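(* A class of graphs is monadically stable if and only if it is flip-wide.
   Context: Graphs are finite and simple. A flip in a graph $G$ is a pair $\mathsf{F}=(A,B)$ with $A,B\subseteq V(G)$; $G\oplus\mathsf{F}$ is the graph on $V(G)$ with edge set $\{uv: uv\in E(G)\text{ xor }(u,v)\in(A\times B)\cup(B\times A)\}$, and for a set $F$ of distinct flips $G\oplus F$ applies all of them successively. A vertex set is distance-$r$ independent if its vertices have pairwise distance greater than $r$. A class $\mathscr{C}$ of graphs is flip-wide if for every $r\in\mathbb{N}$ there are a function $N_r:\mathbb{N}\to\mathbb{N}$ and a constant $s_r\in\mathbb{N}$ such that for all $m\in\mathbb{N}$, $G\in\mathscr{C}$ and $A\subseteq V(G)$ with $|A|\ge N_r(m)$, there exist a set $F$ of at most $s_r$ flips and $B\subseteq A$ with $|B|\ge m$ that is distance-$r$ independent in $G\oplus F$. A class of graphs is monadically stable if for every expansion by unary predicates the resulting class is stable, i.e. no first-order formula $\psi(\bar x,\bar y)$ has, for all $k$, a structure with tuples $\bar a_1,\dots,\bar a_k,\bar b_1,\dots,\bar b_k$ such that $\psi(\bar a_i,\bar b_j)$ iff $i\le j$. *)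

theory Defs
  imports "Graph_Theory.Graph_Theory"
begin

section \<open>Graphs, distances and flips\<close>

text \<open>
  A finite simple graph is a \<open>'v pair_pre_digraph\<close> satisfying \<open>pair_graph\<close> (finite, symmetric,
  loopless); the edge \<open>uv\<close> is represented by the two arcs \<open>(u, v)\<close> and \<open>(v, u)\<close>.
\<close>

text \<open>
  \<open>wf_digraph.\<mu>\<close> is the infimum of the costs of all walks, hence \<open>\<infinity>\<close> between vertices in different
  components. With unit costs it is the usual graph distance.
\<close>

definition graph_dist :: "'v pair_pre_digraph \<Rightarrow> 'v \<Rightarrow> 'v \<Rightarrow> ereal" where
  "graph_dist G u v = wf_digraph.\<mu> (with_proj G) (\<lambda>_. 1) u v"

definition dist_independent :: "'v pair_pre_digraph \<Rightarrow> nat \<Rightarrow> 'v set \<Rightarrow> bool" where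
  "dist_independent G r B \<longleftrightarrow>
     B \<subseteq> pverts G \<and> (\<forall>u\<in>B. \<forall>v\<in>B. u \<noteq> v \<longrightarrow> graph_dist G u v > ereal (real r))"

type_synonym 'v flip = "'v set \<times> 'v set"

definition flips :: "'v pair_pre_digraph \<Rightarrow> 'v flip set" where
  "flips G = Pow (pverts G) \<times> Pow (pverts G)"

text \<open>
  Only pairs \<open>u \<noteq> v\<close> can become adjacent: the result is again a simple graph even if
  \<open>A \<inter> B \<noteq> {}\<close>.
\<close>

definition apply_flip :: "'v pair_pre_digraph \<Rightarrow> 'v flip \<Rightarrow> 'v pair_pre_digraph" where
  "apply_flip G f = (case f of (A, B) \<Rightarrow>
     \<lparr> pverts = pverts G,
       parcs = {(u, v). u \<in> pverts G \<and> v \<in> pverts G \<and> u \<noteq> v \<and>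
                        ((u, v) \<in> parcs G) \<noteq> ((u, v) \<in> A \<times> B \<union> B \<times> A)} \<rparr>)"

text \<open>
  Successive application of a finite set of flips. The order is immaterial, by
  \<open>comp_fun_commute_apply_flip\<close> below, so \<open>Finite_Set.fold\<close> is meaningful here.
\<close>

definition apply_flips :: "'v pair_pre_digraph \<Rightarrow> 'v flip set \<Rightarrow> 'v pair_pre_digraph"
    (infixl "\<oplus>\<^sub>F" 65) where
  "G \<oplus>\<^sub>F F = Finite_Set.fold (\<lambda>f H. apply_flip H f) G F"

lemma comp_fun_commute_apply_flip: "comp_fun_commute (\<lambda>f H. apply_flip H f)"
  by unfold_locales (auto simp: apply_flip_def fun_eq_iff)

lemma apply_flips_empty [simp]: "G \<oplus>\<^sub>F {} = G"
  by (simp add: apply_flips_def)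

lemma apply_flips_insert:
  "finite F \<Longrightarrow> f \<notin> F \<Longrightarrow> G \<oplus>\<^sub>F insert f F = apply_flip (G \<oplus>\<^sub>F F) f"
  by (simp add: apply_flips_def comp_fun_commute_on.fold_insert[OF comp_fun_commute_apply_flip[unfolded comp_fun_commute_def']])

lemma pverts_apply_flip [simp]: "pverts (apply_flip G f) = pverts G"
  by (simp add: apply_flip_def split: prod.split)

lemma pair_graph_apply_flip:
  assumes "pair_graph G"
  shows "pair_graph (apply_flip G f)"
proof -
  interpret pair_graph G by fact
  obtain A B where f: "f = (A, B)" by force
  have "finite (parcs (apply_flip G f))"
    by (rule finite_subset[of _ "pverts G \<times> pverts G"]) (auto simp: f apply_flip_def)
  moreover have "(u, v) \<in> parcs G \<longleftrightarrow> (v, u) \<in> parcs G" for u v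
    using pair_sym_arcs unfolding symmetric_def by (auto dest: symD)
  ultimately show ?thesis
    by unfold_locales
       (auto simp: f apply_flip_def symmetric_def sym_def)
qed

lemma pair_graph_apply_flips:
  assumes "pair_graph G" "finite F"
  shows "pair_graph (G \<oplus>\<^sub>F F)" and "pverts (G \<oplus>\<^sub>F F) = pverts G"
  using assms(2,1)
  by (induction F) (auto simp: apply_flips_insert pair_graph_apply_flip)

definition flip_wide :: "'v pair_pre_digraph set \<Rightarrow> bool" where
  "flip_wide C \<longleftrightarrow>
     (\<forall>r::nat. \<exists>(N :: nat \<Rightarrow> nat) (s :: nat).
        \<forall>m. \<forall>G\<in>C. \<forall>A. A \<subseteq> pverts G \<and> card A \<ge> N m \<longrightarrow>
          (\<exists>F B. F \<subseteq> flips G \<and> finite F \<and> card F \<le> s \<and>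
                 B \<subseteq> A \<and> card B \<ge> m \<and> dist_independent (G \<oplus>\<^sub>F F) r B))"


section \<open>First-order logic over vertex-coloured graphs\<close>

text \<open>
  A unary expansion of a graph interprets the unary predicate symbols \<open>P\<^sub>0, P\<^sub>1, \<dots>\<close> by sets of
  vertices. Every formula mentions only finitely many of them, and an expansion by \<open>n\<close> predicates
  is one in which \<open>P\<^sub>i\<close> is empty for all \<open>i \<ge> n\<close>.
\<close>

type_synonym 'v coloured_graph = "'v pair_pre_digraph \<times> (nat \<Rightarrow> 'v set)"

datatype formula =
    Equal nat nat
  | Adj nat nat
  | Pred nat nat  \<comment> \<open>\<open>Pred i x\<close> stands for \<open>P\<^sub>i(x)\<close>\<close>
  | Neg formula
  | Conj formula formula
  | Exists nat formula

primrec fv :: "formula \<Rightarrow> nat set" where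
  "fv (Equal x y) = {x, y}"
| "fv (Adj x y) = {x, y}"
| "fv (Pred i x) = {x}"
| "fv (Neg \<phi>) = fv \<phi>"
| "fv (Conj \<phi> \<psi>) = fv \<phi> \<union> fv \<psi>"
| "fv (Exists x \<phi>) = fv \<phi> - {x}"

primrec sat :: "'v coloured_graph \<Rightarrow> (nat \<Rightarrow> 'v) \<Rightarrow> formula \<Rightarrow> bool" where
  "sat M e (Equal x y) \<longleftrightarrow> e x = e y"
| "sat M e (Adj x y) \<longleftrightarrow> (e x, e y) \<in> parcs (fst M)"
| "sat M e (Pred i x) \<longleftrightarrow> e x \<in> snd M i"
| "sat M e (Neg \<phi>) \<longleftrightarrow> \<not> sat M e \<phi>"
| "sat M e (Conj \<phi> \<psi>) \<longleftrightarrow> sat M e \<phi> \<and> sat M e \<psi>"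
| "sat M e (Exists x \<phi>) \<longleftrightarrow> (\<exists>v\<in>pverts (fst M). sat M (e(x := v)) \<phi>)"

text \<open>
  A formula \<open>\<psi>(x\<^sub>0,\<dots>,x\<^sub>p\<^sub>-\<^sub>1; y\<^sub>0,\<dots>,y\<^sub>q\<^sub>-\<^sub>1)\<close> uses variable number \<open>i\<close> for \<open>x\<^sub>i\<close> and variable number
  \<open>p + i\<close> for \<open>y\<^sub>i\<close>. So the tuples \<open>a\<close> and \<open>b\<close> are plugged in by the assignment that maps variable
  \<open>n\<close> to the \<open>n\<close>-th entry of \<open>a @ b\<close>; its values for \<open>n \<ge> p + q\<close> are irrelevant because no such
  variable is free in \<open>\<psi>\<close>.
\<close>

definition tuples :: "'v coloured_graph \<Rightarrow> nat \<Rightarrow> 'v list set" where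
  "tuples M n = {a. length a = n \<and> set a \<subseteq> pverts (fst M)}"

definition orders :: "'v coloured_graph \<Rightarrow> formula \<Rightarrow> nat \<Rightarrow> nat \<Rightarrow> nat \<Rightarrow> bool" where
  "orders M \<psi> p q k \<longleftrightarrow>
     (\<exists>a b. (\<forall>i\<in>{1..k}. a i \<in> tuples M p \<and> b i \<in> tuples M q) \<and>
            (\<forall>i\<in>{1..k}. \<forall>j\<in>{1..k}. sat M ((!) (a i @ b j)) \<psi> \<longleftrightarrow> i \<le> j))"

definition stable_class :: "'v coloured_graph set \<Rightarrow> bool" where
  "stable_class D \<longleftrightarrow>
     \<not> (\<exists>\<psi> p q. fv \<psi> \<subseteq> {..<p + q} \<and> (\<forall>k. \<exists>M\<in>D. orders M \<psi> p q k))"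

text \<open>
  \<open>D\<close> arises from \<open>C\<close> by expanding each of its members, possibly in several ways.
\<close>

definition unary_expansion :: "'v coloured_graph set \<Rightarrow> 'v pair_pre_digraph set \<Rightarrow> bool" where
  "unary_expansion D C \<longleftrightarrow> fst ` D = C \<and> (\<forall>(G, P)\<in>D. \<forall>i. P i \<subseteq> pverts G)"

definition monadically_stable :: "'v pair_pre_digraph set \<Rightarrow> bool" where
  "monadically_stable C \<longleftrightarrow> (\<forall>D. unary_expansion D C \<longrightarrow> stable_class D)"

end

theory Submission
  imports Defs "HOL-Library.Ramsey" "HOL-Library.Nat_Bijection"
begin

text \<open>
  From stability to flips, go from distance \<open>2\<rho>\<close> to distance \<open>2\<rho> + 2\<close>. Let the balls of radius
  \<open>\<rho>\<close> around the vertices of a large set be disjoint. By stability the traces of two vertices on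
  these balls agree on all but boundedly many balls or differ on all but boundedly many. Take a
  maximal family of vertices with pairwise mostly different traces. It is bounded, since otherwise a
  unary predicate that marks suitable vertices in the balls defines a long order. So every vertex
  agrees with one of boundedly many sample vertices, up to boundedly many exceptional balls, and the
  flips between the vertices represented by a sample and the neighbourhood of that sample leave only
  exceptional adjacencies. A Ramsey argument thins the set out until every vertex has at most one
  exceptional ball: otherwise there are exceptional vertices that link the balls pairwise, and marking
  some of these links again defines a long order.

  Conversely, an order on tuples yields one on single vertices: by Ramsey's theorem one coordinate
  can be traded for an existential quantifier over a new unary predicate. Among the vertices that one
  tuple is compared with, flip-wideness provides many that are far apart from each other after a few
  flips and that have the same local type. Only boundedly many of them are close to the tuple, and a
  back-and-forth argument shows that the formula cannot distinguish any two of the others.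
\<close>

section \<open>Ramsey arguments\<close>

text \<open>The number of flips may depend on the radius but not on the size \<open>m\<close> of the
  wanted set. So each step derives the number of sample vertices from ladder bounds alone, before
  \<open>m\<close> is fixed; only the cardinalities consumed by the Ramsey arguments depend on
  \<open>m\<close>. Flips are carried through the induction as a relation that depends only on
  membership in \<open>n\<close> sets. This form is closed under symmetric difference at the cost of
  adding the bounds, and with further unary predicates a formula about the original graph can speak
  about adjacency and distance in the flipped one. That is what keeps stability of the original
  class usable after every step. In the converse direction flip-wideness scatters single vertices
  and says nothing about tuples, hence the reduction to one variable. There the colours also undo
  the flips, so that a formula about the original graph can be evaluated in a coloured graph in
  which the chosen vertices are far apart.\<close>

lemma finite_nat_enum:
  fixes Y :: "nat set" assumes "finite Y" "card Y = n"
  obtains g where "strict_mono_on {..<n} g" "g ` {..<n} = Y"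
proof
  let ?g = "\<lambda>i. sorted_list_of_set Y ! i"
  show "strict_mono_on {..<n} ?g"
    using assms by (auto simp: strict_mono_on_def intro!: sorted_wrt_nth_less[OF strict_sorted_list_of_set])
  have "?g ` {..<n} = set (sorted_list_of_set Y)"
    using assms by (force simp: set_conv_nth)
  then show "?g ` {..<n} = Y" using assms by simp
qed

text \<open>The predicates become homogeneous simultaneously by colouring a set with the code of the
  set of predicates that are true on it. The constant value may still differ from predicate to
  predicate.\<close>

lemma ramsey_preds:
  "\<exists>N::nat. \<forall>p :: nat \<Rightarrow> nat set \<Rightarrow> bool. \<exists>Y\<subseteq>{..<N}. card Y = n \<and>
     (\<forall>l<k. \<exists>b. \<forall>S\<in>nsets Y r. p l S = b)"
proof -
  define c where "c p S = set_encode {l. l < k \<and> p l S}" for p :: "nat \<Rightarrow> nat set \<Rightarrow> bool" and S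
  define M where "M = Suc (Max (set_encode ` Pow {..<k}))"
  have c_less: "c p S < M" for p S
    unfolding M_def less_Suc_eq_le by (rule Max_ge) (auto simp: c_def)
  obtain N :: nat where N: "partn_lst {..<N} (replicate M n) r"
    using ramsey_full by blast
  show ?thesis
  proof (rule exI[of _ N], intro allI)
    fix p
    have "c p \<in> nsets {..<N} r \<rightarrow> {..<length (replicate M n)}" using c_less by auto
    then obtain i H where iH: "i < M" "H \<in> nsets {..<N} n" "c p ` (nsets H r) \<subseteq> {i}"
      using N unfolding partn_lst_def monochromatic_def by (metis length_replicate nth_replicate)
    have "\<exists>b. \<forall>S\<in>nsets H r. p l S = b" if "l < k" for l
    proof -
      have "p l S = p l S'" if "S \<in> nsets H r" "S' \<in> nsets H r" for S S'
      proof -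
        have "c p S = c p S'" using iH(3) that by blast
        then have "{l. l < k \<and> p l S} = {l. l < k \<and> p l S'}"
          unfolding c_def by (simp add: inj_on_eq_iff[OF inj_on_set_encode])
        then show ?thesis using \<open>l < k\<close> by blast
      qed
      then show ?thesis by blast
    qed
    then show "\<exists>Y\<subseteq>{..<N}. card Y = n \<and> (\<forall>l<k. \<exists>b. \<forall>S\<in>nsets Y r. p l S = b)"
      using iH(2) by (intro exI[of _ H]) (auto simp: nsets_def)
  qed
qed

text \<open>A half graph. Rows and columns range over whole types, so membership conditions are
  placed inside \<open>R\<close>, where the diagonal entries enforce them. The index range agrees
  with \<open>orders\<close>.\<close>

definition ladder :: "nat \<Rightarrow> ('a \<Rightarrow> 'b \<Rightarrow> bool) \<Rightarrow> bool" where
  "ladder h R \<longleftrightarrow> (\<exists>a b. \<forall>i\<in>{1..h}. \<forall>j\<in>{1..h}. R (a i) (b j) \<longleftrightarrow> i \<le> j)"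

lemma ladder_reverse:
  assumes "\<And>i j. i < h \<Longrightarrow> j < h \<Longrightarrow> R (a i) (b j) \<longleftrightarrow> j \<le> i"
  shows "ladder h R"
  unfolding ladder_def
proof (intro exI ballI)
  fix i j assume "i \<in> {1..h}" "j \<in> {1..h}"
  then show "R (a (h - i)) (b (h - j)) \<longleftrightarrow> i \<le> j"
    using assms[of "h - i" "h - j"] by auto
qed

lemma ladder_shift:
  assumes "\<And>i j. i < h \<Longrightarrow> j < h \<Longrightarrow> R (a i) (b j) \<longleftrightarrow> i \<le> j"
  shows "ladder h R"
  unfolding ladder_def
proof (intro exI ballI)
  fix i j assume "i \<in> {1..h}" "j \<in> {1..h}"
  then have "R (a (i - 1)) (b (j - 1)) \<longleftrightarrow> i - 1 \<le> j - 1" and "1 \<le> i" "1 \<le> j"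
    using assms[of "i - 1" "j - 1"] by auto
  then show "R (a (i - 1)) (b (j - 1)) \<longleftrightarrow> i \<le> j" by linarith
qed

lemma card_less_strict_mono:
  fixes g :: "nat \<Rightarrow> nat"
  assumes "strict_mono_on {..<n} g" "s + m \<le> n" "i < m"
  shows "card {j \<in> g ` {s..<s+m}. j < g (s + i)} = i"
proof -
  have "{j \<in> g ` {s..<s+m}. j < g (s + i)} = g ` {s..<s+i}"
    using assms strict_mono_on_less[OF assms(1)] by auto
  moreover have "inj_on g {s..<s+i}"
    using assms by (intro inj_on_subset[OF strict_mono_on_imp_inj_on[OF assms(1)]]) auto
  ultimately show ?thesis by (simp add: card_image)
qed

text \<open>The \<open>h\<close>-th smallest of \<open>2 * h\<close> elements of \<open>P\<close>
  serves as threshold. On one side of it there are \<open>h\<close> elements of \<open>Q\<close>,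
  and \<open>h\<close> elements of \<open>P\<close> are available on the other side.\<close>

lemma half_split:
  fixes P Q :: "nat set"
  assumes "finite P" "finite Q" "2 * h \<le> card P" "2 * h \<le> card Q"
  obtains X Y where "X \<subseteq> P" "Y \<subseteq> Q" "card X = h" "card Y = h"
    "(\<forall>x\<in>X. \<forall>y\<in>Y. x < y) \<or> (\<forall>x\<in>X. \<forall>y\<in>Y. y \<le> x)"
proof (cases "h = 0")
  case True
  then show ?thesis using that[of "{}" "{}"] by simp
next
  case False
  obtain P1 where P1: "P1 \<subseteq> P" "card P1 = 2*h" using assms by (meson obtain_subset_with_card_n)
  have "finite P1" using P1 assms finite_subset by blast
  obtain g where g: "strict_mono_on {..<2*h} g" "g ` {..<2*h} = P1"
    using finite_nat_enum[OF \<open>finite P1\<close> P1(2)] by blast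
  have gi: "inj_on g A" if "A \<subseteq> {..<2*h}" for A
    using strict_mono_on_imp_inj_on[OF g(1)] that inj_on_subset by blast
  let ?t = "g (h-1)"
  have lo: "g i \<le> ?t" if "i < h" for i
    using that strict_mono_on_leD[OF g(1), of i "h-1"] by auto
  have hi: "?t < g i" if "h \<le> i" "i < 2*h" for i
    using that False strict_mono_onD[OF g(1), of "h-1" i] by auto
  have "Q = {y\<in>Q. y \<le> ?t} \<union> {y\<in>Q. ?t < y}" by auto
  then have "card Q \<le> card {y\<in>Q. y \<le> ?t} + card {y\<in>Q. ?t < y}"
    by (metis card_Un_le)
  then consider "h \<le> card {y\<in>Q. y \<le> ?t}" | "h \<le> card {y\<in>Q. ?t < y}"
    using assms by linarith
  then show ?thesis
  proof cases
    case 1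
    then obtain Y where "Y \<subseteq> {y\<in>Q. y \<le> ?t}" "card Y = h" by (meson obtain_subset_with_card_n)
    moreover have "card (g ` {h..<2*h}) = h" by (subst card_image[OF gi]) auto
    moreover have "g ` {h..<2*h} \<subseteq> P" using g P1 by auto
    ultimately show ?thesis using hi
      by (intro that[of "g ` {h..<2*h}" Y]) fastforce+
  next
    case 2
    then obtain Y where "Y \<subseteq> {y\<in>Q. ?t < y}" "card Y = h" by (meson obtain_subset_with_card_n)
    moreover have "card (g ` {..<h}) = h" by (subst card_image[OF gi]) auto
    moreover have "g ` {..<h} \<subseteq> P" using g P1 by auto
    ultimately show ?thesis using lo
      by (intro that[of "g ` {..<h}" Y]) fastforce+
  qed
qed

lemma card_below_split:
  fixes X Y :: "nat set"
  assumes "finite X" "finite Y" "card X = h" "\<forall>x\<in>X. \<forall>y\<in>Y. x < y"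
  shows "x \<in> X \<Longrightarrow> card {j \<in> X \<union> Y. j < x} < h" "y \<in> Y \<Longrightarrow> h \<le> card {j \<in> X \<union> Y. j < y}"
proof -
  assume x: "x \<in> X"
  have "{j \<in> X \<union> Y. j < x} \<subseteq> X - {x}" using assms(4) x less_asym by blast
  then have "card {j \<in> X \<union> Y. j < x} \<le> card (X - {x})" using assms(1) by (intro card_mono) auto
  also have "\<dots> < card X" using assms(1) x by (rule card_Diff1_less)
  finally show "card {j \<in> X \<union> Y. j < x} < h" using assms(3) by simp
next
  assume y: "y \<in> Y"
  have "X \<subseteq> {j \<in> X \<union> Y. j < y}" using assms(4) y by blast
  then have "card X \<le> card {j \<in> X \<union> Y. j < y}" using assms(1,2) by (intro card_mono) auto
  then show "h \<le> card {j \<in> X \<union> Y. j < y}" using assms(3) by simp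
qed

text \<open>In a homogeneous set, a window of \<open>2h\<close> consecutive elements realising the pattern
  \<open>1\<^sup>h0\<^sup>h\<close> can be shifted along the set; the shifts cut a fixed block of \<open>h\<close> elements at
  every position.\<close>

lemma stable_indivisible:
  "\<exists>N::nat. \<forall>\<delta> :: nat \<Rightarrow> 'b \<Rightarrow> bool. \<not> ladder h (\<lambda>i b. i < N \<and> \<delta> i b) \<longrightarrow>
     (\<exists>I\<subseteq>{..<N}. card I = n \<and> (\<forall>b. card {i\<in>I. \<delta> i b} < 2*h \<or> card {i\<in>I. \<not> \<delta> i b} < 2*h))"
proof -
  \<comment> \<open>For \<open>l = 0\<close> some column is true on exactly the first half of
    \<open>S\<close>, for \<open>l = 1\<close> on exactly the second half.\<close>
  define p where "p \<delta> l S = (\<exists>b. \<forall>i\<in>S. (\<delta> i b \<longleftrightarrow> ((card {j\<in>S. j < i} < h) \<longleftrightarrow> (l = (0::nat)))))"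
    for \<delta> :: "nat \<Rightarrow> 'b \<Rightarrow> bool" and l S
  \<comment> \<open>The windows of \<open>2 * h\<close> elements that start at positions 0 to
    \<open>h\<close> fit into \<open>3 * h\<close> elements.\<close>
  from ramsey_preds[of "n + 3*h" 2 "2*h"] obtain N where
    N: "\<forall>p :: nat \<Rightarrow> nat set \<Rightarrow> bool. \<exists>Y\<subseteq>{..<N}. card Y = n + 3*h \<and>
     (\<forall>l<2. \<exists>b. \<forall>S\<in>nsets Y (2*h). p l S = b)" ..
  show ?thesis
  proof (rule exI[of _ N], intro allI impI)
    fix \<delta> :: "nat \<Rightarrow> 'b \<Rightarrow> bool" assume nl: "\<not> ladder h (\<lambda>i b. i < N \<and> \<delta> i b)"
    from N[THEN spec, of "p \<delta>"]
    obtain Y where Y: "Y \<subseteq> {..<N}" "card Y = n + 3*h"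
       and hom: "\<forall>l<2. \<exists>b. \<forall>S\<in>nsets Y (2*h). p \<delta> l S = b"
      by (elim exE conjE)
    have "finite Y" using Y finite_subset by blast
    obtain g where g: "strict_mono_on {..<n+3*h} g" "g ` {..<n+3*h} = Y"
      using finite_nat_enum[OF \<open>finite Y\<close> Y(2)] by blast
    have gN: "g i < N" if "i < n + 3*h" for i using g Y that by blast
    have window: "\<exists>b. \<forall>i<2*h. \<delta> (g (s+i)) b \<longleftrightarrow> (i < h \<longleftrightarrow> l = 0)"
      if all: "\<forall>S\<in>nsets Y (2*h). p \<delta> l S" and s: "s \<le> h" for s l
    proof -
      have "inj_on g {s..<s+2*h}"
        using s by (intro inj_on_subset[OF strict_mono_on_imp_inj_on[OF g(1)]]) auto
      then have "card (g ` {s..<s+2*h}) = 2*h" by (simp add: card_image)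
      moreover have "g ` {s..<s+2*h} \<subseteq> Y" using g(2) s by auto
      ultimately have "p \<delta> l (g ` {s..<s+2*h})" using all by (auto simp: nsets_def)
      then obtain b where b: "\<forall>i\<in>g ` {s..<s+2*h}. \<delta> i b \<longleftrightarrow>
          ((card {j\<in>g ` {s..<s+2*h}. j < i} < h) \<longleftrightarrow> l = 0)" unfolding p_def by blast
      have "\<delta> (g (s+i)) b \<longleftrightarrow> (i < h \<longleftrightarrow> l = 0)" if "i < 2*h" for i
        using b[rule_format, of "g (s+i)"] card_less_strict_mono[OF g(1), of s "2*h" i] that s by auto
      then show ?thesis by blast
    qed
    have no: "\<forall>S\<in>nsets Y (2*h). \<not> p \<delta> l S" if "l < 2" for l
    proof (rule ccontr)
      assume "\<not> ?thesis"
      then have "\<forall>S\<in>nsets Y (2*h). p \<delta> l S" using hom that by metis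
      from window[OF this] obtain b where
        b: "\<And>s i. s \<le> h \<Longrightarrow> i < 2*h \<Longrightarrow> \<delta> (g (s+i)) (b s) \<longleftrightarrow> (i < h \<longleftrightarrow> l = 0)" by metis
      \<comment> \<open>All windows share the positions from \<open>h\<close> to
        \<open>2 * h - 1\<close>; the window that starts at \<open>j\<close> changes its value after
        \<open>j\<close> of them.\<close>
      have *: "(g (h+i) < N \<and> \<delta> (g (h + i)) (b j)) \<longleftrightarrow> (i < j \<longleftrightarrow> l = 0)" if "i < h" "j \<le> h" for i j
        using b[of j "h+i-j"] that gN[of "h+i"] by auto
      have "ladder h (\<lambda>i b. i < N \<and> \<delta> i b)"
      proof (cases "l = 0")
        case True
        have "(g (h+i) < N \<and> \<delta> (g (h+i)) (b (Suc j))) \<longleftrightarrow> i \<le> j" if "i < h" "j < h" for i j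
          using *[of i "Suc j"] that True by auto
        then show ?thesis by (rule ladder_shift)
      next
        case False
        have "(g (h+i) < N \<and> \<delta> (g (h+i)) (b j)) \<longleftrightarrow> j \<le> i" if "i < h" "j < h" for i j
          using *[of i j] that False by auto
        then show ?thesis by (rule ladder_reverse)
      qed
      then show False using nl by blast
    qed
    \<comment> \<open>A column with \<open>2 * h\<close> elements of either value would realise one
      of the two patterns: \<open>half_split\<close> picks \<open>h\<close> elements of each value,
      those of one value entirely below the others.\<close>
    have split: "card {i\<in>Y. \<delta> i b} < 2*h \<or> card {i\<in>Y. \<not> \<delta> i b} < 2*h" for b
    proof (rule ccontr)
      assume "\<not> ?thesis"
      then have "2*h \<le> card {i\<in>Y. \<delta> i b}" "2*h \<le> card {i\<in>Y. \<not> \<delta> i b}" by auto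
      then obtain X Z where XZ: "X \<subseteq> {i\<in>Y. \<delta> i b}" "Z \<subseteq> {i\<in>Y. \<not> \<delta> i b}" "card X = h" "card Z = h"
        and lt: "(\<forall>x\<in>X. \<forall>y\<in>Z. x < y) \<or> (\<forall>x\<in>X. \<forall>y\<in>Z. y \<le> x)"
        using half_split[of "{i\<in>Y. \<delta> i b}" "{i\<in>Y. \<not> \<delta> i b}" h] \<open>finite Y\<close> by auto
      have fin: "finite X" "finite Z" using XZ \<open>finite Y\<close> finite_subset by fastforce+
      have "X \<inter> Z = {}" using XZ by auto
      then have "card (X \<union> Z) = 2*h" using fin XZ by (simp add: card_Un_disjoint)
      then have XZn: "X \<union> Z \<in> nsets Y (2*h)" using XZ fin by (auto simp: nsets_def)
      from lt show False
      proof
        assume lt: "\<forall>x\<in>X. \<forall>y\<in>Z. x < y"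
        have "p \<delta> 0 (X \<union> Z)" unfolding p_def
          using card_below_split[OF fin XZ(3) lt] XZ(1,2) by (intro exI[of _ b]) fastforce
        then show False using no[of 0] XZn by auto
      next
        assume "\<forall>x\<in>X. \<forall>y\<in>Z. y \<le> x"
        then have lt: "\<forall>y\<in>Z. \<forall>x\<in>X. y < x" using \<open>X \<inter> Z = {}\<close> by (metis disjoint_iff le_neq_implies_less)
        have "p \<delta> 1 (Z \<union> X)" unfolding p_def
          using card_below_split[OF fin(2,1) XZ(4) lt] XZ(1,2) by (intro exI[of _ b]) fastforce
        then show False using no[of 1] XZn by (auto simp: Un_commute)
      qed
    qed
    have "n \<le> card Y" using Y(2) by simp
    then obtain I where I: "I \<subseteq> Y" "card I = n" by (meson obtain_subset_with_card_n)
    have "card {i\<in>I. Q i} \<le> card {i\<in>Y. Q i}" for Q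
      using I \<open>finite Y\<close> by (intro card_mono) auto
    then show "\<exists>I\<subseteq>{..<N}. card I = n \<and> (\<forall>b. card {i\<in>I. \<delta> i b} < 2*h \<or> card {i\<in>I. \<not> \<delta> i b} < 2*h)"
      using split I Y by (intro exI[of _ I] conjI allI) (blast, blast, metis le_less_trans)
  qed
qed

section \<open>Counting arguments: separated families, free sets and exceptional links\<close>

lemma pigeonhole_fibre:
  assumes "finite I" "finite T" "f ` I \<subseteq> T" "card T * h < card I"
  obtains y where "y \<in> T" "h < card {i\<in>I. f i = y}"
proof (rule ccontr)
  assume "\<not> thesis"
  then have le: "\<forall>y\<in>T. card {i\<in>I. f i = y} \<le> h" using that by (meson not_le)
  have "I \<subseteq> (\<Union>y\<in>T. {i\<in>I. f i = y})" using assms by auto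
  then have "card I \<le> card (\<Union>y\<in>T. {i\<in>I. f i = y})" using assms by (intro card_mono) auto
  also have "\<dots> \<le> (\<Sum>y\<in>T. card {i\<in>I. f i = y})" by (rule card_UN_le) fact
  also have "\<dots> \<le> card T * h" using sum_bounded_above[of T _ h] le by auto
  finally show False using assms by simp
qed

text \<open>Some \<open>u\<close> splits \<open>X\<close>; the larger class is kept, and one point
  of the other class is recorded. The survivor \<open>z\<close> of all \<open>h\<close> rounds is
  always in the kept class, so the point recorded in round \<open>j\<close> differs from it at
  \<open>u j\<close> and agrees with it at all earlier \<open>u m\<close>. This triangular pattern
  becomes the ladder of \<open>separated_ladder\<close>.\<close>

lemma halving:
  assumes "finite X" "2 ^ h \<le> card X" "\<And>x y. x \<in> X \<Longrightarrow> y \<in> X \<Longrightarrow> x \<noteq> y \<Longrightarrow> \<exists>u\<in>U. f u x \<noteq> f u y"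
  shows "\<exists>y u z. z \<in> X \<and> (\<forall>j<h. y j \<in> X \<and> u j \<in> U \<and> f (u j) (y j) \<noteq> (f (u j) z :: bool) \<and>
           (\<forall>m<j. f (u m) (y j) = f (u m) z))"
  using assms
proof (induction h arbitrary: X)
  case 0
  then have "X \<noteq> {}" by auto
  then show ?case by auto
next
  case (Suc h)
  have "1 < card X" using Suc.prems(2) by (metis less_le_trans one_less_numeral_iff one_less_power semiring_norm(76) zero_less_Suc)
  then obtain x y where xy: "x \<in> X" "y \<in> X" "x \<noteq> y"
    by (metis card_le_Suc0_iff_eq not_le One_nat_def Suc.prems(1))
  then obtain u0 where u0: "u0 \<in> U" "f u0 x \<noteq> f u0 y" using Suc.prems(3) by blast
  define P where "P b = {a\<in>X. f u0 a = b}" for b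
  have P: "X = P True \<union> P False" "P True \<inter> P False = {}" by (auto simp: P_def)
  have finP: "finite (P b)" for b using Suc.prems(1) by (simp add: P_def)
  have "card X = card (P True) + card (P False)"
    using card_Un_disjoint[OF finP finP P(2)] P(1) by metis
  then have "2 ^ h \<le> card (P True) \<or> 2 ^ h \<le> card (P False)" using Suc.prems(2) by auto
  then obtain b where b: "2 ^ h \<le> card (P b)" by blast
  have "P (\<not> b) \<noteq> {}" using u0 xy by (cases b) (auto simp: P_def)
  then obtain y0 where y0: "y0 \<in> P (\<not> b)" by blast
  have sub: "P b \<subseteq> X" by (auto simp: P_def)
  have sep: "\<exists>u\<in>U. f u x \<noteq> f u y" if "x \<in> P b" "y \<in> P b" "x \<noteq> y" for x y
    using Suc.prems(3) that sub by blast
  have "\<exists>y u z. z \<in> P b \<and> (\<forall>j<h. y j \<in> P b \<and> u j \<in> U \<and> f (u j) (y j) \<noteq> f (u j) z \<and>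
           (\<forall>m<j. f (u m) (y j) = f (u m) z))"
    by (rule Suc.IH[OF finP b]) (rule sep)
  then obtain y' u' z where
    IH: "z \<in> P b" "\<forall>j<h. y' j \<in> P b \<and> u' j \<in> U \<and> f (u' j) (y' j) \<noteq> f (u' j) z \<and>
           (\<forall>m<j. f (u' m) (y' j) = f (u' m) z)"
    by (elim exE conjE)
  define y where "y = case_nat y0 y'"
  define u where "u = case_nat u0 u'"
  have "y j \<in> X \<and> u j \<in> U \<and> f (u j) (y j) \<noteq> f (u j) z \<and> (\<forall>m<j. f (u m) (y j) = f (u m) z)" if "j < Suc h" for j
  proof (cases j)
    case 0
    then show ?thesis using y0 u0 IH(1) by (auto simp: y_def u_def P_def)
  next
    case (Suc i)
    then have i: "i < h" using that by simp
    have "f (u m) (y j) = f (u m) z" if "m < j" for m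
      using IH(1) IH(2)[rule_format, OF i] that Suc by (cases m) (auto simp: u_def y_def P_def)
    then show ?thesis using IH(2)[rule_format, OF i] sub Suc by (auto simp: u_def y_def)
  qed
  then show ?case using IH(1) sub by blast
qed

lemma six_choose_three: "6 * (k + 3 choose 3) = (k + 1) * (k + 2) * (k + 3)"
proof (induction k)
  case (Suc k)
  have "Suc k + 3 choose 3 = (k + 3 choose 2) + (k + 3 choose 3)"
    by (simp add: numeral_3_eq_3 numeral_2_eq_2)
  moreover have "2 * (k + 3 choose 2) = (k + 3) * (k + 2)"
    by (simp add: choose_two)
  ultimately show ?case using Suc by (simp add: algebra_simps)
qed simp

text \<open>Triples are coloured by whether one point lies in the set assigned to the other two.
  Each of the \<open>m * m\<close> pairs of a homogeneous set of size \<open>m\<close> spoils at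
  most \<open>c\<close> triples, too few to spoil all triples, so no triple in it is
  spoiled.\<close>

lemma free_set:
  "\<exists>N::nat. \<forall>f :: nat \<Rightarrow> nat \<Rightarrow> nat set. (\<forall>x<N. \<forall>y<N. card (f x y \<inter> {..<N}) \<le> c) \<longrightarrow>
     (\<exists>Y\<subseteq>{..<N}. card Y = n \<and> (\<forall>x\<in>Y. \<forall>y\<in>Y. x \<noteq> y \<longrightarrow> f x y \<inter> Y \<subseteq> {x, y}))"
proof -
  \<comment> \<open>With \<open>m = k + 3\<close>, spoiling all triples would mean
    \<open>(k+1)(k+2) \<le> 6c(k+3)\<close>. This fails as soon as \<open>6c \<le> k\<close>,
    because \<open>(k+1)(k+2)\<close> exceeds \<open>k(k+3)\<close>.\<close>
  define m where "m = n + 6*c + 1 + 3"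
  from ramsey_preds[of m 1 3] obtain N where N: "\<forall>p :: nat \<Rightarrow> nat set \<Rightarrow> bool. \<exists>Y\<subseteq>{..<N}. card Y = m \<and>
     (\<forall>l<1. \<exists>b. \<forall>S\<in>nsets Y 3. p l S = b)" ..
  show ?thesis
  proof (rule exI[of _ N], intro allI impI)
    fix f :: "nat \<Rightarrow> nat \<Rightarrow> nat set" assume c: "\<forall>x<N. \<forall>y<N. card (f x y \<inter> {..<N}) \<le> c"
    define p where "p S = (\<exists>x y z. S = {x,y,z} \<and> z \<in> f x y)" for S
    from N[THEN spec, of "\<lambda>_. p"] obtain Y where Y: "Y \<subseteq> {..<N}" "card Y = m"
      and "\<forall>l<1::nat. \<exists>b. \<forall>S\<in>nsets Y 3. p S = b" by (elim exE conjE)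
    then have "\<exists>b. \<forall>S\<in>nsets Y 3. p S = b" by simp
    then obtain b where b: "\<And>S. S \<in> nsets Y 3 \<Longrightarrow> p S = b" by blast
    have finY: "finite Y" using Y finite_subset by blast
    have "\<not> b"
    proof
      assume b
      let ?T = "Sigma (Y \<times> Y) (\<lambda>(x,y). f x y \<inter> Y)"
      have finT: "finite ?T" using finY by auto
      have "nsets Y 3 \<subseteq> (\<lambda>((x,y),z). {x,y,z}) ` ?T"
      proof
        fix S assume S: "S \<in> nsets Y 3"
        then have "p S" using b \<open>b\<close> by simp
        then obtain x y z where xyz: "S = {x,y,z}" "z \<in> f x y" unfolding p_def by blast
        moreover have "S \<subseteq> Y" using S by (auto simp: nsets_def)
        ultimately have "((x,y),z) \<in> ?T" by auto
        then show "S \<in> (\<lambda>((x,y),z). {x,y,z}) ` ?T" using xyz(1) by (intro image_eqI[of _ _ "((x,y),z)"]) auto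
      qed
      then have "card (nsets Y 3) \<le> card ?T"
        by (rule surj_card_le[OF finT])
      also have "card ?T = (\<Sum>(x,y)\<in>Y \<times> Y. card (f x y \<inter> Y))"
        using finY by (subst card_SigmaI) (auto simp: split_def)
      also have "\<dots> \<le> (\<Sum>(x,y)\<in>Y \<times> Y. c)"
      proof (rule sum_mono, clarify)
        fix x y assume "x \<in> Y" "y \<in> Y"
        have "card (f x y \<inter> Y) \<le> card (f x y \<inter> {..<N})" using Y by (intro card_mono) auto
        also have "\<dots> \<le> c" using c Y \<open>x \<in> Y\<close> \<open>y \<in> Y\<close> by blast
        finally show "card (f x y \<inter> Y) \<le> c" .
      qed
      also have "\<dots> = m * m * c" using Y by (simp add: split_def card_cartesian_product)
      finally have "6 * (m choose 3) \<le> 6 * (m * m * c)" using Y by simp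
      moreover define k where "k = n + 6*c + 1"
      moreover have "m = k + 3" by (simp add: m_def k_def)
      ultimately have *: "(k + 1) * (k + 2) * (k + 3) \<le> (k+3) * ((k+3) * (6 * c))"
        using six_choose_three[of k] by (simp add: algebra_simps)
      then have "(k+3) * ((k + 1) * (k + 2)) \<le> (k+3) * ((k+3) * (6 * c))" by (simp only: ac_simps)
      then have "(k + 1) * (k + 2) \<le> (k+3) * (6 * c)" by (subst (asm) mult_le_cancel1) simp
      also have "\<dots> \<le> (k+3) * k" unfolding k_def by (intro mult_left_mono) auto
      finally show False by (simp add: algebra_simps)
    qed
    have "n \<le> card Y" using Y(2) by (simp add: m_def)
    then obtain Z where Z: "Z \<subseteq> Y" "card Z = n" by (meson obtain_subset_with_card_n)
    have "f x y \<inter> Z \<subseteq> {x, y}" if "x \<in> Z" "y \<in> Z" "x \<noteq> y" for x y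
    proof
      fix z assume z: "z \<in> f x y \<inter> Z"
      show "z \<in> {x,y}"
      proof (rule ccontr)
        assume "z \<notin> {x,y}"
        then have "{x,y,z} \<in> nsets Y 3" using that z Z by (auto simp: nsets_def card_insert_if)
        then have "\<not> p {x,y,z}" using b \<open>\<not> b\<close> by simp
        then show False using z unfolding p_def by blast
      qed
    qed
    then show "\<exists>Y\<subseteq>{..<N}. card Y = n \<and> (\<forall>x\<in>Y. \<forall>y\<in>Y. x \<noteq> y \<longrightarrow> f x y \<inter> Y \<subseteq> {x, y})"
      using Z Y by (intro exI[of _ Z]) auto
  qed
qed

text \<open>A subdivided complete bipartite graph with sides \<open>a\<close> and \<open>b\<close>
  and subdivision vertices \<open>w\<close>. Selecting some of the vertices \<open>w\<close> encodes
  any bipartite graph between the sides, in particular a half graph.\<close>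

definition link_grid ::
  "nat \<Rightarrow> 'v set \<Rightarrow> ('v \<Rightarrow> nat \<Rightarrow> bool) \<Rightarrow> nat \<Rightarrow> (nat \<Rightarrow> nat) \<Rightarrow> (nat \<Rightarrow> nat) \<Rightarrow> (nat \<Rightarrow> nat \<Rightarrow> 'v) \<Rightarrow> bool" where
  "link_grid N V \<zeta> h a b w \<longleftrightarrow> (\<forall>x<h. \<forall>y<h. a x < N \<and> b x < N \<and> w x y \<in> V \<and>
     (\<forall>x'<h. \<forall>y'<h. \<zeta> (w x' y') (a x) \<and> \<zeta> (w x' y') (b y) \<longleftrightarrow> x = x' \<and> y = y'))"

text \<open>Pairs of indices are coloured by whether some vertex is exceptional for both. If no pair
  of a homogeneous set is linked, its indices are as required. If all pairs are linked, one link is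
  chosen for each pair; a link is exceptional for at most \<open>c\<close> indices, so
  \<open>free_set\<close> yields \<open>2 * h\<close> indices among which each link meets only its
  own two. The first \<open>h\<close> of them become rows, the others columns.\<close>

lemma sparse_or_grid:
  "\<exists>N::nat. \<forall>(\<zeta> :: 'v \<Rightarrow> nat \<Rightarrow> bool) V. (\<forall>v\<in>V. card {i. i < N \<and> \<zeta> v i} \<le> c) \<longrightarrow>
     (\<exists>I\<subseteq>{..<N}. card I = m \<and> (\<forall>v\<in>V. \<forall>i\<in>I. \<forall>j\<in>I. \<zeta> v i \<longrightarrow> \<zeta> v j \<longrightarrow> i = j)) \<or>
     (\<exists>a b w. link_grid N V \<zeta> h a b w)"
proof -
  from free_set[of c "2*h"] obtain M where M: "\<forall>f :: nat \<Rightarrow> nat \<Rightarrow> nat set.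
     (\<forall>x<M. \<forall>y<M. card (f x y \<inter> {..<M}) \<le> c) \<longrightarrow>
     (\<exists>Y\<subseteq>{..<M}. card Y = 2*h \<and> (\<forall>x\<in>Y. \<forall>y\<in>Y. x \<noteq> y \<longrightarrow> f x y \<inter> Y \<subseteq> {x, y}))" ..
  from ramsey_preds[of "m+M" 1 2] obtain N where N: "\<forall>p :: nat \<Rightarrow> nat set \<Rightarrow> bool. \<exists>Y\<subseteq>{..<N}. card Y = m+M \<and>
     (\<forall>l<1. \<exists>b. \<forall>S\<in>nsets Y 2. p l S = b)" ..
  show ?thesis
  proof (rule exI[of _ N], intro allI impI)
    fix \<zeta> :: "'v \<Rightarrow> nat \<Rightarrow> bool" and V assume c: "\<forall>v\<in>V. card {i. i < N \<and> \<zeta> v i} \<le> c"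
    define p where "p S = (\<exists>x y. \<exists>v\<in>V. S = {x,y} \<and> x \<noteq> y \<and> \<zeta> v x \<and> \<zeta> v y)" for S
    from N[THEN spec, of "\<lambda>_. p"] obtain Y where Y: "Y \<subseteq> {..<N}" "card Y = m+M"
      and "\<forall>l<1::nat. \<exists>b. \<forall>S\<in>nsets Y 2. p S = b" by (elim exE conjE)
    then have "\<exists>b. \<forall>S\<in>nsets Y 2. p S = b" by simp
    then obtain \<beta> where \<beta>: "\<And>S. S \<in> nsets Y 2 \<Longrightarrow> p S = \<beta>" by blast
    have finY: "finite Y" using Y finite_subset by blast
    show "(\<exists>I\<subseteq>{..<N}. card I = m \<and> (\<forall>v\<in>V. \<forall>i\<in>I. \<forall>j\<in>I. \<zeta> v i \<longrightarrow> \<zeta> v j \<longrightarrow> i = j)) \<or>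
     (\<exists>a b w. link_grid N V \<zeta> h a b w)"
    proof (cases \<beta>)
      case False
      have "m \<le> card Y" using Y(2) by simp
      then obtain Z where Z: "Z \<subseteq> Y" "card Z = m" by (meson obtain_subset_with_card_n)
      have "i = j" if "v \<in> V" "i \<in> Z" "j \<in> Z" "\<zeta> v i" "\<zeta> v j" for v i j
      proof (rule ccontr)
        assume "i \<noteq> j"
        then have "{i,j} \<in> nsets Y 2" using that Z by auto
        then have "\<not> p {i,j}" using \<beta> False by simp
        then show False using that \<open>i \<noteq> j\<close> unfolding p_def by blast
      qed
      then show ?thesis using Z Y by (intro disjI1 exI[of _ Z]) auto
    next
      case True
      obtain g where g: "strict_mono_on {..<m+M} g" "g ` {..<m+M} = Y"
        using finite_nat_enum[OF finY Y(2)] by blast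
      have ginj: "g x = g y \<longleftrightarrow> x = y" if "x < M" "y < M" for x y
        using strict_mono_on_eqD[OF g(1), of x y] that by auto
      have gN: "g x < N" "g x \<in> Y" if "x < M" for x
      proof -
        show "g x \<in> Y" using g that by auto
        then show "g x < N" using Y by auto
      qed
      have ex: "\<exists>v\<in>V. \<zeta> v (g x) \<and> \<zeta> v (g y)" if "x < M" "y < M" "x \<noteq> y" for x y
      proof -
        have "{g x, g y} \<in> nsets Y 2" using that ginj gN by auto
        then have "p {g x, g y}" using \<beta> True by simp
        then show ?thesis unfolding p_def by (auto simp: doubleton_eq_iff)
      qed
      define w where "w x y = (SOME v. v \<in> V \<and> \<zeta> v (g x) \<and> \<zeta> v (g y))" for x y
      have w: "w x y \<in> V" "\<zeta> (w x y) (g x)" "\<zeta> (w x y) (g y)" if "x < M" "y < M" "x \<noteq> y" for x y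
        using someI_ex[of "\<lambda>v. v \<in> V \<and> \<zeta> v (g x) \<and> \<zeta> v (g y)"] ex[OF that] unfolding w_def by auto
      define f where "f x y = (if x = y then {} else {z. z < M \<and> \<zeta> (w x y) (g z)})" for x y
      have "card (f x y \<inter> {..<M}) \<le> c" if "x < M" "y < M" for x y
      proof (cases "x = y")
        case False
        have inj: "inj_on g (f x y)" using ginj by (auto simp: f_def inj_on_def)
        have "g ` f x y \<subseteq> {i. i < N \<and> \<zeta> (w x y) i}" using gN by (auto simp: f_def split: if_splits)
        then have "card (g ` f x y) \<le> card {i. i < N \<and> \<zeta> (w x y) i}" by (intro card_mono) auto
        also have "\<dots> \<le> c" using c w(1)[OF that False] by blast
        also have "f x y \<inter> {..<M} = f x y" by (auto simp: f_def)
        ultimately show ?thesis by (simp add: card_image[OF inj])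
      qed (simp add: f_def)
      then have "\<forall>x<M. \<forall>y<M. card (f x y \<inter> {..<M}) \<le> c" by blast
      from mp[OF spec[OF M] this] obtain Z where Z: "Z \<subseteq> {..<M}" "card Z = 2*h"
         and free: "\<forall>x\<in>Z. \<forall>y\<in>Z. x \<noteq> y \<longrightarrow> f x y \<inter> Z \<subseteq> {x, y}"
        by (elim exE conjE)
      obtain k where k: "strict_mono_on {..<2*h} k" "k ` {..<2*h} = Z"
        using finite_nat_enum[OF _ Z(2)] Z finite_subset by blast
      have kinj: "k x = k y \<longleftrightarrow> x = y" if "x < 2*h" "y < 2*h" for x y
        using strict_mono_on_eqD[OF k(1), of x y] that by auto
      have kZ: "k x \<in> Z" "k x < M" if "x < 2*h" for x using k Z that by auto
      define a where "a x = g (k x)" for x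
      define b where "b y = g (k (h + y))" for y
      define w' where "w' x y = w (k x) (k (h + y))" for x y
      have "\<zeta> (w' x' y') (g (k t)) \<longleftrightarrow> t = x' \<or> t = h + y'" if "x' < h" "y' < h" "t < 2*h" for x' y' t
      proof -
        have ne: "k x' \<noteq> k (h + y')" using that kinj by auto
        have "\<zeta> (w' x' y') (g (k t)) \<longleftrightarrow> k t \<in> f (k x') (k (h + y'))"
          using that kZ ne by (auto simp: w'_def f_def)
        moreover have "k t \<in> f (k x') (k (h + y')) \<Longrightarrow> k t = k x' \<or> k t = k (h + y')"
          using free[rule_format, OF kZ(1) kZ(1) ne] kZ(1)[of t] that by auto
        moreover have "k x' \<in> f (k x') (k (h + y'))" "k (h+y') \<in> f (k x') (k (h + y'))"
          using w kZ(2) that ne by (auto simp: f_def)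
        ultimately show ?thesis using kinj[of t x'] kinj[of t "h + y'"] that by auto
      qed
      moreover have "w' x y \<in> V" if "x < h" "y < h" for x y
        using w(1)[of "k x" "k (h+y)"] kZ(2) kinj that by (auto simp: w'_def)
      moreover have "a x < N" "b x < N" if "x < h" for x using gN kZ that by (auto simp: a_def b_def)
      ultimately show ?thesis
        unfolding link_grid_def by (intro disjI2 exI[of _ a] exI[of _ b] exI[of _ w']) (auto simp: a_def b_def)
    qed
  qed
qed

section \<open>Ladders when three positions vary\<close>

lemma ladder_order:
  assumes "\<And>x y. x \<in> {s..<s+2*h} \<Longrightarrow> y \<in> {s..<s+2*h} \<Longrightarrow> x \<noteq> y \<Longrightarrow> R x y = (if x < y then p else q)" "p \<noteq> q"
  shows "ladder h R"
proof (cases p)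
  case True
  \<comment> \<open>\<open>R\<close> is unknown on the diagonal, so rows use one parity and columns
    the other.\<close>
  have "R (s + 2*i) (s + 2*j + 1) \<longleftrightarrow> i \<le> j" if "i < h" "j < h" for i j
  proof -
    have "s + 2*i \<noteq> s + 2*j + 1" by presburger
    then have "R (s + 2*i) (s + 2*j + 1) = (if s + 2*i < s + 2*j + 1 then p else q)"
      using that by (intro assms(1)) auto
    moreover have "s + 2*i < s + 2*j + 1 \<longleftrightarrow> i \<le> j" by arith
    ultimately show ?thesis using True assms(2) by simp
  qed
  then show ?thesis by (rule ladder_shift)
next
  case False
  have "R (s + 2*i + 1) (s + 2*j) \<longleftrightarrow> j \<le> i" if "i < h" "j < h" for i j
  proof -
    have "s + 2*i + 1 \<noteq> s + 2*j" by presburger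
    then have "R (s + 2*i + 1) (s + 2*j) = (if s + 2*i + 1 < s + 2*j then p else q)"
      using that by (intro assms(1)) auto
    moreover have "s + 2*i + 1 < s + 2*j \<longleftrightarrow> \<not> j \<le> i" by arith
    ultimately show ?thesis using False assms(2) by simp
  qed
  then show ?thesis by (rule ladder_reverse)
qed

lemma ladder_comp:
  assumes "ladder h (\<lambda>x y. R (f x) (g y))"
  shows "ladder h R"
proof -
  from assms obtain a b where "\<forall>i\<in>{1..h}. \<forall>j\<in>{1..h}. R (f (a i)) (g (b j)) \<longleftrightarrow> i \<le> j"
    unfolding ladder_def by (elim exE)
  then show ?thesis
    unfolding ladder_def by (intro exI[of _ "\<lambda>i. f (a i)"] exI[of _ "\<lambda>j. g (b j)"])
qed

text \<open>Two orders of three positions that differ by an adjacent transposition are distinguished only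
  by a ladder in which the third position is fixed at an extreme index. As adjacent transpositions
  generate all permutations, off the diagonal \<open>val\<close> may be assumed constant.\<close>

lemma ladder_or_diagonal:
  "\<exists>N. \<forall>val :: nat \<Rightarrow> nat \<Rightarrow> nat \<Rightarrow> bool. (\<forall>i<N. \<forall>j<N. val i i j \<longleftrightarrow> i \<le> j) \<longrightarrow>
     (\<exists>c. ladder h (\<lambda>x y. val x y c)) \<or> (\<exists>c. ladder h (\<lambda>x z. val x c z)) \<or>
     (\<exists>c. ladder h (\<lambda>y z. val c y z)) \<or>
     (\<exists>\<epsilon> i j. \<forall>a\<in>{1..h}. \<forall>a'\<in>{1..h}. \<forall>b\<in>{1..h}. (val (i a) (i a') (j b) \<noteq> \<epsilon>) \<longleftrightarrow> a = a' \<and> a \<le> b)"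
proof -
  \<comment> \<open>Each of the six orders of a triple gives one predicate. Positions 1 to
    \<open>2 * h\<close> carry a ladder; 0 and \<open>2 * h + 1\<close> are the extremes at which
    the third position is held.\<close>
  from ramsey_preds[of "2*h+2" 6 3] obtain N where N: "\<forall>p :: nat \<Rightarrow> nat set \<Rightarrow> bool. \<exists>Y\<subseteq>{..<N}. card Y = 2*h+2 \<and>
     (\<forall>l<6. \<exists>b. \<forall>S\<in>nsets Y 3. p l S = b)" ..
  show ?thesis
  proof (rule exI[of _ N], intro allI impI)
    fix val :: "nat \<Rightarrow> nat \<Rightarrow> nat \<Rightarrow> bool" assume diag: "\<forall>i<N. \<forall>j<N. val i i j \<longleftrightarrow> i \<le> j"
    define q where "q l x y z = [val x y z, val x z y, val y x z, val y z x, val z x y, val z y x] ! l"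
      for x y z and l :: nat
    define p where "p l S = (\<exists>x y z. S = {x,y,z} \<and> x < y \<and> y < z \<and> q l x y z)" for l S
    from N[THEN spec, of p] obtain Y where Y: "Y \<subseteq> {..<N}" "card Y = 2*h+2"
      and hom: "\<forall>l<6. \<exists>b. \<forall>S\<in>nsets Y 3. p l S = b" by (elim exE conjE)
    have finY: "finite Y" using Y finite_subset by blast
    obtain g where g: "strict_mono_on {..<2*h+2} g" "g ` {..<2*h+2} = Y"
      using finite_nat_enum[OF finY Y(2)] by blast
    obtain \<beta> where \<beta>: "\<And>l S. l < 6 \<Longrightarrow> S \<in> nsets Y 3 \<Longrightarrow> p l S = \<beta> l" using hom by metis
    define v where "v x y z = val (g x) (g y) (g z)" for x y z
    have q: "q l (g x) (g y) (g z) = \<beta> l" if "l < 6" "x < y" "y < z" "z < 2*h+2" for l x y z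
    proof -
      have lt: "g x < g y" "g y < g z" using g(1) that by (auto simp: strict_mono_on_def)
      have "{g x, g y, g z} \<in> nsets Y 3" using lt g(2) that by (auto simp: nsets_def card_insert_if)
      then have "p l {g x, g y, g z} = \<beta> l" using \<beta> that by blast
      moreover have "p l {g x, g y, g z} \<longleftrightarrow> q l (g x) (g y) (g z)"
      proof
        assume "p l {g x, g y, g z}"
        then obtain x' y' z' where *: "{g x, g y, g z} = {x',y',z'}" "x' < y'" "y' < z'" "q l x' y' z'"
          unfolding p_def by blast
        then have "sorted_list_of_set {g x, g y, g z} = sorted_list_of_set {x',y',z'}" by simp
        then have "[g x, g y, g z] = [x', y', z']" using lt *(2,3) by simp
        then show "q l (g x) (g y) (g z)" using * by simp
      qed (use lt p_def in blast)
      ultimately show ?thesis by simp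
    qed
    have vq: "v x y z = \<beta> 0" "v x z y = \<beta> 1" "v y x z = \<beta> 2" "v y z x = \<beta> 3" "v z x y = \<beta> 4" "v z y x = \<beta> 5"
      if "x < y" "y < z" "z < 2*h+2" for x y z
      using q[of 0 x y z] q[of 1 x y z] q[of 2 x y z] q[of 3 x y z] q[of 4 x y z] q[of 5 x y z] that
      by (simp_all add: q_def v_def)
    show "(\<exists>c. ladder h (\<lambda>x y. val x y c)) \<or> (\<exists>c. ladder h (\<lambda>x z. val x c z)) \<or>
     (\<exists>c. ladder h (\<lambda>y z. val c y z)) \<or>
     (\<exists>\<epsilon> i j. \<forall>a\<in>{1..h}. \<forall>a'\<in>{1..h}. \<forall>b\<in>{1..h}. (val (i a) (i a') (j b) \<noteq> \<epsilon>) \<longleftrightarrow> a = a' \<and> a \<le> b)"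
      (is "?A \<or> ?B \<or> ?C \<or> ?D")
    proof (rule ccontr)
      assume neg: "\<not> ?thesis"
      have no: "\<not> ladder h (\<lambda>x y. v x y c)" "\<not> ladder h (\<lambda>x z. v x c z)" "\<not> ladder h (\<lambda>y z. v c y z)" for c
        using neg ladder_comp[of h "\<lambda>x y. val x y (g c)" g g] ladder_comp[of h "\<lambda>x y. val x (g c) y" g g]
          ladder_comp[of h "\<lambda>x y. val (g c) x y" g g] unfolding v_def by blast+
      \<comment> \<open>The five equations connect all six orders. Each of them swaps two arguments
        of consecutive rank, while the remaining argument is either the largest or the smallest and
        is held at that extreme.\<close>
      have "\<beta> 0 = \<beta> 2"
      proof (rule ccontr)
        assume "\<beta> 0 \<noteq> \<beta> 2"
        have "ladder h (\<lambda>x y. v x y (2*h+1))"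
          by (rule ladder_order[of 1 h _ "\<beta> 0" "\<beta> 2", OF _ \<open>\<beta> 0 \<noteq> \<beta> 2\<close>]) (auto simp: vq not_less)
        then show False using no by blast
      qed
      moreover have "\<beta> 2 = \<beta> 4"
      proof (rule ccontr)
        assume "\<beta> 2 \<noteq> \<beta> 4"
        have "ladder h (\<lambda>x z. v x 0 z)"
          by (rule ladder_order[of 1 h _ "\<beta> 2" "\<beta> 4", OF _ \<open>\<beta> 2 \<noteq> \<beta> 4\<close>]) (auto simp: vq not_less)
        then show False using no by blast
      qed
      moreover have "\<beta> 4 = \<beta> 5"
      proof (rule ccontr)
        assume "\<beta> 4 \<noteq> \<beta> 5"
        have "ladder h (\<lambda>y z. v (2*h+1) y z)"
          by (rule ladder_order[of 1 h _ "\<beta> 4" "\<beta> 5", OF _ \<open>\<beta> 4 \<noteq> \<beta> 5\<close>]) (auto simp: vq not_less)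
        then show False using no by blast
      qed
      moreover have "\<beta> 3 = \<beta> 5"
      proof (rule ccontr)
        assume "\<beta> 3 \<noteq> \<beta> 5"
        have "ladder h (\<lambda>x y. v x y 0)"
          by (rule ladder_order[of 1 h _ "\<beta> 3" "\<beta> 5", OF _ \<open>\<beta> 3 \<noteq> \<beta> 5\<close>]) (auto simp: vq not_less)
        then show False using no by blast
      qed
      moreover have "\<beta> 1 = \<beta> 3"
      proof (rule ccontr)
        assume "\<beta> 1 \<noteq> \<beta> 3"
        have "ladder h (\<lambda>x z. v x (2*h+1) z)"
          by (rule ladder_order[of 1 h _ "\<beta> 1" "\<beta> 3", OF _ \<open>\<beta> 1 \<noteq> \<beta> 3\<close>]) (auto simp: vq not_less)
        then show False using no by blast
      qed
      ultimately have eq: "\<beta> 1 = \<beta> 0" "\<beta> 2 = \<beta> 0" "\<beta> 3 = \<beta> 0" "\<beta> 4 = \<beta> 0" "\<beta> 5 = \<beta> 0" by auto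
      have const: "v x y z = \<beta> 0" if "x \<noteq> y" "y \<noteq> z" "x \<noteq> z" "x < 2*h+2" "y < 2*h+2" "z < 2*h+2" for x y z
      proof -
        have "x < y \<and> y < z \<or> x < z \<and> z < y \<or> y < x \<and> x < z \<or> y < z \<and> z < x \<or> z < x \<and> x < y \<or> z < y \<and> y < x"
          using that by arith
        then show ?thesis using that by (elim disjE conjE) (simp_all add: vq eq eq(1)[unfolded One_nat_def])
      qed
      have vdiag: "v x x z \<longleftrightarrow> x \<le> z" if "x < 2*h+2" "z < 2*h+2" for x z
      proof -
        have "g x < N" "g z < N" using g(2) Y(1) that by auto
        then have "v x x z \<longleftrightarrow> g x \<le> g z" using diag by (simp add: v_def)
        also have "\<dots> \<longleftrightarrow> x \<le> z" using strict_mono_on_less_eq[OF g(1)] that by auto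
        finally show ?thesis .
      qed
      \<comment> \<open>The two parities keep the last argument away from the first two, so that
        \<open>const\<close> applies off the diagonal. If the constant is true, a diagonal value
        deviates from it when the first position exceeds the last, and reversing the indices turns
        this into \<open>a \<le> b\<close>.\<close>
      have ?D
      proof (cases "\<beta> 0")
        case True
        have D: "(v (2*(h-a)+1) (2*(h-a')+1) (2*(h-b)) \<noteq> True) \<longleftrightarrow> a = a' \<and> a \<le> b"
          if "a \<in> {1..h}" "a' \<in> {1..h}" "b \<in> {1..h}" for a a' b
        proof (cases "a = a'")
          case eq: True
          then show ?thesis using vdiag[of "2*(h-a)+1" "2*(h-b)"] that by auto
        next
          case False
          have ne: "2*(h-a)+1 \<noteq> 2*(h-a')+1" "2*(h-a')+1 \<noteq> 2*(h-b)" "2*(h-a)+1 \<noteq> 2*(h-b)"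
            using that False by (auto, presburger+)
          have "v (2*(h-a)+1) (2*(h-a')+1) (2*(h-b))"
            using const[OF ne] True by auto
          then show ?thesis using False by simp
        qed
        show ?thesis
          by (intro exI[of _ True] exI[of _ "\<lambda>a. g (2*(h-a)+1)"] exI[of _ "\<lambda>b. g (2*(h-b))"] ballI)
             (rule D[unfolded v_def]; assumption)
      next
        case False
        have D: "(v (2*(a-1)) (2*(a'-1)) (2*(b-1)+1) \<noteq> False) \<longleftrightarrow> a = a' \<and> a \<le> b"
          if "a \<in> {1..h}" "a' \<in> {1..h}" "b \<in> {1..h}" for a a' b
        proof (cases "a = a'")
          case eq: True
          have "2*(a-1) < 2*h+2" "2*(b-1)+1 < 2*h+2" using that by auto
          moreover have "2*(a-1) \<le> 2*(b-1)+1 \<longleftrightarrow> a \<le> b" using that by auto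
          ultimately show ?thesis using vdiag[of "2*(a-1)" "2*(b-1)+1"] eq by simp
        next
          case ne: False
          have "a - 1 \<noteq> a' - 1" using that ne by auto
          then have ne': "2*(a-1) \<noteq> 2*(a'-1)" "2*(a'-1) \<noteq> 2*(b-1)+1" "2*(a-1) \<noteq> 2*(b-1)+1"
            by presburger+
          have "\<not> v (2*(a-1)) (2*(a'-1)) (2*(b-1)+1)"
          proof -
            have "2*(a-1) < 2*h+2" "2*(a'-1) < 2*h+2" "2*(b-1)+1 < 2*h+2"
              using that unfolding atLeastAtMost_iff by presburger+
            from const[OF ne' this] show ?thesis using False by blast
          qed
          then show ?thesis using ne by simp
        qed
        show ?thesis
          by (intro exI[of _ False] exI[of _ "\<lambda>a. g (2*(a-1))"] exI[of _ "\<lambda>b. g (2*(b-1)+1)"] ballI)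
             (rule D[unfolded v_def]; assumption)
      qed
      then show False by (rule neg[THEN notE, OF disjI2[OF disjI2[OF disjI2]]])
    qed
  qed
qed

section \<open>Distances and flips\<close>

primrec near :: "('v \<Rightarrow> 'v \<Rightarrow> bool) \<Rightarrow> nat \<Rightarrow> 'v \<Rightarrow> 'v \<Rightarrow> bool" where
  "near E 0 u v \<longleftrightarrow> u = v"
| "near E (Suc n) u v \<longleftrightarrow> near E n u v \<or> (\<exists>w. E u w \<and> near E n w v)"

lemma near_mono: "near E m u v \<Longrightarrow> m \<le> n \<Longrightarrow> near E n u v"
  by (induction n) (auto simp: le_Suc_eq)

lemma near_refl [simp]: "near E n u u"
  by (induction n) auto

lemma near_trans: "near E m u w \<Longrightarrow> near E n w v \<Longrightarrow> near E (m + n) u v"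
proof (induction m arbitrary: u)
  case 0
  then show ?case by simp
next
  case (Suc m)
  then show ?case by auto
qed

lemma near_step: "near E n u w \<Longrightarrow> E w v \<Longrightarrow> near E (Suc n) u v"
  using near_trans[of E n u w 1 v] by auto

lemma near_Suc_right: "near E (Suc n) u v \<longleftrightarrow> near E n u v \<or> (\<exists>w. near E n u w \<and> E w v)"
proof (induction n arbitrary: u)
  case (Suc n)
  have "near E (Suc (Suc n)) u v \<longleftrightarrow> near E (Suc n) u v \<or> (\<exists>w. E u w \<and> near E (Suc n) w v)"
    by simp
  also have "\<dots> \<longleftrightarrow> near E (Suc n) u v \<or> (\<exists>w. E u w \<and> (near E n w v \<or> (\<exists>x. near E n w x \<and> E x v)))"
    unfolding Suc.IH ..
  also have "\<dots> \<longleftrightarrow> near E (Suc n) u v \<or> (\<exists>w. near E (Suc n) u w \<and> E w v)"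
    using near_step[of E n u _ v] by (auto simp del: near.simps(2) simp: near.simps(2)[of E n u v] near.simps(2)[of E n u for u])
  finally show ?case .
qed auto

lemma near_sym:
  assumes "\<And>u v. E u v \<Longrightarrow> E v u" "near E n u v"
  shows "near E n v u"
  using assms(2)
proof (induction n arbitrary: u)
  case (Suc n)
  then show ?case using assms(1) near_step[of E n v _ u] near_mono[of E n v u "Suc n"]
    by (metis le_SucI order_refl near.simps(2))
qed auto

definition adj :: "'v pair_pre_digraph \<Rightarrow> 'v \<Rightarrow> 'v \<Rightarrow> bool" where
  "adj G u v \<longleftrightarrow> (u, v) \<in> parcs G"

lemma adj_facts:
  assumes "pair_graph G"
  shows "finite (pverts G)" "adj G u v \<Longrightarrow> u \<in> pverts G" "adj G u v \<Longrightarrow> v \<in> pverts G"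
    "adj G u v \<Longrightarrow> u \<noteq> v" "adj G u v \<Longrightarrow> adj G v u"
proof -
  interpret pair_graph G by fact
  show "finite (pverts G)" by simp
  show "adj G u v \<Longrightarrow> u \<in> pverts G" "adj G u v \<Longrightarrow> v \<in> pverts G" "adj G u v \<Longrightarrow> u \<noteq> v" "adj G u v \<Longrightarrow> adj G v u"
    unfolding adj_def using in_arcsD1 in_arcsD2 no_loops' arcs_symmetric by auto
qed

lemma near_iff_awalk:
  assumes "pair_graph G" "u \<in> pverts G"
  shows "near (adj G) n u v \<longleftrightarrow> (\<exists>p. pre_digraph.awalk (with_proj G) u p v \<and> length p \<le> n)"
  using assms(2)
proof (induction n arbitrary: u)
  case 0
  interpret pair_graph G by fact
  show ?case using 0 by (auto simp: awalk_Nil_iff)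
next
  case (Suc n)
  interpret pair_graph G by fact
  show ?case
  proof
    assume "near (adj G) (Suc n) u v"
    then consider "near (adj G) n u v" | w where "adj G u w" "near (adj G) n w v" by auto
    then show "\<exists>p. awalk u p v \<and> length p \<le> Suc n"
    proof cases
      case 1
      then show ?thesis using Suc le_SucI by blast
    next
      case 2
      then have "w \<in> pverts G" using adj_facts(3)[OF assms(1)] by blast
      then obtain p where "awalk w p v" "length p \<le> n" using Suc.IH 2 by blast
      moreover have "awalk u ((u, w) # p) v"
        using \<open>awalk w p v\<close> 2(1) Suc.prems by (auto simp: awalk_Cons_iff adj_def)
      ultimately show ?thesis by (intro exI[of _ "(u, w) # p"]) auto
    qed
  next
    assume "\<exists>p. awalk u p v \<and> length p \<le> Suc n"
    then obtain p where p: "awalk u p v" "length p \<le> Suc n" by blast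
    show "near (adj G) (Suc n) u v"
    proof (cases p)
      case Nil
      then show ?thesis using p by (auto simp: awalk_Nil_iff)
    next
      case (Cons e es)
      then have "e \<in> parcs G" "fst e = u" "awalk (snd e) es v" using p by (auto simp: awalk_Cons_iff)
      then have "adj G u (snd e)" "snd e \<in> pverts G" by (auto simp: adj_def in_arcsD2 intro: in_arcsD2)
      then show ?thesis using Suc.IH \<open>awalk (snd e) es v\<close> p Cons by auto
    qed
  qed
qed

lemma graph_dist_gt_iff:
  assumes "pair_graph G" "u \<in> pverts G"
  shows "graph_dist G u v > ereal (real r) \<longleftrightarrow> \<not> near (adj G) r u v"
proof -
  interpret pair_graph G by fact
  have cost: "awalk_cost (\<lambda>_. 1) p = real (length p)" for p :: "('a \<times> 'a) list"
    by (induction p) (auto simp: awalk_cost_def)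
  show ?thesis
  proof
    assume "graph_dist G u v > ereal (real r)"
    show "\<not> near (adj G) r u v"
    proof
      assume "near (adj G) r u v"
      then obtain p where "awalk u p v" "length p \<le> r" using near_iff_awalk[OF assms] by blast
      then have "\<mu> (\<lambda>_. 1) u v \<le> ereal (real r)"
        using min_cost_le_walk_cost[of u p v "\<lambda>_. 1"] cost[of p] by (metis (no_types, lifting) ereal_less_eq(3) of_nat_le_iff order_trans)
      then show False using \<open>graph_dist G u v > ereal (real r)\<close> by (simp add: graph_dist_def)
    qed
  next
    assume n: "\<not> near (adj G) r u v"
    \<comment> \<open>Strictness survives the infimum because walk lengths are integers: every walk
      costs at least \<open>r + 1\<close>.\<close>
    have "ereal (real (Suc r)) \<le> \<mu> (\<lambda>_. 1) u v"
      unfolding \<mu>_def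
    proof (rule INF_greatest)
      fix p assume "p \<in> {p. awalk u p v}"
      then have "\<not> length p \<le> r" using n near_iff_awalk[OF assms] by blast
      then show "ereal (real (Suc r)) \<le> ereal (awalk_cost (\<lambda>_. 1) p)" unfolding cost by simp
    qed
    moreover have "ereal (real r) < ereal (real (Suc r))" by simp
    ultimately show "graph_dist G u v > ereal (real r)" unfolding graph_dist_def by (rule less_le_trans[rotated])
  qed
qed

definition scattered :: "('v \<Rightarrow> 'v \<Rightarrow> bool) \<Rightarrow> nat \<Rightarrow> 'v set \<Rightarrow> bool" where
  "scattered E r B \<longleftrightarrow> (\<forall>u\<in>B. \<forall>v\<in>B. u \<noteq> v \<longrightarrow> \<not> near E r u v)"

lemma dist_independent_iff:
  assumes "pair_graph G"
  shows "dist_independent G r B \<longleftrightarrow> B \<subseteq> pverts G \<and> scattered (adj G) r B"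
  unfolding dist_independent_def scattered_def using graph_dist_gt_iff[OF assms] by blast

lemma scattered_mono: "scattered E r B \<Longrightarrow> B' \<subseteq> B \<Longrightarrow> r' \<le> r \<Longrightarrow> scattered E r' B'"
  unfolding scattered_def using near_mono[of E r' _ _ r] by (meson subsetD)

section \<open>Relations that depend on membership in boundedly many sets\<close>

definition xadj :: "'v pair_pre_digraph \<Rightarrow> ('v \<Rightarrow> 'v \<Rightarrow> bool) \<Rightarrow> 'v \<Rightarrow> 'v \<Rightarrow> bool" where
  "xadj G D u v \<longleftrightarrow> u \<in> pverts G \<and> v \<in> pverts G \<and> u \<noteq> v \<and> (adj G u v \<noteq> D u v)"

text \<open>The working substitute for a bounded set of flips: \<open>D\<close> is constant on
  products of classes of the partition generated by \<open>n\<close> sets. Such relations can be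
  added modulo 2 without tracking which flips cancel, and the \<open>n\<close> sets are exactly what
  a unary expansion can supply.\<close>

definition coded :: "nat \<Rightarrow> 'v set \<Rightarrow> ('v \<Rightarrow> 'v \<Rightarrow> bool) \<Rightarrow> bool" where
  "coded n V D \<longleftrightarrow> (\<exists>P :: nat \<Rightarrow> 'v set. \<forall>v\<in>V. \<forall>v'\<in>V. \<forall>w\<in>V. \<forall>w'\<in>V.
     (\<forall>i<n. v \<in> P i \<longleftrightarrow> v' \<in> P i) \<longrightarrow> (\<forall>i<n. w \<in> P i \<longleftrightarrow> w' \<in> P i) \<longrightarrow> D v w = D v' w')"

lemma codedI:
  fixes P :: "nat \<Rightarrow> 'v set"
  assumes "\<And>v v' w w'. v \<in> V \<Longrightarrow> v' \<in> V \<Longrightarrow> w \<in> V \<Longrightarrow> w' \<in> V \<Longrightarrow>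
     (\<And>i. i < n \<Longrightarrow> v \<in> P i \<longleftrightarrow> v' \<in> P i) \<Longrightarrow> (\<And>i. i < n \<Longrightarrow> w \<in> P i \<longleftrightarrow> w' \<in> P i) \<Longrightarrow> D v w = D v' w'"
  shows "coded n V D"
  unfolding coded_def
proof (intro exI[of _ P] ballI impI)
  fix v v' w w' assume "v \<in> V" "v' \<in> V" "w \<in> V" "w' \<in> V"
    and "\<forall>i<n. v \<in> P i \<longleftrightarrow> v' \<in> P i" "\<forall>i<n. w \<in> P i \<longleftrightarrow> w' \<in> P i"
  then show "D v w = D v' w'" by (intro assms) simp_all
qed

lemma codedE:
  assumes "coded n V D"
  obtains P :: "nat \<Rightarrow> 'v set" where "\<And>v v' w w'. v \<in> V \<Longrightarrow> v' \<in> V \<Longrightarrow> w \<in> V \<Longrightarrow> w' \<in> V \<Longrightarrow>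
     (\<And>i. i < n \<Longrightarrow> v \<in> P i \<longleftrightarrow> v' \<in> P i) \<Longrightarrow> (\<And>i. i < n \<Longrightarrow> w \<in> P i \<longleftrightarrow> w' \<in> P i) \<Longrightarrow> D v w = D v' w'"
proof -
  from assms obtain P :: "nat \<Rightarrow> 'v set" where P: "\<forall>v\<in>V. \<forall>v'\<in>V. \<forall>w\<in>V. \<forall>w'\<in>V.
     (\<forall>i<n. v \<in> P i \<longleftrightarrow> v' \<in> P i) \<longrightarrow> (\<forall>i<n. w \<in> P i \<longleftrightarrow> w' \<in> P i) \<longrightarrow> D v w = D v' w'"
    unfolding coded_def by (elim exE)
  show thesis
  proof (rule that[of P])
    fix v v' w w' assume V: "v \<in> V" "v' \<in> V" "w \<in> V" "w' \<in> V"
      and "\<And>i. i < n \<Longrightarrow> v \<in> P i \<longleftrightarrow> v' \<in> P i" "\<And>i. i < n \<Longrightarrow> w \<in> P i \<longleftrightarrow> w' \<in> P i"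
    then show "D v w = D v' w'"
      by (intro P[THEN bspec, OF V(1), THEN bspec, OF V(2), THEN bspec, OF V(3), THEN bspec, OF V(4), THEN mp, THEN mp])
         simp_all
  qed
qed

lemma coded_xor:
  assumes "coded m V D1" "coded n V D2"
  shows "coded (m + n) V (\<lambda>v w. D1 v w \<noteq> D2 v w)"
proof -
  obtain P where P: "\<And>v v' w w'. v \<in> V \<Longrightarrow> v' \<in> V \<Longrightarrow> w \<in> V \<Longrightarrow> w' \<in> V \<Longrightarrow>
     (\<And>i. i < m \<Longrightarrow> v \<in> P i \<longleftrightarrow> v' \<in> P i) \<Longrightarrow> (\<And>i. i < m \<Longrightarrow> w \<in> P i \<longleftrightarrow> w' \<in> P i) \<Longrightarrow> D1 v w = D1 v' w'"
    using codedE[OF assms(1)] by metis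
  obtain Q where Q: "\<And>v v' w w'. v \<in> V \<Longrightarrow> v' \<in> V \<Longrightarrow> w \<in> V \<Longrightarrow> w' \<in> V \<Longrightarrow>
     (\<And>i. i < n \<Longrightarrow> v \<in> Q i \<longleftrightarrow> v' \<in> Q i) \<Longrightarrow> (\<And>i. i < n \<Longrightarrow> w \<in> Q i \<longleftrightarrow> w' \<in> Q i) \<Longrightarrow> D2 v w = D2 v' w'"
    using codedE[OF assms(2)] by metis
  define S where "S i = (if i < m then P i else Q (i - m))" for i
  show ?thesis
  proof (rule codedI[where P = S])
    fix v v' w w' assume V: "v \<in> V" "v' \<in> V" "w \<in> V" "w' \<in> V"
      and v: "\<And>i. i < m + n \<Longrightarrow> v \<in> S i \<longleftrightarrow> v' \<in> S i" and w: "\<And>i. i < m + n \<Longrightarrow> w \<in> S i \<longleftrightarrow> w' \<in> S i"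
    have "D1 v w = D1 v' w'"
    proof (rule P[OF V])
      show "v \<in> P i \<longleftrightarrow> v' \<in> P i" "w \<in> P i \<longleftrightarrow> w' \<in> P i" if "i < m" for i
        using v[of i] w[of i] that by (auto simp: S_def)
    qed
    moreover have "D2 v w = D2 v' w'"
    proof (rule Q[OF V])
      show "v \<in> Q i \<longleftrightarrow> v' \<in> Q i" "w \<in> Q i \<longleftrightarrow> w' \<in> Q i" if "i < n" for i
        using v[of "m + i"] w[of "m + i"] that by (auto simp: S_def)
    qed
    ultimately show "(D1 v w \<noteq> D2 v w) = (D1 v' w' \<noteq> D2 v' w')" by simp
  qed
qed

lemma coded_index:
  assumes "coded n V D"
  obtains \<kappa> :: "'v \<Rightarrow> nat" and R where "\<And>v. \<kappa> v < 2 ^ n" "\<And>v w. v \<in> V \<Longrightarrow> w \<in> V \<Longrightarrow> D v w = R (\<kappa> v) (\<kappa> w)"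
proof -
  obtain P where P: "\<And>v v' w w'. v \<in> V \<Longrightarrow> v' \<in> V \<Longrightarrow> w \<in> V \<Longrightarrow> w' \<in> V \<Longrightarrow>
     (\<And>i. i < n \<Longrightarrow> v \<in> P i \<longleftrightarrow> v' \<in> P i) \<Longrightarrow> (\<And>i. i < n \<Longrightarrow> w \<in> P i \<longleftrightarrow> w' \<in> P i) \<Longrightarrow> D v w = D v' w'"
    using codedE[OF assms] by metis
  obtain f where f: "bij_betw f (Pow {..<n}) {0..<card (Pow {..<n})}"
    using ex_bij_betw_finite_nat[of "Pow {..<n}"] by auto
  define \<kappa> where "\<kappa> v = f {i. i < n \<and> v \<in> P i}" for v
  have "\<kappa> v < 2 ^ n" for v
    using bij_betwE[OF f] unfolding \<kappa>_def by (auto simp: card_Pow)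
  moreover define R where "R k l = (\<exists>v\<in>V. \<exists>w\<in>V. \<kappa> v = k \<and> \<kappa> w = l \<and> D v w)" for k l
  have eq: "v \<in> P i \<longleftrightarrow> v' \<in> P i" if "\<kappa> v = \<kappa> v'" "i < n" for v v' i
  proof -
    have "{i. i < n \<and> v \<in> P i} = {i. i < n \<and> v' \<in> P i}"
      using that(1) unfolding \<kappa>_def by (rule inj_onD[OF bij_betw_imp_inj_on[OF f]]) auto
    then show ?thesis using that(2) by blast
  qed
  have "D v w = R (\<kappa> v) (\<kappa> w)" if "v \<in> V" "w \<in> V" for v w
  proof
    show "D v w \<Longrightarrow> R (\<kappa> v) (\<kappa> w)" using that unfolding R_def by blast
    assume "R (\<kappa> v) (\<kappa> w)"
    then obtain v' w' where "v' \<in> V" "w' \<in> V" "\<kappa> v' = \<kappa> v" "\<kappa> w' = \<kappa> w" "D v' w'" unfolding R_def by blast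
    then show "D v w" using P[of v v' w w'] eq that by metis
  qed
  ultimately show thesis using that by blast
qed

text \<open>There is one rectangle per class, namely the class times everything related to it. In
  this form \<open>rectF\<close> can express \<open>D\<close>.\<close>

lemma coded_rectangles:
  assumes "coded n V D"
  obtains P Q :: "nat \<Rightarrow> 'v set" where "\<And>k. P k \<subseteq> V" "\<And>k. Q k \<subseteq> V"
    "\<And>v w. v \<in> V \<Longrightarrow> w \<in> V \<Longrightarrow> D v w \<longleftrightarrow> (\<exists>k<2^n. v \<in> P k \<and> w \<in> Q k)"
proof -
  obtain \<kappa> :: "'v \<Rightarrow> nat" and R where *: "\<And>v. \<kappa> v < 2 ^ n" "\<And>v w. v \<in> V \<Longrightarrow> w \<in> V \<Longrightarrow> D v w = R (\<kappa> v) (\<kappa> w)"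
    using coded_index[OF assms] by metis
  show thesis
    by (rule that[of "\<lambda>k. {v\<in>V. \<kappa> v = k}" "\<lambda>k. {w\<in>V. R k (\<kappa> w)}"]) (auto simp: *)
qed

text \<open>A flip toggles the pairs of its symmetrised rectangle, so what matters for a pair is the
  parity of the number of flips that hit it.\<close>

lemma adj_apply_flips:
  assumes "pair_graph G" "finite F"
  shows "adj (G \<oplus>\<^sub>F F) = xadj G (\<lambda>u v. odd (card {f\<in>F. (u, v) \<in> fst f \<times> snd f \<union> snd f \<times> fst f}))"
  using assms(2)
proof (induction F)
  case empty
  have "\<not> adj G x x" for x using adj_facts(4)[OF assms(1)] by blast
  then show ?case using adj_facts(2,3)[OF assms(1)] by (auto simp: fun_eq_iff xadj_def)
next
  case (insert f F)
  obtain A B where f: "f = (A, B)" by force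
  let ?L = "\<lambda>F u v. {g\<in>F. (u, v) \<in> fst g \<times> snd g \<union> snd g \<times> fst g}"
  let ?W = "\<lambda>u v. (u, v) \<in> A \<times> B \<union> B \<times> A"
  have step: "adj (G \<oplus>\<^sub>F insert f F) u v \<longleftrightarrow> u \<in> pverts G \<and> v \<in> pverts G \<and> u \<noteq> v \<and>
     (adj (G \<oplus>\<^sub>F F) u v \<noteq> ?W u v)" for u v
    using pair_graph_apply_flips(2)[OF assms(1) insert.hyps(1)]
    unfolding apply_flips_insert[OF insert.hyps] by (simp add: f apply_flip_def adj_def)
  have parity: "odd (card (?L (insert f F) u v)) \<longleftrightarrow> (odd (card (?L F u v)) \<noteq> ?W u v)" for u v
  proof (cases "?W u v")
    case True
    then have "(u, v) \<in> fst f \<times> snd f \<union> snd f \<times> fst f" by (simp only: f fst_conv snd_conv)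
    then have "?L (insert f F) u v = insert f (?L F u v)" by blast
    moreover have "card (insert f (?L F u v)) = Suc (card (?L F u v))"
      using insert.hyps by (intro card_insert_disjoint) auto
    ultimately show ?thesis using True by (simp only: even_Suc) blast
  next
    case False
    then have "(u, v) \<notin> fst f \<times> snd f \<union> snd f \<times> fst f" by (simp only: f fst_conv snd_conv) simp
    then have "?L (insert f F) u v = ?L F u v" by blast
    then show ?thesis using False by (simp only:) blast
  qed
  show ?case unfolding fun_eq_iff step insert.IH unfolding xadj_def parity by blast
qed

lemma flips_coded:
  assumes "pair_graph G" "finite F" "card F \<le> s"
  shows "\<exists>D. coded (2 * s) (pverts G) D \<and> (\<forall>u v. D u v = D v u) \<and> adj (G \<oplus>\<^sub>F F) = xadj G D"
proof -
  define D where "D u v \<longleftrightarrow> odd (card {f\<in>F. (u, v) \<in> fst f \<times> snd f \<union> snd f \<times> fst f})" for u v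
  obtain g where g: "bij_betw g {0..<card F} F"
    using ex_bij_betw_nat_finite[OF assms(2)] by blast
  define P where "P i = (if even i then fst (g (i div 2)) else snd (g (i div 2)))" for i
  have "coded (2 * s) (pverts G) D"
  proof (rule codedI[where P = P])
    fix v v' w w' 
    assume v: "\<And>i. i < 2 * s \<Longrightarrow> v \<in> P i \<longleftrightarrow> v' \<in> P i" and w: "\<And>i. i < 2 * s \<Longrightarrow> w \<in> P i \<longleftrightarrow> w' \<in> P i"
    have "(v \<in> fst f \<longleftrightarrow> v' \<in> fst f) \<and> (v \<in> snd f \<longleftrightarrow> v' \<in> snd f) \<and>
          (w \<in> fst f \<longleftrightarrow> w' \<in> fst f) \<and> (w \<in> snd f \<longleftrightarrow> w' \<in> snd f)" if "f \<in> F" for f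
    proof -
      obtain i where "i < card F" "f = g i" using bij_betw_imp_surj_on[OF g] \<open>f \<in> F\<close> by force
      then show ?thesis using v[of "2*i"] v[of "2*i+1"] w[of "2*i"] w[of "2*i+1"] assms(3)
        by (auto simp: P_def)
    qed
    then have "{f\<in>F. (v, w) \<in> fst f \<times> snd f \<union> snd f \<times> fst f} = {f\<in>F. (v', w') \<in> fst f \<times> snd f \<union> snd f \<times> fst f}"
      by auto
    then show "D v w = D v' w'" unfolding D_def by (simp only:)
  qed
  moreover have "D u v = D v u" for u v
  proof -
    have "{f\<in>F. (u, v) \<in> fst f \<times> snd f \<union> snd f \<times> fst f} = {f\<in>F. (v, u) \<in> fst f \<times> snd f \<union> snd f \<times> fst f}"
      by auto
    then show ?thesis unfolding D_def by (simp only:)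
  qed
  ultimately show ?thesis using adj_apply_flips[OF assms(1,2)] unfolding D_def by blast
qed

lemma coded_flips:
  assumes "pair_graph G" "coded n (pverts G) D" "\<And>u v. u \<in> pverts G \<Longrightarrow> v \<in> pverts G \<Longrightarrow> D u v = D v u"
  shows "\<exists>F. F \<subseteq> flips G \<and> finite F \<and> card F \<le> 2 ^ n * 2 ^ n \<and> adj (G \<oplus>\<^sub>F F) = xadj G D"
proof -
  obtain \<kappa> R where \<kappa>: "\<And>v. \<kappa> v < (2::nat) ^ n"
    and R: "\<And>v w. v \<in> pverts G \<Longrightarrow> w \<in> pverts G \<Longrightarrow> D v w = R (\<kappa> v) (\<kappa> w)"
    using coded_index[OF assms(2)] by metis
  define K where "K k = {v\<in>pverts G. \<kappa> v = k}" for k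
  \<comment> \<open>Each unordered pair of classes contributes one flip, hence
    \<open>k \<le> l\<close>: the flips for \<open>(k, l)\<close> and \<open>(l, k)\<close> would
    cancel each other.\<close>
  define I where "I = {(k, l). k < 2 ^ n \<and> l < 2 ^ n \<and> k \<le> l \<and> R k l \<and> K k \<noteq> {} \<and> K l \<noteq> {}}"
  define F where "F = (\<lambda>(k, l). (K k, K l)) ` I"
  have Isub: "I \<subseteq> {..<(2::nat) ^ n} \<times> {..<(2::nat) ^ n}" by (auto simp: I_def)
  then have finI: "finite I" using finite_subset by blast
  have "card F \<le> card I" unfolding F_def by (rule card_image_le[OF finI])
  also have "\<dots> \<le> card ({..<(2::nat) ^ n} \<times> {..<(2::nat) ^ n})" using Isub by (intro card_mono) auto
  finally have card: "card F \<le> 2 ^ n * 2 ^ n" by (simp add: card_cartesian_product)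
  have finF: "finite F" using finI by (simp add: F_def)
  have "odd (card {f\<in>F. (u, v) \<in> fst f \<times> snd f \<union> snd f \<times> fst f}) \<longleftrightarrow> D u v"
    if uv: "u \<in> pverts G" "v \<in> pverts G" for u v
  proof -
    let ?k = "min (\<kappa> u) (\<kappa> v)" and ?l = "max (\<kappa> u) (\<kappa> v)"
    have mem: "x \<in> K k \<longleftrightarrow> k = \<kappa> x" if "x \<in> pverts G" for x k using that by (auto simp: K_def)
    have RD: "R ?k ?l \<longleftrightarrow> D u v" using R[of u v] R[of v u] uv assms(3)[of u v] by (auto simp: min_def max_def)
    have "{f\<in>F. (u, v) \<in> fst f \<times> snd f \<union> snd f \<times> fst f} = (if D u v then {(K ?k, K ?l)} else {})" (is "?L = ?R")
    proof (intro set_eqI iffI)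
      fix f assume "f \<in> ?L"
      then obtain k l where "(k, l) \<in> I" and f: "f = (K k, K l)" and "u \<in> K k \<and> v \<in> K l \<or> u \<in> K l \<and> v \<in> K k"
        by (auto simp: F_def)
      then have "k \<le> l" "R k l" "k = \<kappa> u \<and> l = \<kappa> v \<or> l = \<kappa> u \<and> k = \<kappa> v" using mem uv by (auto simp: I_def)
      then have "k = ?k" "l = ?l" by (auto simp: min_def max_def)
      then show "f \<in> ?R" using RD f \<open>R k l\<close> by auto
    next
      fix f assume "f \<in> ?R"
      then have D: "D u v" and f: "f = (K ?k, K ?l)" by (auto split: if_splits)
      have "u \<in> K (\<kappa> u)" "v \<in> K (\<kappa> v)" using uv by (auto simp: K_def)
      then have "u \<in> K ?k \<and> v \<in> K ?l \<or> u \<in> K ?l \<and> v \<in> K ?k" by (auto simp: min_def max_def)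
      moreover from this have "(?k, ?l) \<in> I" using D RD \<kappa> by (auto simp: I_def min_def max_def)
      then have "f \<in> F" unfolding F_def f by (rule rev_image_eqI) simp
      ultimately show "f \<in> ?L" by (auto simp: f)
    qed
    then show ?thesis by simp
  qed
  then have "adj (G \<oplus>\<^sub>F F) = xadj G D"
    unfolding adj_apply_flips[OF assms(1) finF] by (auto simp: fun_eq_iff xadj_def)
  moreover have "F \<subseteq> flips G" by (auto simp: F_def flips_def K_def)
  ultimately show ?thesis using card finF by blast
qed

section \<open>Formulas on flipped graphs\<close>

definition Disj :: "formula \<Rightarrow> formula \<Rightarrow> formula" where
  "Disj \<phi> \<psi> = Neg (Conj (Neg \<phi>) (Neg \<psi>))"

definition Xor :: "formula \<Rightarrow> formula \<Rightarrow> formula" where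
  "Xor \<phi> \<psi> = Disj (Conj \<phi> (Neg \<psi>)) (Conj (Neg \<phi>) \<psi>)"

lemma sat_Disj [simp]: "sat M e (Disj \<phi> \<psi>) \<longleftrightarrow> sat M e \<phi> \<or> sat M e \<psi>"
  by (simp add: Disj_def)

lemma sat_Xor [simp]: "sat M e (Xor \<phi> \<psi>) \<longleftrightarrow> (sat M e \<phi> \<noteq> sat M e \<psi>)"
  by (auto simp: Xor_def)

lemma fv_Disj [simp]: "fv (Disj \<phi> \<psi>) = fv \<phi> \<union> fv \<psi>"
  by (simp add: Disj_def)

lemma fv_Xor [simp]: "fv (Xor \<phi> \<psi>) = fv \<phi> \<union> fv \<psi>"
  by (auto simp: Xor_def)

primrec rectF :: "(nat \<Rightarrow> nat) \<Rightarrow> (nat \<Rightarrow> nat) \<Rightarrow> nat \<Rightarrow> nat \<Rightarrow> nat \<Rightarrow> formula" where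
  "rectF p q 0 x y = Neg (Equal x x)"
| "rectF p q (Suc k) x y = Disj (rectF p q k x y) (Conj (Pred (p k) x) (Pred (q k) y))"

lemma sat_rectF [simp]:
  "sat M e (rectF p q k x y) \<longleftrightarrow> (\<exists>i<k. e x \<in> snd M (p i) \<and> e y \<in> snd M (q i))"
  by (induction k) (auto simp: less_Suc_eq)

lemma fv_rectF: "fv (rectF p q k x y) \<subseteq> {x, y}"
  by (induction k) auto

text \<open>Predicates are interleaved modulo 6. Residues 0 and 1 hold the rectangles of the flips,
  2 and 3 the rectangles of the prediction made from the samples, 4 and 5 the two marks. All kinds
  can thus be used together, with any number of rectangles.\<close>

definition hadjF :: "nat \<Rightarrow> nat \<Rightarrow> nat \<Rightarrow> formula" where
  "hadjF k x y = Conj (Neg (Equal x y)) (Xor (Adj x y) (rectF (\<lambda>i. 6 * i) (\<lambda>i. 6 * i + 1) k x y))"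

definition hadj :: "nat \<Rightarrow> 'v coloured_graph \<Rightarrow> 'v \<Rightarrow> 'v \<Rightarrow> bool" where
  "hadj k M u v \<longleftrightarrow> u \<noteq> v \<and> (adj (fst M) u v \<noteq> (\<exists>i<k. u \<in> snd M (6 * i) \<and> v \<in> snd M (6 * i + 1)))"

lemma sat_hadjF [simp]: "sat M e (hadjF k x y) \<longleftrightarrow> hadj k M (e x) (e y)"
  by (simp add: hadjF_def hadj_def adj_def)

lemma fv_hadjF: "fv (hadjF k x y) \<subseteq> {x, y}"
  using fv_rectF by (fastforce simp: hadjF_def)

text \<open>The last argument is a bound on the variables in use. Each step binds it and recurses
  with its successor, so nothing is captured.\<close>

primrec nearF :: "nat \<Rightarrow> nat \<Rightarrow> nat \<Rightarrow> nat \<Rightarrow> nat \<Rightarrow> formula" where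
  "nearF k 0 = (\<lambda>x y b. Equal x y)"
| "nearF k (Suc n) = (\<lambda>x y b. Disj (nearF k n x y b) (Exists b (Conj (hadjF k x b) (nearF k n b y (Suc b)))))"

lemma sat_nearF:
  assumes "\<And>u v. hadj k M u v \<Longrightarrow> v \<in> pverts (fst M)" "x < b" "y < b"
  shows "sat M e (nearF k n x y b) \<longleftrightarrow> near (hadj k M) n (e x) (e y)"
  using assms(2,3)
proof (induction n arbitrary: x b e)
  case (Suc n)
  have "sat M (e(b := v)) (nearF k n b y (Suc b)) \<longleftrightarrow> near (hadj k M) n v (e y)" for v
    by (subst Suc.IH) (use Suc.prems in auto)
  then show ?case using Suc.IH[OF Suc.prems] Suc.prems assms(1) by auto
qed simp

lemma fv_nearF: "fv (nearF k n x y b) \<subseteq> {x, y}"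
proof (induction n arbitrary: x b)
  case (Suc n)
  show ?case using Suc[of x b] Suc[of b "Suc b"] fv_hadjF[of k x b] by auto
qed simp

definition palette ::
  "(nat \<Rightarrow> 'v set) \<Rightarrow> (nat \<Rightarrow> 'v set) \<Rightarrow> (nat \<Rightarrow> 'v set) \<Rightarrow> (nat \<Rightarrow> 'v set) \<Rightarrow> 'v set \<Rightarrow> 'v set \<Rightarrow> nat \<Rightarrow> 'v set" where
  "palette A B P Q W Z i = [A (i div 6), B (i div 6), P (i div 6), Q (i div 6), W, Z] ! (i mod 6)"

lemma palette_simps [simp]:
  "palette A B P Q W Z (6 * i) = A i" "palette A B P Q W Z (Suc (6 * i)) = B i"
  "palette A B P Q W Z (6 * i + 2) = P i" "palette A B P Q W Z (6 * i + 3) = Q i"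
  "palette A B P Q W Z 4 = W" "palette A B P Q W Z 5 = Z"
proof -
  have "Suc (6 * i) mod 6 = 1" "Suc (6 * i) div 6 = i" "(6 * i + 2) mod 6 = 2" "(6 * i + 2) div 6 = i"
    "(6 * i + 3) mod 6 = 3" "(6 * i + 3) div 6 = i" by presburger+
  then show "palette A B P Q W Z (6 * i) = A i" "palette A B P Q W Z (Suc (6 * i)) = B i"
    "palette A B P Q W Z (6 * i + 2) = P i" "palette A B P Q W Z (6 * i + 3) = Q i"
    "palette A B P Q W Z 4 = W" "palette A B P Q W Z 5 = Z"
    by (simp_all add: palette_def)
qed

lemma palette_subset:
  assumes "\<And>i. A i \<subseteq> V" "\<And>i. B i \<subseteq> V" "\<And>i. P i \<subseteq> V" "\<And>i. Q i \<subseteq> V" "W \<subseteq> V" "Z \<subseteq> V"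
  shows "palette A B P Q W Z i \<subseteq> V"
proof -
  have "i mod 6 < 6" by simp
  then have "i mod 6 = 0 \<or> i mod 6 = 1 \<or> i mod 6 = 2 \<or> i mod 6 = 3 \<or> i mod 6 = 4 \<or> i mod 6 = 5" by arith
  then show ?thesis using assms by (elim disjE) (simp_all add: palette_def)
qed

lemma hadj_palette:
  assumes "pair_graph G" "\<And>k. A k \<subseteq> pverts G" "\<And>k. B k \<subseteq> pverts G"
    "\<And>v w. v \<in> pverts G \<Longrightarrow> w \<in> pverts G \<Longrightarrow> D v w \<longleftrightarrow> (\<exists>i<k. v \<in> A i \<and> w \<in> B i)"
  shows "hadj k (G, palette A B P Q W Z) = xadj G D"
proof (intro ext)
  fix u v
  show "hadj k (G, palette A B P Q W Z) u v = xadj G D u v"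
  proof (cases "u \<in> pverts G \<and> v \<in> pverts G")
    case True
    then show ?thesis using assms(4) by (simp add: hadj_def xadj_def)
  next
    case False
    then have "\<not> adj G u v" using adj_facts[OF assms(1)] by blast
    moreover have "\<not> (\<exists>i<k. u \<in> palette A B P Q W Z (6 * i) \<and> v \<in> palette A B P Q W Z (6 * i + 1))"
      using False assms(2,3) by (simp, blast)
    ultimately show ?thesis using False unfolding hadj_def xadj_def fst_conv snd_conv by blast
  qed
qed

lemma xadj_verts: "xadj G D u v \<Longrightarrow> u \<in> pverts G \<and> v \<in> pverts G"
  by (simp add: xadj_def)

lemma coded_palette:
  assumes "pair_graph G" "coded n (pverts G) D"
  obtains A B :: "nat \<Rightarrow> 'v set" where "\<And>k. A k \<subseteq> pverts G" "\<And>k. B k \<subseteq> pverts G"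
    "\<And>P Q W Z. hadj (2 ^ n) (G, palette A B P Q W Z) = xadj G D"
proof -
  obtain A B :: "nat \<Rightarrow> 'v set" where AB: "\<And>k. A k \<subseteq> pverts G" "\<And>k. B k \<subseteq> pverts G"
    "\<And>v w. v \<in> pverts G \<Longrightarrow> w \<in> pverts G \<Longrightarrow> D v w \<longleftrightarrow> (\<exists>k<2^n. v \<in> A k \<and> w \<in> B k)"
    using coded_rectangles[OF assms(2)] by metis
  show thesis by (rule that[OF AB(1,2) hadj_palette[OF assms(1) AB]])
qed

lemma sat_nearF_xadj:
  assumes "hadj k (G, P) = xadj G D" "x < b" "y < b"
  shows "sat (G, P) e (nearF k \<rho> x y b) \<longleftrightarrow> near (xadj G D) \<rho> (e x) (e y)"
  using sat_nearF[of k "(G, P)" x b y e \<rho>] assms xadj_verts[of G D] by simp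

section \<open>Uniform ladder bounds in a monadically stable class\<close>

lemma stable_bound:
  fixes C :: "'a pair_pre_digraph set"
  assumes "monadically_stable C" "fv \<psi> \<subseteq> {..<p + q}"
  shows "\<exists>h. \<forall>G\<in>C. \<forall>P. (\<forall>i. P i \<subseteq> pverts G) \<longrightarrow> \<not> orders (G, P) \<psi> p q h"
proof -
  \<comment> \<open>All colourings of all members form a single unary expansion. Its stability gives
    one bound for every member and every colouring at once.\<close>
  define D where "D = {(G, P :: nat \<Rightarrow> 'a set). G \<in> C \<and> (\<forall>i. P i \<subseteq> pverts G)}"
  have "fst ` D = C"
  proof (intro equalityI subsetI)
    fix G assume "G \<in> C"
    then have "(G, \<lambda>_. {}) \<in> D" by (simp add: D_def)
    then show "G \<in> fst ` D" by force
  qed (auto simp: D_def)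
  then have "unary_expansion D C" by (auto simp: unary_expansion_def D_def)
  then have "stable_class D" using assms(1) by (simp add: monadically_stable_def)
  then have "\<not> (\<forall>h. \<exists>M\<in>D. orders M \<psi> p q h)" using assms(2) unfolding stable_class_def by blast
  then show ?thesis unfolding D_def by blast
qed

lemma stable_bound_1:
  assumes "monadically_stable C" "fv \<psi> \<subseteq> {0, 1}"
  shows "\<exists>h. \<forall>G\<in>C. \<forall>P. (\<forall>i. P i \<subseteq> pverts G) \<longrightarrow>
     \<not> ladder h (\<lambda>u v. u \<in> pverts G \<and> v \<in> pverts G \<and> sat (G, P) ((!) [u, v]) \<psi>)"
proof -
  have "fv \<psi> \<subseteq> {..<1 + 1}" using assms(2) by auto
  from stable_bound[OF assms(1) this] obtain h where
    h: "\<forall>G\<in>C. \<forall>P. (\<forall>i. P i \<subseteq> pverts G) \<longrightarrow> \<not> orders (G, P) \<psi> 1 1 h" ..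
  have "orders (G, P) \<psi> 1 1 h"
    if "ladder h (\<lambda>u v. u \<in> pverts G \<and> v \<in> pverts G \<and> sat (G, P) ((!) [u, v]) \<psi>)"
    for G :: "'a pair_pre_digraph" and P
  proof -
    from that obtain a b where ab: "\<forall>i\<in>{1..h}. \<forall>j\<in>{1..h}.
        (a i \<in> pverts G \<and> b j \<in> pverts G \<and> sat (G, P) ((!) [a i, b j]) \<psi>) \<longleftrightarrow> i \<le> j"
      unfolding ladder_def by (elim exE)
    have "a i \<in> pverts G" "b i \<in> pverts G" if "i \<in> {1..h}" for i using ab that by blast+
    then show ?thesis unfolding orders_def
      using ab by (intro exI[of _ "\<lambda>i. [a i]"] exI[of _ "\<lambda>i. [b i]"]) (simp add: tuples_def)
  qed
  then show ?thesis using h by blast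
qed

lemma stable_bound_2:
  assumes "monadically_stable C" "fv \<psi> \<subseteq> {0, 1, 2}"
  shows "\<exists>h. \<forall>G\<in>C. \<forall>P. (\<forall>i. P i \<subseteq> pverts G) \<longrightarrow>
     \<not> ladder h (\<lambda>u vw. u \<in> pverts G \<and> fst vw \<in> pverts G \<and> snd vw \<in> pverts G \<and>
          sat (G, P) ((!) [u, fst vw, snd vw]) \<psi>)"
proof -
  have "fv \<psi> \<subseteq> {..<1 + 2}" using assms(2) by auto
  from stable_bound[OF assms(1) this] obtain h where
    h: "\<forall>G\<in>C. \<forall>P. (\<forall>i. P i \<subseteq> pverts G) \<longrightarrow> \<not> orders (G, P) \<psi> 1 2 h" ..
  have "orders (G, P) \<psi> 1 2 h"
    if "ladder h (\<lambda>u vw. u \<in> pverts G \<and> fst vw \<in> pverts G \<and> snd vw \<in> pverts G \<and>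
          sat (G, P) ((!) [u, fst vw, snd vw]) \<psi>)"
    for G :: "'a pair_pre_digraph" and P
  proof -
    from that obtain a b where ab: "\<forall>i\<in>{1..h}. \<forall>j\<in>{1..h}.
        (a i \<in> pverts G \<and> fst (b j) \<in> pverts G \<and> snd (b j) \<in> pverts G \<and>
         sat (G, P) ((!) [a i, fst (b j), snd (b j)]) \<psi>) \<longleftrightarrow> i \<le> j"
      unfolding ladder_def by (elim exE)
    have "a i \<in> pverts G" "fst (b i) \<in> pverts G" "snd (b i) \<in> pverts G" if "i \<in> {1..h}" for i
      using ab that by blast+
    then show ?thesis unfolding orders_def
      using ab by (intro exI[of _ "\<lambda>i. [a i]"] exI[of _ "\<lambda>i. [fst (b i), snd (b i)]"]) (simp add: tuples_def)
  qed
  then show ?thesis using h by blast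
qed

definition trace_split :: "'v set \<Rightarrow> ('v \<Rightarrow> 'v \<Rightarrow> bool) \<Rightarrow> nat \<Rightarrow> 'v \<Rightarrow> 'v \<times> 'v \<Rightarrow> bool" where
  "trace_split V H \<rho> x vw \<longleftrightarrow> x \<in> V \<and> fst vw \<in> V \<and> snd vw \<in> V \<and>
     (\<exists>u\<in>V. near H \<rho> x u \<and> H (fst vw) u \<noteq> H (snd vw) u)"

text \<open>\<open>Z\<close> is to be the neighbourhood of a reference vertex to which
  \<open>v\<close> is compared; \<open>W\<close> restricts the comparison to selected vertices of
  the ball around \<open>x\<close>.\<close>

definition marked_split :: "'v set \<Rightarrow> ('v \<Rightarrow> 'v \<Rightarrow> bool) \<Rightarrow> nat \<Rightarrow> 'v set \<Rightarrow> 'v set \<Rightarrow> 'v \<Rightarrow> 'v \<Rightarrow> bool" where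
  "marked_split V H \<rho> W Z v x \<longleftrightarrow> v \<in> V \<and> x \<in> V \<and> (\<exists>u\<in>V. u \<in> W \<and> near H \<rho> x u \<and> H v u \<noteq> (u \<in> Z))"

lemma no_trace_ladder:
  fixes C :: "'v pair_pre_digraph set"
  assumes "monadically_stable C" "\<forall>G\<in>C. pair_graph G"
  shows "\<exists>h. \<forall>G\<in>C. \<forall>D. coded n (pverts G) D \<longrightarrow>
     \<not> ladder h (trace_split (pverts G) (xadj G D) \<rho>)"
proof -
  let ?k = "2 ^ n"
  define \<psi> where "\<psi> = Exists 3 (Conj (nearF ?k \<rho> 0 3 4) (Xor (hadjF ?k 1 3) (hadjF ?k 2 3)))"
  have "fv \<psi> \<subseteq> {0, 1, 2}"
    using fv_nearF[of ?k \<rho> 0 3 4] fv_hadjF[of ?k 1 3] fv_hadjF[of ?k 2 3] by (auto simp: \<psi>_def)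
  from stable_bound_2[OF assms(1) this] obtain h where
    h: "\<forall>G\<in>C. \<forall>P. (\<forall>i. P i \<subseteq> pverts G) \<longrightarrow>
     \<not> ladder h (\<lambda>u vw. u \<in> pverts G \<and> fst vw \<in> pverts G \<and> snd vw \<in> pverts G \<and>
          sat (G, P) ((!) [u, fst vw, snd vw]) \<psi>)" ..
  show ?thesis
  proof (intro exI[of _ h] ballI allI impI)
    fix G D assume G: "G \<in> C" and D: "coded n (pverts G) D"
    have pg: "pair_graph G" using assms G by blast
    obtain A B where AB: "\<And>k. A k \<subseteq> pverts G" "\<And>k. B k \<subseteq> pverts G"
      and pal: "\<And>P Q W Z. hadj ?k (G, palette A B P Q W Z) = xadj G D"
      using coded_palette[OF pg D] by metis
    define P where "P = palette A B (\<lambda>_. {}) (\<lambda>_. {}) {} {}"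
    have H: "hadj ?k (G, P) = xadj G D" unfolding P_def by (rule pal)
    note nr = sat_nearF_xadj[OF H]
    have "P i \<subseteq> pverts G" for i unfolding P_def by (rule palette_subset) (auto simp: AB(1,2))
    then have "\<not> ladder h (\<lambda>u vw. u \<in> pverts G \<and> fst vw \<in> pverts G \<and> snd vw \<in> pverts G \<and>
          sat (G, P) ((!) [u, fst vw, snd vw]) \<psi>)" using h G by blast
    moreover have "sat (G, P) ((!) [x, v, w]) \<psi> \<longleftrightarrow>
      (\<exists>u\<in>pverts G. near (xadj G D) \<rho> x u \<and> xadj G D v u \<noteq> xadj G D w u)" for x v w
      unfolding \<psi>_def by (simp add: nr H)
    ultimately show "\<not> ladder h (trace_split (pverts G) (xadj G D) \<rho>)"
      unfolding trace_split_def[abs_def] by (simp only: not_False_eq_True)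
  qed
qed

lemma no_marked_ladder:
  fixes C :: "'v pair_pre_digraph set"
  assumes "monadically_stable C" "\<forall>G\<in>C. pair_graph G"
  shows "\<exists>h. \<forall>G\<in>C. \<forall>D. coded n (pverts G) D \<longrightarrow> (\<forall>W Z.
     \<not> ladder h (marked_split (pverts G) (xadj G D) \<rho> W Z))"
proof -
  let ?k = "2 ^ n"
  define \<psi> where "\<psi> = Exists 2 (Conj (Pred 4 2) (Conj (nearF ?k \<rho> 1 2 3) (Xor (hadjF ?k 0 2) (Pred 5 2))))"
  have "fv \<psi> \<subseteq> {0, 1}"
    using fv_nearF[of ?k \<rho> 1 2 3] fv_hadjF[of ?k 0 2] by (auto simp: \<psi>_def)
  from stable_bound_1[OF assms(1) this] obtain h where
    h: "\<forall>G\<in>C. \<forall>P. (\<forall>i. P i \<subseteq> pverts G) \<longrightarrow>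
     \<not> ladder h (\<lambda>u v. u \<in> pverts G \<and> v \<in> pverts G \<and> sat (G, P) ((!) [u, v]) \<psi>)" ..
  show ?thesis
  proof (intro exI[of _ h] ballI allI impI)
    fix G D W Z assume G: "G \<in> C" and D: "coded n (pverts G) D"
    have pg: "pair_graph G" using assms G by blast
    obtain A B where AB: "\<And>k. A k \<subseteq> pverts G" "\<And>k. B k \<subseteq> pverts G"
      and pal: "\<And>P Q W Z. hadj ?k (G, palette A B P Q W Z) = xadj G D"
      using coded_palette[OF pg D] by metis
    define P where "P = palette A B (\<lambda>_. {}) (\<lambda>_. {}) (W \<inter> pverts G) (Z \<inter> pverts G)"
    have H: "hadj ?k (G, P) = xadj G D" unfolding P_def by (rule pal)
    note nr = sat_nearF_xadj[OF H]
    have "P i \<subseteq> pverts G" for i unfolding P_def by (rule palette_subset) (auto simp: AB(1,2))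
    then have "\<not> ladder h (\<lambda>u v. u \<in> pverts G \<and> v \<in> pverts G \<and> sat (G, P) ((!) [u, v]) \<psi>)" using h G by blast
    moreover have "sat (G, P) ((!) [v, x]) \<psi> \<longleftrightarrow>
      (\<exists>u\<in>pverts G. u \<in> W \<and> near (xadj G D) \<rho> x u \<and> xadj G D v u \<noteq> (u \<in> Z))" for x v
      unfolding \<psi>_def by (auto simp: nr H) (auto simp: P_def)
    ultimately show "\<not> ladder h (marked_split (pverts G) (xadj G D) \<rho> W Z)"
      unfolding marked_split_def[abs_def] by (simp only: not_False_eq_True)
  qed
qed

text \<open>\<open>K\<close> is a prediction of \<open>H\<close>, later read off the sample
  vertices. The ball of \<open>x\<close> is exceptional for \<open>v\<close> if it contains
  \<open>v\<close> or if the prediction for \<open>v\<close> fails inside it.\<close>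

definition touches :: "'v set \<Rightarrow> ('v \<Rightarrow> 'v \<Rightarrow> bool) \<Rightarrow> nat \<Rightarrow> ('v \<Rightarrow> 'v \<Rightarrow> bool) \<Rightarrow> 'v \<Rightarrow> 'v \<Rightarrow> bool" where
  "touches V H \<rho> K v x \<longleftrightarrow> near H \<rho> x v \<or> (\<exists>u\<in>V. near H \<rho> x u \<and> H v u \<noteq> K v u)"

text \<open>\<open>W\<close> decides which common exceptional vertices count, so that a selection
  from the links of a \<open>link_grid\<close> yields a ladder.\<close>

definition links ::
  "'v set \<Rightarrow> ('v \<Rightarrow> 'v \<Rightarrow> bool) \<Rightarrow> nat \<Rightarrow> ('v \<Rightarrow> 'v \<Rightarrow> bool) \<Rightarrow> 'v set \<Rightarrow> 'v \<Rightarrow> 'v \<Rightarrow> bool" where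
  "links V H \<rho> K W x y \<longleftrightarrow> x \<in> V \<and> y \<in> V \<and> (\<exists>v\<in>V. v \<in> W \<and> touches V H \<rho> K v x \<and> touches V H \<rho> K v y)"

text \<open>The prediction takes \<open>T\<close> pairs of predicates, so the formula and with it
  the bound depend on \<open>T\<close>. The bound is uniform in these predicates because the samples
  vary with the graph.\<close>

lemma no_link_ladder:
  fixes C :: "'v pair_pre_digraph set" and T :: nat
  assumes "monadically_stable C" "\<forall>G\<in>C. pair_graph G"
  shows "\<exists>h. \<forall>G\<in>C. \<forall>D. coded n (pverts G) D \<longrightarrow> (\<forall>W P Q.
     \<not> ladder h (links (pverts G) (xadj G D) \<rho> (\<lambda>v u. \<exists>l<T. v \<in> P l \<and> u \<in> Q l) W))"
proof -
  let ?k = "2 ^ n"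
  define \<zeta> where "\<zeta> x = Disj (nearF ?k \<rho> x 2 3) (Exists 3 (Conj (nearF ?k \<rho> x 3 4)
     (Xor (hadjF ?k 2 3) (rectF (\<lambda>l. 6 * l + 2) (\<lambda>l. 6 * l + 3) T 2 3))))" for x
  define \<psi> where "\<psi> = Exists 2 (Conj (Pred 4 2) (Conj (\<zeta> 0) (\<zeta> 1)))"
  have "fv (\<zeta> x) \<subseteq> {x, 2}" for x
    using fv_nearF[of ?k \<rho> x 2 3] fv_nearF[of ?k \<rho> x 3 4] fv_hadjF[of ?k 2 3] fv_rectF[of _ _ T 2 3]
    by (fastforce simp: \<zeta>_def)
  from this[of 0] this[of 1] have "fv \<psi> \<subseteq> {0, 1}"
    by (auto simp: \<psi>_def)
  from stable_bound_1[OF assms(1) this] obtain h where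
    h: "\<forall>G\<in>C. \<forall>P. (\<forall>i. P i \<subseteq> pverts G) \<longrightarrow>
     \<not> ladder h (\<lambda>u v. u \<in> pverts G \<and> v \<in> pverts G \<and> sat (G, P) ((!) [u, v]) \<psi>)" ..
  show ?thesis
  proof (intro exI[of _ h] ballI allI impI)
    fix G D W and P Q :: "nat \<Rightarrow> 'v set" assume G: "G \<in> C" and D: "coded n (pverts G) D"
    have pg: "pair_graph G" using assms G by blast
    obtain A B where AB: "\<And>k. A k \<subseteq> pverts G" "\<And>k. B k \<subseteq> pverts G"
      and pal: "\<And>P Q W Z. hadj ?k (G, palette A B P Q W Z) = xadj G D"
      using coded_palette[OF pg D] by metis
    define R where "R = palette A B (\<lambda>i. P i \<inter> pverts G) (\<lambda>i. Q i \<inter> pverts G) (W \<inter> pverts G) {}"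
    let ?t = "touches (pverts G) (xadj G D) \<rho> (\<lambda>v u. \<exists>l<T. v \<in> P l \<and> u \<in> Q l)"
    have H: "hadj ?k (G, R) = xadj G D" unfolding R_def by (rule pal)
    note nr = sat_nearF_xadj[OF H]
    have R: "R 4 = W \<inter> pverts G" "R (6 * i + 2) = P i \<inter> pverts G" "R (6 * i + 3) = Q i \<inter> pverts G" for i
      unfolding R_def by (simp_all only: palette_simps)
    have "R i \<subseteq> pverts G" for i unfolding R_def by (rule palette_subset) (auto simp: AB(1,2))
    then have "\<not> ladder h (\<lambda>u v. u \<in> pverts G \<and> v \<in> pverts G \<and> sat (G, R) ((!) [u, v]) \<psi>)" using h G by blast
    moreover have "sat (G, R) ((!) [x, y]) \<psi> \<longleftrightarrow> (\<exists>v\<in>pverts G. v \<in> W \<and> ?t v x \<and> ?t v y)" for x y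
    proof -
      have "sat (G, R) (e(2 := v)) (\<zeta> i) \<longleftrightarrow> ?t v (e i)" if "i < 2" "v \<in> pverts G" for v e i
      proof -
        have "sat (G, R) (e(2 := v)) (\<zeta> i) \<longleftrightarrow> near (xadj G D) \<rho> (e i) v \<or>
           (\<exists>u\<in>pverts G. near (xadj G D) \<rho> (e i) u \<and>
             (xadj G D v u \<noteq> (\<exists>l<T. v \<in> R (6 * l + 2) \<and> u \<in> R (6 * l + 3))))"
          using that(1) by (simp add: \<zeta>_def nr H del: add_2_eq_Suc' add_numeral_left)
        also have "\<dots> \<longleftrightarrow> ?t v (e i)" unfolding R touches_def using that(2) by auto
        finally show ?thesis .
      qed
      from this[of 0 _ "(!) [x, y]"] this[of 1 _ "(!) [x, y]"] show ?thesis
        unfolding \<psi>_def using R(1) by auto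
    qed
    ultimately show "\<not> ladder h (links (pverts G) (xadj G D) \<rho> (\<lambda>v u. \<exists>l<T. v \<in> P l \<and> u \<in> Q l) W)"
      unfolding links_def[abs_def] by (simp only: not_False_eq_True)
  qed
qed

section \<open>Monadically stable classes are flip-wide\<close>

text \<open>Greedy extension: a vertex that no member of \<open>S\<close> represents agrees, by the
  dichotomy, with each member on fewer than \<open>c\<close> indices, and can be added to
  \<open>S\<close>.\<close>

lemma maximal_separated:
  assumes "finite I" "c > 0"
    and dich: "\<And>v w. v \<in> V \<Longrightarrow> w \<in> V \<Longrightarrow> card {i\<in>I. tr v i \<noteq> tr w i} < c \<or> card {i\<in>I. tr v i = tr w i} < c"
  shows "(\<exists>S\<subseteq>V. finite S \<and> card S = T \<and> (\<forall>v\<in>S. \<forall>w\<in>S. v \<noteq> w \<longrightarrow> card {i\<in>I. tr v i = tr w i} < c)) \<or>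
    (\<exists>S\<subseteq>V. finite S \<and> card S < T \<and> (\<forall>v\<in>V. \<exists>s\<in>S. card {i\<in>I. tr v i \<noteq> tr s i} < c))"
proof (induction T)
  case 0
  show ?case by (intro disjI1 exI[of _ "{}"]) auto
next
  case (Suc T)
  then show ?case
  proof
    assume "\<exists>S\<subseteq>V. finite S \<and> card S = T \<and> (\<forall>v\<in>S. \<forall>w\<in>S. v \<noteq> w \<longrightarrow> card {i\<in>I. tr v i = tr w i} < c)"
    then obtain S where S: "S \<subseteq> V" "finite S" "card S = T"
      and sep: "\<forall>v\<in>S. \<forall>w\<in>S. v \<noteq> w \<longrightarrow> card {i\<in>I. tr v i = tr w i} < c" by (elim exE conjE)
    show ?thesis
    proof (cases "\<forall>v\<in>V. \<exists>s\<in>S. card {i\<in>I. tr v i \<noteq> tr s i} < c")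
      case True
      then show ?thesis using S by (intro disjI2 exI[of _ S]) auto
    next
      case False
      then obtain v where v: "v \<in> V" "\<forall>s\<in>S. \<not> card {i\<in>I. tr v i \<noteq> tr s i} < c" by blast
      \<comment> \<open>A member of \<open>S\<close> differs from itself nowhere, which is fewer
        than \<open>c\<close> times because \<open>c\<close> is positive.\<close>
      have "v \<notin> S" using v(2) \<open>c > 0\<close> by fastforce
      have vs: "card {i\<in>I. tr v i = tr s i} < c" if "s \<in> S" for s
        using dich[of v s] v that S(1) by blast
      have sv: "card {i\<in>I. tr s i = tr v i} < c" if "s \<in> S" for s
        using vs[OF that] by (simp add: eq_commute)
      have "\<forall>x\<in>insert v S. \<forall>w\<in>insert v S. x \<noteq> w \<longrightarrow> card {i\<in>I. tr x i = tr w i} < c"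
        using sep vs sv by simp
      then show ?thesis using S v(1) \<open>v \<notin> S\<close> by (intro disjI1 exI[of _ "insert v S"]) simp
    qed
  next
    assume "\<exists>S\<subseteq>V. finite S \<and> card S < T \<and> (\<forall>v\<in>V. \<exists>s\<in>S. card {i\<in>I. tr v i \<noteq> tr s i} < c)"
    then show ?thesis using less_SucI by blast
  qed
qed

text \<open>In every ball \<open>halving\<close> produces vertices \<open>y\<close> and
  \<open>z\<close> of \<open>S\<close> and witnesses \<open>u\<close> in a triangular pattern. There
  are boundedly many choices of \<open>y\<close> and \<open>z\<close>, so more than \<open>h\<close>
  balls share them, and only the witnesses vary with the ball.\<close>

lemma separated_ladder:
  fixes N :: "'v \<Rightarrow> 'u \<Rightarrow> bool" and Bk :: "nat \<Rightarrow> 'u set"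
  assumes S: "finite S" "2 ^ h \<le> card S" and J: "finite J" "card S ^ h * card S * h < card J"
    and disj: "\<And>i j u. i \<in> J \<Longrightarrow> j \<in> J \<Longrightarrow> u \<in> Bk i \<Longrightarrow> u \<in> Bk j \<Longrightarrow> i = j"
    and sep: "\<And>i v w. i \<in> J \<Longrightarrow> v \<in> S \<Longrightarrow> w \<in> S \<Longrightarrow> v \<noteq> w \<Longrightarrow> \<exists>u\<in>Bk i. N v u \<noteq> N w u"
  shows "\<exists>W Z y i. \<forall>p<h. \<forall>q<h. y p \<in> S \<and> i q \<in> J \<and>
     ((\<exists>u. u \<in> W \<and> u \<in> Bk (i q) \<and> N (y p) u \<noteq> (u \<in> Z)) \<longleftrightarrow> p \<le> q)"
proof -
  have "\<forall>i\<in>J. \<exists>y u z. z \<in> S \<and> (\<forall>j<h. y j \<in> S \<and> u j \<in> Bk i \<and> N (y j) (u j) \<noteq> N z (u j) \<and>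
           (\<forall>m<j. N (y j) (u m) = N z (u m)))"
  proof
    fix i assume "i \<in> J"
    show "\<exists>y u z. z \<in> S \<and> (\<forall>j<h. y j \<in> S \<and> u j \<in> Bk i \<and> N (y j) (u j) \<noteq> N z (u j) \<and>
           (\<forall>m<j. N (y j) (u m) = N z (u m)))"
      using halving[of S h "Bk i" "\<lambda>u v. N v u"] S sep[OF \<open>i \<in> J\<close>] by simp
  qed
  then obtain y u z where *: "\<forall>i\<in>J. z i \<in> S \<and> (\<forall>j<h. y i j \<in> S \<and> u i j \<in> Bk i \<and> N (y i j) (u i j) \<noteq> N (z i) (u i j) \<and>
           (\<forall>m<j. N (y i j) (u i m) = N (z i) (u i m)))"
    by metis
  \<comment> \<open>The possible keys number \<open>card S ^ h * card S\<close>, which explains the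
    assumption on \<open>card J\<close>.\<close>
  define key where "key i = (map (y i) [0..<h], z i)" for i
  define T where "T = {xs. set xs \<subseteq> S \<and> length xs = h} \<times> S"
  have finT: "finite T" using finite_lists_length_eq[OF S(1)] S(1) by (simp add: T_def)
  have "card T = card S ^ h * card S"
    using card_lists_length_eq[OF S(1)] by (simp add: T_def card_cartesian_product)
  then have "card T * h < card J" using J(2) by simp
  moreover have "key ` J \<subseteq> T" using * by (auto simp: key_def T_def)
  ultimately obtain t where t: "h < card {i\<in>J. key i = t}"
    using pigeonhole_fibre[OF J(1) finT] by metis
  have finJ: "finite {i\<in>J. key i = t}" using J(1) by simp
  obtain g where g: "strict_mono_on {..<card {i\<in>J. key i = t}} g" "g ` {..<card {i\<in>J. key i = t}} = {i\<in>J. key i = t}"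
    by (rule finite_nat_enum[OF finJ refl])
  have gJ: "g q \<in> J" "key (g q) = t" if "q < h" for q using g(2) t that by auto
  have ginj: "g q = g q' \<Longrightarrow> q = q'" if "q < h" "q' < h" for q q'
    using strict_mono_on_eqD[OF g(1), of q q'] t that by auto
  define y0 where "y0 p = fst t ! p" for p
  have y0: "y (g q) p = y0 p" if "q < h" "p < h" for p q
    using gJ(2)[OF that(1)] that(2) by (auto simp: y0_def key_def)
  have z0: "z (g q) = snd t" if "q < h" for q using gJ(2)[OF that] by (auto simp: key_def)
  \<comment> \<open>In the \<open>q\<close>-th ball exactly the first \<open>q + 1\<close> witnesses
    are marked. The vertex \<open>y0 p\<close> agrees with the reference at all witnesses before the
    \<open>p\<close>-th and differs at the \<open>p\<close>-th, so a marked difference is visible in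
    ball \<open>q\<close> exactly if \<open>p \<le> q\<close>. Disjointness keeps the marks of other
    balls out.\<close>
  define W where "W = {u (g q) m |q m. q < h \<and> m \<le> q}"
  define Z where "Z = {x. N (snd t) x}"
  have ladd: "(\<exists>x. x \<in> W \<and> x \<in> Bk (g q) \<and> N (y0 p) x \<noteq> (x \<in> Z)) \<longleftrightarrow> p \<le> q" if pq: "p < h" "q < h" for p q
  proof
    assume "p \<le> q"
    have "u (g q) p \<in> W" using pq \<open>p \<le> q\<close> by (auto simp: W_def)
    moreover have "u (g q) p \<in> Bk (g q)" "N (y0 p) (u (g q) p) \<noteq> N (snd t) (u (g q) p)"
      using *[rule_format, OF gJ(1)[OF pq(2)]] pq y0[OF pq(2,1)] z0[OF pq(2)] by auto
    ultimately show "\<exists>x. x \<in> W \<and> x \<in> Bk (g q) \<and> N (y0 p) x \<noteq> (x \<in> Z)"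
      unfolding Z_def by blast
  next
    assume "\<exists>x. x \<in> W \<and> x \<in> Bk (g q) \<and> N (y0 p) x \<noteq> (x \<in> Z)"
    then obtain q' m where x: "q' < h" "m \<le> q'" "u (g q') m \<in> Bk (g q)" "N (y0 p) (u (g q') m) \<noteq> N (snd t) (u (g q') m)"
      unfolding W_def Z_def by blast
    have "u (g q') m \<in> Bk (g q')" using *[rule_format, OF gJ(1)[OF x(1)]] x(1,2) by auto
    then have "g q' = g q" using disj[OF gJ(1) gJ(1)] x pq by blast
    then have "q' = q" using ginj x(1) pq by blast
    show "p \<le> q"
    proof (rule ccontr)
      assume "\<not> p \<le> q"
      then have "m < p" using x(2) \<open>q' = q\<close> by simp
      then have "N (y (g q) p) (u (g q) m) = N (z (g q)) (u (g q) m)"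
        using *[rule_format, OF gJ(1)[OF pq(2)]] pq by blast
      then show False using x(4) y0[OF pq(2,1)] z0[OF pq(2)] \<open>q' = q\<close> by simp
    qed
  qed
  have yS: "y0 p \<in> S" if "p < h" for p
    using *[rule_format, OF gJ(1)[OF that]] y0[OF that that] that by auto
  show ?thesis
    by (rule exI[of _ W], rule exI[of _ Z], rule exI[of _ y0], rule exI[of _ g])
       (intro allI impI conjI yS gJ(1) ladd; assumption)
qed

section \<open>The effect of the flips on distances\<close>

lemma near_split: "near E (m + n) u v \<Longrightarrow> \<exists>w. near E m u w \<and> near E n w v"
proof (induction m arbitrary: u)
  case (Suc m)
  then show ?case by (metis add_Suc near.simps(2) near_refl)
qed simp

text \<open>After the flips every sphere of radius \<open>\<rho>\<close> around \<open>A\<close> sees no other such sphere, and no vertex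
  outside the balls sees two of them. The interiors of the balls are not touched by the flips, so
  balls of radius \<open>\<rho>\<close> do not grow.\<close>

lemma flip_apart:
  fixes H K :: "'v \<Rightarrow> 'v \<Rightarrow> bool"
  assumes H: "\<And>u v. H u v \<Longrightarrow> u \<in> V \<and> v \<in> V \<and> H v u" "A \<subseteq> V" "scattered H (2 * \<rho>) A"
    and uniq: "\<And>v a b. v \<in> V \<Longrightarrow> a \<in> A \<Longrightarrow> b \<in> A \<Longrightarrow> touches V H \<rho> K v a \<Longrightarrow> touches V H \<rho> K v b \<Longrightarrow> a = b"
  defines "I \<equiv> {v. \<exists>a\<in>A. \<exists>d<\<rho>. near H d a v}"
  defines "L \<equiv> {v. \<exists>a\<in>A. near H \<rho> a v} - I"
  defines "X \<equiv> V - {v. \<exists>a\<in>A. near H \<rho> a v}"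
  defines "D \<equiv> \<lambda>u v. u \<in> L \<and> v \<in> L \<and> K u v \<and> K v u \<or> u \<in> X \<and> v \<in> L \<and> K u v \<or> u \<in> L \<and> v \<in> X \<and> K v u"
  assumes H': "\<And>u v. H' u v \<Longrightarrow> u \<in> V \<and> v \<in> V \<and> u \<noteq> v \<and> (H u v \<noteq> D u v)"
  shows "scattered H' (2 * \<rho> + 2) A"
proof -
  have Hsym: "H u v \<Longrightarrow> H v u" for u v using H(1) by blast
  \<comment> \<open>Between the spheres of different balls both directions of \<open>K\<close> turn
    out to be correct; their conjunction agrees with either and makes \<open>D\<close>
    symmetric.\<close>
  have Dsym: "D u v \<longleftrightarrow> D v u" for u v unfolding D_def by blast
  define E where "E u v \<longleftrightarrow> u \<in> V \<and> v \<in> V \<and> u \<noteq> v \<and> (H u v \<noteq> D u v)" for u v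
  have Esym: "E u v \<Longrightarrow> E v u" for u v unfolding E_def using Dsym[of u v] Hsym by blast
  have IX: "I \<inter> X = {}" unfolding I_def X_def using near_mono by (auto dest: near_mono less_imp_le)
  have int: "H u v" if "E u v" "u \<in> I" for u v
  proof -
    have "u \<notin> L" "u \<notin> X" using that(2) IX unfolding L_def by blast+
    then have "\<not> D u v" unfolding D_def by blast
    then show ?thesis using that(1) unfolding E_def by blast
  qed
  have ball: "near H d a v" if "near E d a v" "a \<in> A" "d \<le> \<rho>" for d a v
    using that
  proof (induction d arbitrary: v)
    case (Suc d)
    from Suc.prems(1) consider "near E d a v" | w where "near E d a w" "E w v"
      unfolding near_Suc_right by blast
    then show ?case
    proof cases
      case 1
      then show ?thesis using Suc near_mono[of H d a v "Suc d"] by auto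
    next
      case 2
      then have w: "near H d a w" using Suc by simp
      moreover have "d < \<rho>" using Suc.prems(3) by simp
      ultimately have "w \<in> I" using Suc.prems(2) unfolding I_def by blast
      then have "H w v" using int 2 by blast
      then show ?thesis using near_step[OF w] by blast
    qed
  qed simp
  have far: "\<not> near H m a b" if "a \<in> A" "b \<in> A" "a \<noteq> b" "m \<le> 2 * \<rho>" for a b m
    using H(3) that near_mono[of H m a b "2 * \<rho>"] unfolding scattered_def by blast
  have far2: False if "near H m a v" "near H n b v" "a \<in> A" "b \<in> A" "a \<noteq> b" "m + n \<le> 2 * \<rho>" for a b m n v
    using near_trans[OF that(1) near_sym[OF Hsym that(2)]] far[OF that(3-5,6)] by blast
  have inI: "w \<in> I \<Longrightarrow> \<exists>d<\<rho>. near H d a w" if "a \<in> A" "near H \<rho> a w" for a w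
  proof -
    assume "w \<in> I"
    then obtain a' d where a': "a' \<in> A" "d < \<rho>" "near H d a' w" unfolding I_def by blast
    have "a' = a" using far2[OF a'(3) that(2) a'(1) that(1)] a'(2) by (metis add_mono less_imp_le_nat mult_2 order_refl)
    then show ?thesis using a' by blast
  qed
  \<comment> \<open>An end in an interior would bring the two centres too close in \<open>H\<close>,
    so both ends lie on spheres. Each end touches the centre of its own ball and hence, by
    uniqueness, not the other centre. So the prediction is correct and the flip has removed the
    edge.\<close>
  have noedge: False
    if ab: "a \<in> A" "b \<in> A" "a \<noteq> b" and w: "near H \<rho> a w1" "near H \<rho> b w2" and e: "E w1 w2" for a b w1 w2
  proof -
    have V: "w1 \<in> V" "w2 \<in> V" using e by (auto simp: E_def)
    have "w1 \<notin> I"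
    proof
      assume "w1 \<in> I"
      then obtain d where d: "d < \<rho>" "near H d a w1" using inI[OF ab(1) w(1)] by blast
      have n: "near H (Suc d) a w2" using near_step[OF d(2)] int[OF e \<open>w1 \<in> I\<close>] by blast
      show False by (rule far2[OF n w(2) ab]) (use d(1) in simp)
    qed
    moreover have "w2 \<notin> I"
    proof
      assume "w2 \<in> I"
      then obtain d where d: "d < \<rho>" "near H d b w2" using inI[OF ab(2) w(2)] by blast
      have n: "near H (Suc d) b w1" using near_step[OF d(2)] int[OF Esym[OF e] \<open>w2 \<in> I\<close>] by blast
      show False by (rule far2[OF w(1) n ab]) (use d(1) in simp)
    qed
    ultimately have L: "w1 \<in> L" "w2 \<in> L" using w ab unfolding L_def by blast+
    then have X: "w1 \<notin> X" "w2 \<notin> X" unfolding L_def X_def by blast+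
    have "\<not> touches V H \<rho> K w1 b" using uniq[OF V(1) ab(1,2)] w(1) ab(3) unfolding touches_def by blast
    then have 1: "H w1 w2 = K w1 w2" using V(2) w(2) unfolding touches_def by blast
    have "\<not> touches V H \<rho> K w2 a" using uniq[OF V(2) ab(1,2)] w(2) ab(3) unfolding touches_def by blast
    then have "H w2 w1 = K w2 w1" using V(1) w(1) unfolding touches_def by blast
    then have 2: "H w1 w2 = K w2 w1" using Hsym by blast
    have "D w1 w2 = (K w1 w2 \<and> K w2 w1)" unfolding D_def using L X by blast
    then show False using e 1 2 unfolding E_def by blast
  qed
  \<comment> \<open>An edge between a ball and the outside that is present after the flip is a wrong
    prediction. An outside vertex with such edges to two balls would touch two centres.\<close>
  have touch: "touches V H \<rho> K x a" if "a \<in> A" "near H \<rho> a w" "E w x" "x \<in> X" for a w x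
  proof -
    have V: "w \<in> V" "x \<in> V" using that(3) by (auto simp: E_def)
    note inI' = inI[OF that(1,2)]
    have "w \<notin> I"
    proof
      assume "w \<in> I"
      then obtain d where d: "d < \<rho>" "near H d a w" using inI' by blast
      have "near H (Suc d) a x" using near_step[OF d(2)] int[OF that(3) \<open>w \<in> I\<close>] by blast
      then have "near H \<rho> a x" by (rule near_mono) (use d(1) in simp)
      then show False using that(1,4) unfolding X_def by blast
    qed
    then have "w \<in> L" "w \<notin> X" "x \<notin> L" using that unfolding L_def X_def by blast+
    then have "D w x = K x w" unfolding D_def using that(4) by blast
    then have "H w x \<noteq> K x w" using that(3) unfolding E_def by blast
    then have "H x w \<noteq> K x w" using Hsym by blast
    then show ?thesis using V(1) that(2) unfolding touches_def by blast
  qed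
  have "\<not> near E (2 * \<rho> + 2) a b" if ab: "a \<in> A" "b \<in> A" "a \<noteq> b" for a b
  proof
    assume "near E (2 * \<rho> + 2) a b"
    moreover have "2 * \<rho> + 2 = \<rho> + (2 + \<rho>)" by simp
    ultimately have "near E (\<rho> + (2 + \<rho>)) a b" by (simp only:)
    then obtain w1 w2 where w: "near E \<rho> a w1" "near E 2 w1 w2" "near E \<rho> w2 b"
      using near_split[of E \<rho> "2 + \<rho>" a b] near_split[of E 2 \<rho> _ b] by blast
    have w1: "near H \<rho> a w1" using ball[OF w(1) ab(1)] by simp
    have w2: "near H \<rho> b w2" using ball[OF near_sym[OF Esym w(3)] ab(2)] by simp
    \<comment> \<open>The middle of the path has at most one inner vertex. If it lies in some ball,
      that ball differs from one of the two end balls, and \<open>noedge\<close> applies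
      there.\<close>
    have "w1 = w2 \<or> E w1 w2 \<or> (\<exists>x. E w1 x \<and> E x w2)"
      using w(2) by (auto simp: numeral_2_eq_2)
    then show False
    proof (elim disjE exE conjE)
      assume "w1 = w2"
      then have "near H \<rho> b w1" using w2 by simp
      from far2[OF w1 this ab] show False by simp
    next
      assume "E w1 w2"
      then show False by (rule noedge[OF ab w1 w2])
    next
      fix x assume e: "E w1 x" "E x w2"
      have xV: "x \<in> V" using e by (auto simp: E_def)
      show False
      proof (cases "x \<in> X")
        case True
        show False using uniq[OF xV ab(1,2) touch[OF ab(1) w1 e(1) True] touch[OF ab(2) w2 Esym[OF e(2)] True]] ab(3) by blast
      next
        case False
        then obtain a' where a': "a' \<in> A" "near H \<rho> a' x" using xV unfolding X_def by blast
        show False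
        proof (cases "a' = a")
          case True
          then show False using noedge[OF ab _ w2 e(2)] a' by blast
        next
          case False
          then show False using noedge[OF ab(1) a'(1) _ w1 a'(2) e(1)] by blast
        qed
      qed
    qed
  qed
  moreover have "near E n u v" if "near H' n u v" for n u v
    using that by (induction n arbitrary: u) (auto simp: E_def dest: H')
  ultimately show ?thesis unfolding scattered_def by blast
qed

section \<open>The induction step from radius \<open>2 * \<rho>\<close> to
  \<open>2 * \<rho> + 2\<close>\<close>

lemma xadj_facts:
  assumes "pair_graph G" "\<And>u v. u \<in> pverts G \<Longrightarrow> v \<in> pverts G \<Longrightarrow> D u v = D v u" "xadj G D u v"
  shows "u \<in> pverts G" "v \<in> pverts G" "u \<noteq> v" "xadj G D v u"
proof -
  show "u \<in> pverts G" "v \<in> pverts G" "u \<noteq> v" using assms(3) by (auto simp: xadj_def)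
  have "adj G u v = adj G v u" using adj_facts(5)[OF assms(1)] by blast
  then show "xadj G D v u" using assms(2)[of u v] assms(3) unfolding xadj_def by auto
qed

definition scatters :: "nat \<Rightarrow> nat \<Rightarrow> nat \<Rightarrow> 'v pair_pre_digraph \<Rightarrow> 'v set \<Rightarrow> bool" where
  "scatters n r m G A \<longleftrightarrow> (\<exists>D A'. coded n (pverts G) D \<and> (\<forall>u\<in>pverts G. \<forall>v\<in>pverts G. D u v = D v u) \<and>
     A' \<subseteq> A \<and> m \<le> card A' \<and> scattered (xadj G D) r A')"

lemma scatter_step:
  fixes C :: "'v pair_pre_digraph set"
  assumes st: "monadically_stable C" and pgC: "\<forall>G\<in>C. pair_graph G"
  shows "\<exists>n'. \<forall>m. \<exists>N. \<forall>G\<in>C. \<forall>D A. coded n (pverts G) D \<longrightarrow>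
     (\<forall>u\<in>pverts G. \<forall>v\<in>pverts G. D u v = D v u) \<longrightarrow> A \<subseteq> pverts G \<longrightarrow> N \<le> card A \<longrightarrow>
     scattered (xadj G D) (2 * \<rho>) A \<longrightarrow>
     scatters n' (2 * \<rho> + 2) m G A"
proof -
  from no_trace_ladder[OF st pgC, of n \<rho>] obtain h1 where
    h1: "\<forall>G\<in>C. \<forall>D. coded n (pverts G) D \<longrightarrow>
     \<not> ladder h1 (trace_split (pverts G) (xadj G D) \<rho>)" ..
  from no_marked_ladder[OF st pgC, of n \<rho>] obtain h2 where
    h2: "\<forall>G\<in>C. \<forall>D. coded n (pverts G) D \<longrightarrow> (\<forall>W Z.
     \<not> ladder h2 (marked_split (pverts G) (xadj G D) \<rho> W Z))" ..
  \<comment> \<open>With this many vertices of pairwise mostly different traces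
    \<open>separated_ladder\<close> produces a marked ladder of length \<open>h2\<close>. Only then
    is \<open>h3\<close> determined, since its formula uses \<open>T\<close>.\<close>
  define T :: nat where "T = 2 ^ h2"
  from no_link_ladder[OF st pgC, of n \<rho> T] obtain h3 where
    h3: "\<forall>G\<in>C. \<forall>D. coded n (pverts G) D \<longrightarrow> (\<forall>W P Q.
     \<not> ladder h3 (links (pverts G) (xadj G D) \<rho> (\<lambda>v u. \<exists>l<T. v \<in> P l \<and> u \<in> Q l) W))" ..
  \<comment> \<open>\<open>stable_indivisible\<close> bounds one side of each comparison by
    \<open>2 * h1\<close>; the successor makes \<open>c\<close> positive.\<close>
  define c where "c = Suc (2 * h1)"
  show ?thesis
  \<comment> \<open>The new relation is coded by the spheres, the outside and \<open>T\<close> pairs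
    consisting of a represented class and a neighbourhood. None of this depends on
    \<open>m\<close>.\<close>
  proof (rule exI[of _ "n + (2 + 2 * T)"], rule allI)
    fix m
    from sparse_or_grid[of c m h3, where 'v = 'v] obtain N3 where
      N3: "\<forall>(\<zeta> :: 'v \<Rightarrow> nat \<Rightarrow> bool) V. (\<forall>v\<in>V. card {i. i < N3 \<and> \<zeta> v i} \<le> c) \<longrightarrow>
       (\<exists>I\<subseteq>{..<N3}. card I = m \<and> (\<forall>v\<in>V. \<forall>i\<in>I. \<forall>j\<in>I. \<zeta> v i \<longrightarrow> \<zeta> v j \<longrightarrow> i = j)) \<or>
       (\<exists>a b w. link_grid N3 V \<zeta> h3 a b w)" ..
    \<comment> \<open>The summands pay for the indices needed by \<open>sparse_or_grid\<close>, for
      the balls on which some pair among \<open>T\<close> vertices agrees, and for the pigeonhole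
      argument of \<open>separated_ladder\<close>.\<close>
    define N2 where "N2 = Suc (N3 + T * T * c + T ^ h2 * T * h2)"
    from stable_indivisible[of h1 N2, where 'b = "'v \<times> 'v"] obtain N1 where
      N1: "\<forall>\<delta> :: nat \<Rightarrow> 'v \<times> 'v \<Rightarrow> bool. \<not> ladder h1 (\<lambda>i b. i < N1 \<and> \<delta> i b) \<longrightarrow>
       (\<exists>I\<subseteq>{..<N1}. card I = N2 \<and> (\<forall>b. card {i\<in>I. \<delta> i b} < 2*h1 \<or> card {i\<in>I. \<not> \<delta> i b} < 2*h1))" ..
    show "\<exists>N. \<forall>G\<in>C. \<forall>D A. coded n (pverts G) D \<longrightarrow>
     (\<forall>u\<in>pverts G. \<forall>v\<in>pverts G. D u v = D v u) \<longrightarrow> A \<subseteq> pverts G \<longrightarrow> N \<le> card A \<longrightarrow>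
     scattered (xadj G D) (2 * \<rho>) A \<longrightarrow>
     scatters (n + (2 + 2 * T)) (2 * \<rho> + 2) m G A"
    proof (rule exI[of _ N1], intro ballI allI impI)
      fix G D A
      assume G: "G \<in> C" and D: "coded n (pverts G) D"
        and Dsym: "\<forall>u\<in>pverts G. \<forall>v\<in>pverts G. D u v = D v u"
        and A: "A \<subseteq> pverts G" "N1 \<le> card A" and scat: "scattered (xadj G D) (2 * \<rho>) A"
      let ?V = "pverts G" and ?H = "xadj G D"
      have pg: "pair_graph G" using pgC G by blast
      have H: "u \<in> ?V \<and> v \<in> ?V \<and> ?H v u" if "?H u v" for u v
        using xadj_facts[OF pg _ that] Dsym by blast
      have Hsym: "?H v u" if "?H u v" for u v using H[OF that] by blast
      have finV: "finite ?V" using adj_facts[OF pg] by blast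
      obtain A0 where A0: "A0 \<subseteq> A" "card A0 = N1" using A(2) by (meson obtain_subset_with_card_n)
      have "finite A0" using A0 A finV finite_subset by metis
      then obtain a where a: "bij_betw a {0..<N1} A0" using ex_bij_betw_nat_finite A0(2) by blast
      have aA: "a i \<in> A" "a i \<in> ?V" if "i < N1" for i
      proof -
        have "a i \<in> A0" using bij_betwE[OF a] that by simp
        then show "a i \<in> A" using A0(1) by blast
        then show "a i \<in> ?V" using A(1) by blast
      qed
      have ainj: "i = j" if "a i = a j" "i < N1" "j < N1" for i j
        using bij_betw_imp_inj_on[OF a] that by (auto dest: inj_onD)
      define Bk where "Bk i = {u\<in>?V. near ?H \<rho> (a i) u}" for i
      have disj: "i = j" if "i < N1" "j < N1" "near ?H \<rho> (a i) u" "near ?H \<rho> (a j) u" for i j u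
      proof (rule ccontr)
        assume "i \<noteq> j"
        then have "a i \<noteq> a j" using ainj that by blast
        moreover have "near ?H (\<rho> + \<rho>) (a i) (a j)"
          using near_trans[OF that(3) near_sym[OF Hsym that(4)]] by blast
        ultimately show False using scat aA that unfolding scattered_def mult_2 by blast
      qed
      define tr where "tr v i = {u\<in>Bk i. ?H v u}" for v i
      have trne: "tr v i \<noteq> tr w i \<longleftrightarrow> (\<exists>u\<in>?V. near ?H \<rho> (a i) u \<and> ?H v u \<noteq> ?H w u)" for v w i
        unfolding tr_def Bk_def by blast
      define \<delta> where "\<delta> i vw \<longleftrightarrow> fst vw \<in> ?V \<and> snd vw \<in> ?V \<and> tr (fst vw) i \<noteq> tr (snd vw) i" for i vw
      have "\<not> ladder h1 (\<lambda>i b. i < N1 \<and> \<delta> i b)"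
      proof
        assume "ladder h1 (\<lambda>i b. i < N1 \<and> \<delta> i b)"
        then obtain x y where xy: "\<forall>i\<in>{1..h1}. \<forall>j\<in>{1..h1}. (x i < N1 \<and> \<delta> (x i) (y j)) \<longleftrightarrow> i \<le> j"
          unfolding ladder_def by (elim exE)
        have x: "x i < N1" if "i \<in> {1..h1}" for i using xy that by blast
        have "\<forall>i\<in>{1..h1}. \<forall>j\<in>{1..h1}. (a (x i) \<in> ?V \<and> fst (y j) \<in> ?V \<and> snd (y j) \<in> ?V \<and>
          (\<exists>u\<in>?V. near ?H \<rho> (a (x i)) u \<and> ?H (fst (y j)) u \<noteq> ?H (snd (y j)) u)) \<longleftrightarrow> i \<le> j"
          using xy aA(2) x unfolding \<delta>_def trne by simp
        then have "ladder h1 (trace_split ?V ?H \<rho>)"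
          unfolding ladder_def trace_split_def by (intro exI[of _ "\<lambda>i. a (x i)"] exI[of _ y])
        then show False using h1 G D by blast
      qed
      from mp[OF spec[OF N1] this] obtain I where I: "I \<subseteq> {..<N1}" "card I = N2"
        and Id: "\<forall>b. card {i\<in>I. \<delta> i b} < 2*h1 \<or> card {i\<in>I. \<not> \<delta> i b} < 2*h1" by (elim exE conjE)
      have finI: "finite I" using I finite_subset by blast
      have dich: "card {i\<in>I. tr v i \<noteq> tr w i} < c \<or> card {i\<in>I. tr v i = tr w i} < c" if "v \<in> ?V" "w \<in> ?V" for v w
        using Id[THEN spec, of "(v, w)"] that unfolding \<delta>_def c_def by auto
      have "c > 0" by (simp add: c_def)
      have "\<not> (\<exists>S\<subseteq>?V. finite S \<and> card S = T \<and> (\<forall>v\<in>S. \<forall>w\<in>S. v \<noteq> w \<longrightarrow> card {i\<in>I. tr v i = tr w i} < c))"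
      proof
        assume "\<exists>S\<subseteq>?V. finite S \<and> card S = T \<and> (\<forall>v\<in>S. \<forall>w\<in>S. v \<noteq> w \<longrightarrow> card {i\<in>I. tr v i = tr w i} < c)"
        then obtain S where S: "S \<subseteq> ?V" "finite S" "card S = T"
          and sep: "\<forall>v\<in>S. \<forall>w\<in>S. v \<noteq> w \<longrightarrow> card {i\<in>I. tr v i = tr w i} < c" by (elim exE conjE)
        \<comment> \<open>\<open>separated_ladder\<close> needs traces that differ on every ball,
          not just on most of them. At most \<open>T * T * c\<close> balls are lost here.\<close>
        define J where "J = {i\<in>I. \<forall>v\<in>S. \<forall>w\<in>S. v \<noteq> w \<longrightarrow> tr v i \<noteq> tr w i}"
        define Q where "Q = {(v, w) \<in> S \<times> S. v \<noteq> w}"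
        have Q: "finite Q" "card Q \<le> T * T"
        proof -
          show "finite Q" using S(2) by (intro finite_subset[of Q "S \<times> S"]) (auto simp: Q_def)
          have "card Q \<le> card (S \<times> S)" using S(2) by (intro card_mono) (auto simp: Q_def)
          then show "card Q \<le> T * T" using S(3) by (simp add: card_cartesian_product)
        qed
        have "I \<subseteq> J \<union> (\<Union>(v, w)\<in>Q. {i\<in>I. tr v i = tr w i})" unfolding J_def Q_def by auto
        then have "card I \<le> card (J \<union> (\<Union>(v, w)\<in>Q. {i\<in>I. tr v i = tr w i}))"
          using finI Q(1) by (intro card_mono) (auto simp: J_def)
        also have "\<dots> \<le> card J + card (\<Union>(v, w)\<in>Q. {i\<in>I. tr v i = tr w i})" by (rule card_Un_le)
        also have "card (\<Union>(v, w)\<in>Q. {i\<in>I. tr v i = tr w i}) \<le> (\<Sum>(v, w)\<in>Q. card {i\<in>I. tr v i = tr w i})"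
          using card_UN_le[OF Q(1), of "\<lambda>(v, w). {i\<in>I. tr v i = tr w i}"] by (simp add: split_def)
        also have "\<dots> \<le> (\<Sum>(v, w)\<in>Q. c)"
        proof (rule sum_mono)
          fix p assume "p \<in> Q"
          then have "card {i\<in>I. tr (fst p) i = tr (snd p) i} < c" using sep unfolding Q_def by force
          then show "(case p of (v, w) \<Rightarrow> card {i\<in>I. tr v i = tr w i}) \<le> (case p of (v, w) \<Rightarrow> c)"
            by (simp add: split_def)
        qed
        also have "\<dots> \<le> T * T * c" using Q(2) by (simp add: split_def)
        finally have "N2 \<le> card J + T * T * c" using I(2) by simp
        then have Jc: "card S ^ h2 * card S * h2 < card J" unfolding S(3) N2_def by simp
        have finJ: "finite J" using finI by (simp add: J_def)
        have JN: "i < N1" if "i \<in> J" for i using that I by (auto simp: J_def)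
        have "\<exists>W Z y i. \<forall>p<h2. \<forall>q<h2. y p \<in> S \<and> i q \<in> J \<and>
           ((\<exists>u. u \<in> W \<and> u \<in> Bk (i q) \<and> ?H (y p) u \<noteq> (u \<in> Z)) \<longleftrightarrow> p \<le> q)"
        proof (rule separated_ladder[OF S(2) _ finJ Jc])
          show "2 ^ h2 \<le> card S" using S(3) by (simp add: T_def)
          show "i = j" if "i \<in> J" "j \<in> J" "u \<in> Bk i" "u \<in> Bk j" for i j u
            using disj[OF JN JN] that unfolding Bk_def by blast
          show "\<exists>u\<in>Bk i. ?H v u \<noteq> ?H w u" if "i \<in> J" "v \<in> S" "w \<in> S" "v \<noteq> w" for i v w
          proof -
            have "tr v i \<noteq> tr w i" using that unfolding J_def by blast
            then show ?thesis unfolding trne Bk_def by blast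
          qed
        qed
        then obtain W Z y i where lad: "\<forall>p<h2. \<forall>q<h2. y p \<in> S \<and> i q \<in> J \<and>
           ((\<exists>u. u \<in> W \<and> u \<in> Bk (i q) \<and> ?H (y p) u \<noteq> (u \<in> Z)) \<longleftrightarrow> p \<le> q)" by (elim exE)
        have "ladder h2 (marked_split ?V ?H \<rho> W Z)"
        proof (rule ladder_shift[of _ _ y "\<lambda>q. a (i q)"])
          fix p q assume pq: "p < h2" "q < h2"
          have *: "y p \<in> S" "i q \<in> J" "(\<exists>u. u \<in> W \<and> u \<in> Bk (i q) \<and> ?H (y p) u \<noteq> (u \<in> Z)) \<longleftrightarrow> p \<le> q"
            using lad pq by blast+
          have "y p \<in> ?V" "a (i q) \<in> ?V" using *(1,2) S(1) aA(2) JN by blast+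
          then show "marked_split ?V ?H \<rho> W Z (y p) (a (i q)) \<longleftrightarrow> p \<le> q"
            using *(3) unfolding Bk_def marked_split_def by blast
        qed
        then show False using h2 G D by blast
      qed
      then obtain S where S: "S \<subseteq> ?V" "finite S" "card S < T"
        and rep: "\<forall>v\<in>?V. \<exists>s\<in>S. card {i\<in>I. tr v i \<noteq> tr s i} < c"
        using maximal_separated[where V = ?V and T = T and tr = tr, OF finI \<open>c > 0\<close> dich] by blast
      from rep obtain \<sigma> where \<sigma>: "\<forall>v\<in>?V. \<sigma> v \<in> S \<and> card {i\<in>I. tr v i \<noteq> tr (\<sigma> v) i} < c"
        by metis
      obtain s where s: "bij_betw s {0..<card S} S" using ex_bij_betw_nat_finite[OF S(2)] by blast
      \<comment> \<open>Beyond \<open>card S\<close> the enumeration \<open>s\<close> is arbitrary,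
        so the classes there are made empty. This permits a fixed number \<open>T\<close> of pairs
        although the number of samples varies.\<close>
      define P where "P l = {v\<in>?V. l < card S \<and> \<sigma> v = s l}" for l
      define Q where "Q l = {u\<in>?V. ?H (s l) u}" for l
      let ?K = "\<lambda>v u. \<exists>l<T. v \<in> P l \<and> u \<in> Q l"
      have K: "?K v u \<longleftrightarrow> ?H (\<sigma> v) u" if "v \<in> ?V" "u \<in> ?V" for v u
      proof -
        have "\<sigma> v \<in> S" using \<sigma> that by blast
        then obtain l where l: "l < card S" "\<sigma> v = s l" using bij_betw_imp_surj_on[OF s] by force
        then have "l' = l" if "v \<in> P l'" for l'
          using that bij_betw_imp_inj_on[OF s] unfolding P_def by (auto dest: inj_onD)
        moreover have "v \<in> P l" "l < T" using l that S(3) by (auto simp: P_def)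
        ultimately show ?thesis using that l unfolding Q_def by (metis (mono_tags, lifting) mem_Collect_eq)
      qed
      obtain g where g: "strict_mono_on {..<N2} g" "g ` {..<N2} = I"
        by (rule finite_nat_enum[OF finI I(2)])
      have gI: "g i \<in> I" "g i < N1" if "i < N3" for i
      proof -
        show "g i \<in> I" using g(2) that by (auto simp: N2_def)
        then show "g i < N1" using I(1) by auto
      qed
      have ginj: "i = j" if "g i = g j" "i < N3" "j < N3" for i j
        using strict_mono_on_eqD[OF g(1), of i j] that by (auto simp: N2_def)
      let ?t = "touches ?V ?H \<rho> ?K"
      define \<zeta> where "\<zeta> v i = ?t v (a (g i))" for v i
      \<comment> \<open>One ball may contain \<open>v\<close>, and the prediction from
        \<open>\<sigma> v\<close> fails in fewer than \<open>c\<close> balls.\<close>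
      have "card {i. i < N3 \<and> \<zeta> v i} \<le> c" if v: "v \<in> ?V" for v
      proof -
        have inj: "inj_on g {i. i < N3 \<and> \<zeta> v i}" using ginj by (auto intro: inj_onI)
        define E1 where "E1 = {i\<in>I. near ?H \<rho> (a i) v}"
        define E2 where "E2 = {i\<in>I. tr v i \<noteq> tr (\<sigma> v) i}"
        have "card E1 \<le> 1"
        proof -
          have "\<forall>i\<in>E1. \<forall>j\<in>E1. i = j" unfolding E1_def using disj I(1) by blast
          moreover have "finite E1" using finI by (simp add: E1_def)
          ultimately show ?thesis by (simp add: card_le_Suc0_iff_eq)
        qed
        moreover have "card E2 < c" using \<sigma> v unfolding E2_def by blast
        moreover have "g ` {i. i < N3 \<and> \<zeta> v i} \<subseteq> E1 \<union> E2"
        proof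
          fix j assume "j \<in> g ` {i. i < N3 \<and> \<zeta> v i}"
          then have j: "j \<in> I" "?t v (a j)" using gI by (auto simp: \<zeta>_def)
          show "j \<in> E1 \<union> E2"
          proof (cases "near ?H \<rho> (a j) v")
            case True
            then show ?thesis using j by (simp add: E1_def)
          next
            case False
            then obtain u where "u \<in> ?V" "near ?H \<rho> (a j) u" "?H v u \<noteq> ?K v u"
              using j(2) unfolding touches_def by blast
            then have "tr v j \<noteq> tr (\<sigma> v) j" unfolding trne using K[OF v] by blast
            then show ?thesis using j by (simp add: E2_def)
          qed
        qed
        then have "card (g ` {i. i < N3 \<and> \<zeta> v i}) \<le> card (E1 \<union> E2)"
          using finI by (intro card_mono) (auto simp: E1_def E2_def)
        moreover have "card (E1 \<union> E2) \<le> card E1 + card E2" by (rule card_Un_le)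
        ultimately show ?thesis using card_image[OF inj] by linarith
      qed
      then have sparse: "\<forall>v\<in>?V. card {i. i < N3 \<and> \<zeta> v i} \<le> c" by blast
      from mp[OF spec[OF spec[OF N3]] this]
      have "\<exists>I'\<subseteq>{..<N3}. card I' = m \<and> (\<forall>v\<in>?V. \<forall>i\<in>I'. \<forall>j\<in>I'. \<zeta> v i \<longrightarrow> \<zeta> v j \<longrightarrow> i = j)"
      proof
        assume "\<exists>a b w. link_grid N3 ?V \<zeta> h3 a b w"
        then obtain f f' w where grid: "\<forall>x<h3. \<forall>y<h3. f x < N3 \<and> f' x < N3 \<and> w x y \<in> ?V \<and>
          (\<forall>x'<h3. \<forall>y'<h3. \<zeta> (w x' y') (f x) \<and> \<zeta> (w x' y') (f' y) \<longleftrightarrow> x = x' \<and> y = y')"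
          unfolding link_grid_def by (elim exE)
        \<comment> \<open>Only the links on or above the diagonal of the grid are marked, which
          turns the grid into a ladder.\<close>
        define W where "W = {w x y |x y. x < h3 \<and> y < h3 \<and> x \<le> y}"
        have "ladder h3 (links ?V ?H \<rho> ?K W)"
        proof (rule ladder_shift[of _ _ "\<lambda>x. a (g (f x))" "\<lambda>y. a (g (f' y))"])
          fix x y assume xy: "x < h3" "y < h3"
          have V: "a (g (f x)) \<in> ?V" "a (g (f' y)) \<in> ?V" using grid xy aA(2) gI(2) by blast+
          have "(\<exists>v\<in>?V. v \<in> W \<and> \<zeta> v (f x) \<and> \<zeta> v (f' y)) \<longleftrightarrow> x \<le> y"
          proof
            assume "\<exists>v\<in>?V. v \<in> W \<and> \<zeta> v (f x) \<and> \<zeta> v (f' y)"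
            then obtain x' y' where "x' < h3" "y' < h3" "x' \<le> y'" "\<zeta> (w x' y') (f x) \<and> \<zeta> (w x' y') (f' y)"
              unfolding W_def by blast
            then show "x \<le> y" using grid xy by blast
          next
            assume "x \<le> y"
            then have "w x y \<in> W" using xy unfolding W_def by blast
            then show "\<exists>v\<in>?V. v \<in> W \<and> \<zeta> v (f x) \<and> \<zeta> v (f' y)" using grid xy by blast
          qed
          then show "links ?V ?H \<rho> ?K W (a (g (f x))) (a (g (f' y))) \<longleftrightarrow> x \<le> y"
            using V unfolding \<zeta>_def links_def by blast
        qed
        then show ?thesis using h3 G D by blast
      qed
      then obtain I' where I': "I' \<subseteq> {..<N3}" "card I' = m"
        and uniq: "\<forall>v\<in>?V. \<forall>i\<in>I'. \<forall>j\<in>I'. \<zeta> v i \<longrightarrow> \<zeta> v j \<longrightarrow> i = j" by (elim exE conjE)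
      define A' where "A' = (\<lambda>i. a (g i)) ` I'"
      have "inj_on (\<lambda>i. a (g i)) I'"
      proof (rule inj_onI)
        fix i j assume ij: "i \<in> I'" "j \<in> I'" "a (g i) = a (g j)"
        then have lt: "i < N3" "j < N3" using I'(1) by auto
        then show "i = j" using ginj ainj[OF ij(3) gI(2) gI(2)] by blast
      qed
      then have cardA': "card A' = m" using I'(2) by (simp add: A'_def card_image)
      have A'A: "A' \<subseteq> A" using I'(1) gI(2) aA(1) by (auto simp: A'_def)
      have uniqA: "x = y" if "v \<in> ?V" "x \<in> A'" "y \<in> A'" "?t v x" "?t v y" for v x y
      proof -
        obtain i j where "i \<in> I'" "x = a (g i)" "j \<in> I'" "y = a (g j)" using \<open>x \<in> A'\<close> \<open>y \<in> A'\<close> unfolding A'_def by blast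
        then show ?thesis using uniq that unfolding \<zeta>_def by blast
      qed
      define In where "In = {v. \<exists>a\<in>A'. \<exists>d<\<rho>. near ?H d a v}"
      define L where "L = {v. \<exists>a\<in>A'. near ?H \<rho> a v} - In"
      define X where "X = ?V - {v. \<exists>a\<in>A'. near ?H \<rho> a v}"
      define F where "F u v \<longleftrightarrow> u \<in> L \<and> v \<in> L \<and> ?K u v \<and> ?K v u \<or> u \<in> X \<and> v \<in> L \<and> ?K u v \<or> u \<in> L \<and> v \<in> X \<and> ?K v u" for u v
      have "coded (2 + 2 * T) ?V F"
      proof -
        define R where "R i = (if i = 0 then L else if i = 1 then X else if even i then P ((i - 2) div 2) else Q ((i - 2) div 2))" for i
        have R: "R 0 = L" "R 1 = X" "R (2 + 2 * l) = P l" "R (3 + 2 * l) = Q l" for l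
          by (auto simp: R_def)
        show ?thesis
        proof (rule codedI[where P = R])
          fix v v' w w'
          assume v: "\<And>i. i < 2 + 2 * T \<Longrightarrow> v \<in> R i \<longleftrightarrow> v' \<in> R i"
            and w: "\<And>i. i < 2 + 2 * T \<Longrightarrow> w \<in> R i \<longleftrightarrow> w' \<in> R i"
          have "v \<in> L \<longleftrightarrow> v' \<in> L" "v \<in> X \<longleftrightarrow> v' \<in> X" "w \<in> L \<longleftrightarrow> w' \<in> L" "w \<in> X \<longleftrightarrow> w' \<in> X"
            using v[of 0] v[of 1] w[of 0] w[of 1] unfolding R by simp_all
          moreover have "v \<in> P l \<longleftrightarrow> v' \<in> P l" "v \<in> Q l \<longleftrightarrow> v' \<in> Q l" "w \<in> P l \<longleftrightarrow> w' \<in> P l" "w \<in> Q l \<longleftrightarrow> w' \<in> Q l"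
            if "l < T" for l
            using v[of "2 + 2 * l"] v[of "3 + 2 * l"] w[of "2 + 2 * l"] w[of "3 + 2 * l"] that
            unfolding R by simp_all
          then have "?K v w = ?K v' w'" "?K w v = ?K w' v'" by blast+
          ultimately show "F v w = F v' w'" unfolding F_def by simp
        qed
      qed
      from coded_xor[OF D this]
      have cod: "coded (n + (2 + 2 * T)) ?V (\<lambda>u v. D u v \<noteq> F u v)" .
      have Fsym: "F u v = F v u" for u v unfolding F_def by blast
      define H' where "H' = xadj G (\<lambda>u v. D u v \<noteq> F u v)"
      have H': "u \<in> ?V \<and> v \<in> ?V \<and> u \<noteq> v \<and> (?H u v \<noteq> F u v)" if "H' u v" for u v
        using that unfolding H'_def xadj_def by blast
      have "scattered H' (2 * \<rho> + 2) A'"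
      proof (rule flip_apart[where H = ?H and V = ?V and K = ?K])
        show "u \<in> ?V \<and> v \<in> ?V \<and> ?H v u" if "?H u v" for u v using H[OF that] .
        show "A' \<subseteq> ?V" using A'A A(1) by blast
        show "scattered ?H (2 * \<rho>) A'" by (rule scattered_mono[OF scat A'A order_refl])
        show "x = y" if "v \<in> ?V" "x \<in> A'" "y \<in> A'" "?t v x" "?t v y" for v x y
          using uniqA[OF that] .
      qed (rule H'[unfolded F_def L_def X_def In_def])
      then show "scatters (n + (2 + 2 * T)) (2 * \<rho> + 2) m G A"
        unfolding scatters_def H'_def using cod Dsym Fsym A'A cardA' by (intro exI[of _ "\<lambda>u v. D u v \<noteq> F u v"] exI[of _ A']) auto
    qed
  qed
qed

lemma stable_scatters:
  fixes C :: "'v pair_pre_digraph set"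
  assumes st: "monadically_stable C" and pgC: "\<forall>G\<in>C. pair_graph G"
  shows "\<exists>n. \<forall>m. \<exists>N. \<forall>G\<in>C. \<forall>A. A \<subseteq> pverts G \<longrightarrow> N \<le> card A \<longrightarrow>
     scatters n (2 * \<rho>) m G A"
proof (induction \<rho>)
  case 0
  show ?case
  proof (rule exI[of _ 0], rule allI, rule_tac x = m in exI, intro ballI allI impI)
    fix m and G :: "'v pair_pre_digraph" and A assume "A \<subseteq> pverts G" "m \<le> card A"
    moreover have "coded 0 (pverts G) (\<lambda>_ _. False)" by (rule codedI) simp
    ultimately show "scatters 0 (2 * 0) m G A"
      unfolding scatters_def by (intro exI[of _ "\<lambda>_ _. False"] exI[of _ A]) (simp add: scattered_def)
  qed
next
  case (Suc \<rho>)
  then obtain n where n: "\<forall>m. \<exists>N. \<forall>G\<in>C. \<forall>A. A \<subseteq> pverts G \<longrightarrow> N \<le> card A \<longrightarrow>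
     scatters n (2 * \<rho>) m G A" ..
  from scatter_step[OF st pgC, of n \<rho>] obtain n' where
    n': "\<forall>m. \<exists>N. \<forall>G\<in>C. \<forall>D A. coded n (pverts G) D \<longrightarrow>
     (\<forall>u\<in>pverts G. \<forall>v\<in>pverts G. D u v = D v u) \<longrightarrow> A \<subseteq> pverts G \<longrightarrow> N \<le> card A \<longrightarrow>
     scattered (xadj G D) (2 * \<rho>) A \<longrightarrow>
     scatters n' (2 * \<rho> + 2) m G A" ..
  show ?case
  proof (rule exI[of _ n'], rule allI)
    fix m
    from n'[THEN spec, of m] obtain M where M: "\<forall>G\<in>C. \<forall>D A. coded n (pverts G) D \<longrightarrow>
     (\<forall>u\<in>pverts G. \<forall>v\<in>pverts G. D u v = D v u) \<longrightarrow> A \<subseteq> pverts G \<longrightarrow> M \<le> card A \<longrightarrow>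
     scattered (xadj G D) (2 * \<rho>) A \<longrightarrow>
     scatters n' (2 * \<rho> + 2) m G A" ..
    from n[THEN spec, of M] obtain N where N: "\<forall>G\<in>C. \<forall>A. A \<subseteq> pverts G \<longrightarrow> N \<le> card A \<longrightarrow>
     scatters n (2 * \<rho>) M G A" ..
    show "\<exists>N. \<forall>G\<in>C. \<forall>A. A \<subseteq> pverts G \<longrightarrow> N \<le> card A \<longrightarrow>
     scatters n' (2 * Suc \<rho>) m G A"
    proof (rule exI[of _ N], intro ballI allI impI)
      fix G A assume G: "G \<in> C" and A: "A \<subseteq> pverts G" "N \<le> card A"
      from N[THEN bspec, OF G, THEN spec, THEN mp, OF A(1), THEN mp, OF A(2)]
      obtain D A1 where 1: "coded n (pverts G) D" "\<forall>u\<in>pverts G. \<forall>v\<in>pverts G. D u v = D v u"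
        "A1 \<subseteq> A" "M \<le> card A1" "scattered (xadj G D) (2 * \<rho>) A1"
        unfolding scatters_def by (elim exE conjE)
      from M[THEN bspec, OF G, THEN spec, THEN spec, THEN mp, OF 1(1), THEN mp, OF 1(2), THEN mp,
        OF subset_trans[OF 1(3) A(1)], THEN mp, OF 1(4), THEN mp, OF 1(5)]
      obtain D' A' where 2: "coded n' (pverts G) D'" "\<forall>u\<in>pverts G. \<forall>v\<in>pverts G. D' u v = D' v u"
        "A' \<subseteq> A1" "m \<le> card A'" "scattered (xadj G D') (2 * \<rho> + 2) A'"
        unfolding scatters_def by (elim exE conjE)
      then show "scatters n' (2 * Suc \<rho>) m G A"
        unfolding scatters_def using 1(3) by (intro exI[of _ D'] exI[of _ A']) auto
    qed
  qed
qed

lemma stable_imp_flip_wide: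
  fixes C :: "'v pair_pre_digraph set"
  assumes st: "monadically_stable C" and pgC: "\<forall>G\<in>C. pair_graph G"
  shows "flip_wide C"
  unfolding flip_wide_def
proof (rule allI)
  fix r :: nat
  from stable_scatters[OF assms, of r] obtain n where n: "\<forall>m. \<exists>N. \<forall>G\<in>C. \<forall>A. A \<subseteq> pverts G \<longrightarrow> N \<le> card A \<longrightarrow>
     scatters n (2 * r) m G A" ..
  from choice[OF n] obtain N where N: "\<forall>m. \<forall>G\<in>C. \<forall>A. A \<subseteq> pverts G \<longrightarrow> N m \<le> card A \<longrightarrow>
     scatters n (2 * r) m G A" ..
  show "\<exists>N s. \<forall>m. \<forall>G\<in>C. \<forall>A. A \<subseteq> pverts G \<and> N m \<le> card A \<longrightarrow>
          (\<exists>F B. F \<subseteq> flips G \<and> finite F \<and> card F \<le> s \<and> B \<subseteq> A \<and> m \<le> card B \<and> dist_independent (G \<oplus>\<^sub>F F) r B)"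
  proof (rule exI[of _ N], rule exI[of _ "2 ^ n * 2 ^ n"], intro allI ballI impI)
    fix m G A assume G: "G \<in> C" and A: "A \<subseteq> pverts G \<and> N m \<le> card A"
    have pg: "pair_graph G" using pgC G by blast
    from N[THEN spec, THEN bspec, OF G, THEN spec, THEN mp, OF conjunct1[OF A], THEN mp, OF conjunct2[OF A]]
    obtain D B where B: "coded n (pverts G) D" "\<forall>u\<in>pverts G. \<forall>v\<in>pverts G. D u v = D v u"
        "B \<subseteq> A" "m \<le> card B" "scattered (xadj G D) (2 * r) B"
      unfolding scatters_def by (elim exE conjE)
    have "\<exists>F. F \<subseteq> flips G \<and> finite F \<and> card F \<le> 2 ^ n * 2 ^ n \<and> adj (G \<oplus>\<^sub>F F) = xadj G D"
      by (rule coded_flips[OF pg B(1)]) (use B(2) in blast)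
    then obtain F where F: "F \<subseteq> flips G" "finite F" "card F \<le> 2 ^ n * 2 ^ n" "adj (G \<oplus>\<^sub>F F) = xadj G D"
      by (elim exE conjE)
    have "scattered (xadj G D) r B" by (rule scattered_mono[OF B(5)]) auto
    then have "dist_independent (G \<oplus>\<^sub>F F) r B"
      unfolding dist_independent_iff[OF pair_graph_apply_flips(1)[OF pg F(2)]]
      using pair_graph_apply_flips(2)[OF pg F(2)] F(4) A B(3) by auto
    then show "\<exists>F B. F \<subseteq> flips G \<and> finite F \<and> card F \<le> 2 ^ n * 2 ^ n \<and> B \<subseteq> A \<and> m \<le> card B \<and>
        dist_independent (G \<oplus>\<^sub>F F) r B"
      using F B by blast
  qed
qed

section \<open>Reduction to a single variable\<close>

lemma sat_cong:
  "(\<And>x. x \<in> fv \<phi> \<Longrightarrow> e x = e' x) \<Longrightarrow> sat M e \<phi> = sat M e' \<phi>"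
proof (induction \<phi> arbitrary: e e')
  case (Exists x \<phi>)
  have "sat M (e(x := v)) \<phi> = sat M (e'(x := v)) \<phi>" for v
    using Exists.prems by (intro Exists.IH) auto
  then show ?case by simp
next
  case (Conj \<phi> \<psi>)
  have "sat M e \<phi> = sat M e' \<phi>" "sat M e \<psi> = sat M e' \<psi>"
    using Conj.prems by (auto intro!: Conj.IH)
  then show ?case by simp
next
  case (Neg \<phi>)
  have "sat M e \<phi> = sat M e' \<phi>" by (rule Neg.IH) (simp add: Neg.prems)
  then show ?case by simp
qed simp_all

primrec preds :: "formula \<Rightarrow> nat set" where
  "preds (Equal x y) = {}"
| "preds (Adj x y) = {}"
| "preds (Pred i x) = {i}"
| "preds (Neg \<phi>) = preds \<phi>"
| "preds (Conj \<phi> \<psi>) = preds \<phi> \<union> preds \<psi>"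
| "preds (Exists x \<phi>) = preds \<phi>"

lemma finite_preds: "finite (preds \<phi>)"
  by (induction \<phi>) auto

lemma finite_fv: "finite (fv \<phi>)"
  by (induction \<phi>) auto

lemma sat_preds_cong:
  "(\<And>i. i \<in> preds \<phi> \<Longrightarrow> P i = P' i) \<Longrightarrow> sat (G, P) e \<phi> = sat (G, P') e \<phi>"
proof (induction \<phi> arbitrary: e)
  case (Conj \<phi> \<psi>)
  have "sat (G, P) e \<phi> = sat (G, P') e \<phi>" by (rule Conj.IH(1)) (simp add: Conj.prems)
  moreover have "sat (G, P) e \<psi> = sat (G, P') e \<psi>" by (rule Conj.IH(2)) (simp add: Conj.prems)
  ultimately show ?case by simp
next
  case (Neg \<phi>)
  have "sat (G, P) e \<phi> = sat (G, P') e \<phi>" by (rule Neg.IH) (simp add: Neg.prems)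
  then show ?case by simp
next
  case (Exists x \<phi>)
  have "sat (G, P) e \<phi> = sat (G, P') e \<phi>" for e by (rule Exists.IH) (simp add: Exists.prems)
  then show ?case by simp
qed simp_all

primrec depth :: "formula \<Rightarrow> nat" where
  "depth (Equal x y) = 0"
| "depth (Adj x y) = 0"
| "depth (Pred i x) = 0"
| "depth (Neg \<phi>) = depth \<phi>"
| "depth (Conj \<phi> \<psi>) = max (depth \<phi>) (depth \<psi>)"
| "depth (Exists x \<phi>) = Suc (depth \<phi>)"

text \<open>In a ladder for \<open>X\<close> the first tuple assigns the variables in \<open>X\<close>, the second one all others.\<close>

definition split_sat :: "'v coloured_graph \<Rightarrow> nat set \<Rightarrow> formula \<Rightarrow> (nat \<Rightarrow> 'v) \<Rightarrow> (nat \<Rightarrow> 'v) \<Rightarrow> bool" where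
  "split_sat M X \<phi> e f \<longleftrightarrow> range e \<subseteq> pverts (fst M) \<and> range f \<subseteq> pverts (fst M) \<and>
     sat M (\<lambda>x. if x \<in> X then e x else f x) \<phi>"

definition var_stable :: "'v pair_pre_digraph set \<Rightarrow> nat set \<Rightarrow> bool" where
  "var_stable C X \<longleftrightarrow> (\<forall>\<phi>. \<exists>h. \<forall>G\<in>C. \<forall>P. (\<forall>i. P i \<subseteq> pverts G) \<longrightarrow>
     \<not> ladder h (split_sat (G, P) X \<phi>))"

lemma ladder_mono:
  assumes "ladder h R" "h' \<le> h"
  shows "ladder h' R"
proof -
  from assms(1) obtain a b where "\<forall>i\<in>{1..h}. \<forall>j\<in>{1..h}. R (a i) (b j) \<longleftrightarrow> i \<le> j"
    unfolding ladder_def by (elim exE)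
  then show ?thesis using assms(2) unfolding ladder_def by (intro exI[of _ a] exI[of _ b]) simp
qed

lemma var_stable_empty: "var_stable C {}"
  unfolding var_stable_def
proof (intro allI exI[of _ 2] ballI impI notI)
  fix \<phi> and G :: "'a pair_pre_digraph" and P
  assume "ladder 2 (split_sat (G, P) {} \<phi>)"
  then obtain e f where *: "\<forall>i\<in>{1..2::nat}. \<forall>j\<in>{1..2::nat}. split_sat (G, P) {} \<phi> (e i) (f j) \<longleftrightarrow> i \<le> j"
    unfolding ladder_def by (elim exE)
  have "split_sat (G, P) {} \<phi> (e 1) (f 1)" "split_sat (G, P) {} \<phi> (e 2) (f 2)" "\<not> split_sat (G, P) {} \<phi> (e 2) (f 1)"
    using *[rule_format, of 1 1] *[rule_format, of 2 2] *[rule_format, of 2 1] by simp_all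
  then show False by (simp add: split_sat_def)
qed

text \<open>The variables in \<open>X\<close> and the variable \<open>x\<close> are given separate
  indices. By \<open>ladder_or_diagonal\<close>, either a ladder arises with one of the three
  indices fixed, against \<open>X\<close> or \<open>{x}\<close>, or \<open>\<phi>\<close> deviates
  from a constant only where the two row indices coincide. Then \<open>x\<close> can be quantified
  over the marked values: the one belonging to the \<open>X\<close>-part is the only one that can
  make a difference.\<close>

lemma var_stable_insert:
  fixes C :: "'v pair_pre_digraph set"
  assumes X: "var_stable C X" and x: "var_stable C {x}" "x \<notin> X"
  shows "var_stable C (insert x X)"
  unfolding var_stable_def
proof
  fix \<phi>
  obtain c where c: "c \<notin> preds \<phi>" using ex_new_if_finite[OF infinite_UNIV_nat finite_preds] by blast
  define \<Phi> where "\<Phi> \<epsilon> = Exists x (Conj (Pred c x) (if \<epsilon> then Neg \<phi> else \<phi>))" for \<epsilon>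
  from X[unfolded var_stable_def, THEN spec, of \<phi>] obtain h1 where
    h1: "\<forall>G\<in>C. \<forall>P. (\<forall>i. P i \<subseteq> pverts G) \<longrightarrow>
     \<not> ladder h1 (split_sat (G, P) X \<phi>)" ..
  from x(1)[unfolded var_stable_def, THEN spec, of \<phi>] obtain h2 where
    h2: "\<forall>G\<in>C. \<forall>P. (\<forall>i. P i \<subseteq> pverts G) \<longrightarrow>
     \<not> ladder h2 (split_sat (G, P) {x} \<phi>)" ..
  from choice[OF X[unfolded var_stable_def]] obtain k where
    k: "\<forall>\<psi>. \<forall>G\<in>C. \<forall>P. (\<forall>i. P i \<subseteq> pverts G) \<longrightarrow>
     \<not> ladder (k \<psi>) (split_sat (G, P) X \<psi>)" ..
  define h where "h = h1 + h2 + k (\<Phi> True) + k (\<Phi> False)"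
  have hk: "k (\<Phi> \<epsilon>) \<le> h" for \<epsilon> by (cases \<epsilon>) (simp_all add: h_def)
  from ladder_or_diagonal[of h] obtain N where
    N: "\<forall>val :: nat \<Rightarrow> nat \<Rightarrow> nat \<Rightarrow> bool. (\<forall>i<N. \<forall>j<N. val i i j \<longleftrightarrow> i \<le> j) \<longrightarrow>
     (\<exists>c. ladder h (\<lambda>x y. val x y c)) \<or> (\<exists>c. ladder h (\<lambda>x z. val x c z)) \<or>
     (\<exists>c. ladder h (\<lambda>y z. val c y z)) \<or>
     (\<exists>\<epsilon> i j. \<forall>a\<in>{1..h}. \<forall>a'\<in>{1..h}. \<forall>b\<in>{1..h}. (val (i a) (i a') (j b) \<noteq> \<epsilon>) \<longleftrightarrow> a = a' \<and> a \<le> b)" ..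
  show "\<exists>h. \<forall>G\<in>C. \<forall>P. (\<forall>i. P i \<subseteq> pverts G) \<longrightarrow>
     \<not> ladder h (split_sat (G, P) (insert x X) \<phi>)"
  \<comment> \<open>The successor guarantees that index 1, used as a default, exists.\<close>
  proof (intro exI[of _ "Suc N"] ballI allI impI notI)
    fix G and P :: "nat \<Rightarrow> 'v set" assume G: "G \<in> C" and P: "\<forall>i. P i \<subseteq> pverts G"
    let ?V = "pverts G"
    assume "ladder (Suc N) (split_sat (G, P) (insert x X) \<phi>)"
    then obtain e0 f0 where lad: "\<forall>i\<in>{1..Suc N}. \<forall>j\<in>{1..Suc N}. split_sat (G, P) (insert x X) \<phi> (e0 i) (f0 j) \<longleftrightarrow> i \<le> j"
      unfolding ladder_def by (elim exE)
    \<comment> \<open>The alternatives of \<open>ladder_or_diagonal\<close> do not bound their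
      indices, so all indices from \<open>N\<close> on are sent to an assignment inside the
      graph.\<close>
    define e where "e i = e0 (if i < N then Suc i else 1)" for i
    define f where "f i = f0 (if i < N then Suc i else 1)" for i
    have "range (e0 i) \<subseteq> ?V \<and> range (f0 i) \<subseteq> ?V" if "i \<in> {1..Suc N}" for i
    proof -
      have "split_sat (G, P) (insert x X) \<phi> (e0 i) (f0 i)" using lad that by blast
      then show ?thesis by (simp add: split_sat_def)
    qed
    then have ran: "range (e i) \<subseteq> ?V" "range (f i) \<subseteq> ?V" for i by (auto simp: e_def f_def)
    then have inV: "e i y \<in> ?V" "f i y \<in> ?V" for i y by blast+
    define val where "val i i' j \<longleftrightarrow> sat (G, P) (\<lambda>y. if y \<in> X then e i y else if y = x then e i' x else f j y) \<phi>" for i i' j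
    have "val i i j \<longleftrightarrow> i \<le> j" if "i < N" "j < N" for i j
    proof -
      have "(\<lambda>y. if y \<in> X then e i y else if y = x then e i x else f j y) =
         (\<lambda>y. if y \<in> insert x X then e0 (Suc i) y else f0 (Suc j) y)"
        using that by (auto simp: e_def f_def)
      moreover have "split_sat (G, P) (insert x X) \<phi> (e0 (Suc i)) (f0 (Suc j)) \<longleftrightarrow> Suc i \<le> Suc j"
        by (rule lad[THEN bspec, THEN bspec]) (use that in auto)
      moreover have "range (e0 (Suc i)) \<subseteq> ?V" "range (f0 (Suc j)) \<subseteq> ?V"
        using ran[of i] ran[of j] that by (simp_all add: e_def f_def)
      ultimately show ?thesis unfolding val_def split_sat_def by simp
    qed
    then have "\<forall>i<N. \<forall>j<N. val i i j \<longleftrightarrow> i \<le> j" by blast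
    from mp[OF spec[OF N, of val] this] show False
    proof (elim disjE exE)
      fix c assume "ladder h (\<lambda>x y. val x y c)"
      moreover have "val i i' c \<longleftrightarrow> split_sat (G, P) X \<phi> (e i) ((f c)(x := e i' x))" for i i'
      proof -
        have "(\<lambda>y. if y \<in> X then e i y else if y = x then e i' x else f c y) =
           (\<lambda>y. if y \<in> X then e i y else ((f c)(x := e i' x)) y)" by auto
        moreover have "range ((f c)(x := e i' x)) \<subseteq> ?V" using inV by auto
        ultimately show ?thesis using ran(1)[of i] unfolding val_def split_sat_def fst_conv by simp
      qed
      ultimately have "ladder h (\<lambda>i i'. split_sat (G, P) X \<phi> (e i) ((f c)(x := e i' x)))" by (simp only:)
      from ladder_mono[OF ladder_comp[where R = "split_sat (G, P) X \<phi>" and f = e and g = "\<lambda>i'. (f c)(x := e i' x)", OF this], of h1] have "ladder h1 (split_sat (G, P) X \<phi>)"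
        by (simp add: h_def)
      then show False using h1 G P by blast
    next
      fix c assume "ladder h (\<lambda>x z. val x c z)"
      moreover have "val i c j \<longleftrightarrow> split_sat (G, P) X \<phi> (e i) ((f j)(x := e c x))" for i j
      proof -
        have "(\<lambda>y. if y \<in> X then e i y else if y = x then e c x else f j y) =
           (\<lambda>y. if y \<in> X then e i y else ((f j)(x := e c x)) y)" by auto
        moreover have "range ((f j)(x := e c x)) \<subseteq> ?V" using inV by auto
        ultimately show ?thesis using ran(1)[of i] unfolding val_def split_sat_def fst_conv by simp
      qed
      ultimately have "ladder h (\<lambda>i j. split_sat (G, P) X \<phi> (e i) ((f j)(x := e c x)))" by (simp only:)
      from ladder_mono[OF ladder_comp[where R = "split_sat (G, P) X \<phi>" and f = e and g = "\<lambda>j. (f j)(x := e c x)", OF this], of h1] have "ladder h1 (split_sat (G, P) X \<phi>)"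
        by (simp add: h_def)
      then show False using h1 G P by blast
    next
      fix c assume "ladder h (\<lambda>y z. val c y z)"
      moreover have "val c i j \<longleftrightarrow> split_sat (G, P) {x} \<phi> (e i) (\<lambda>y. if y \<in> X then e c y else f j y)" for i j
      proof -
        have "(\<lambda>y. if y \<in> X then e c y else if y = x then e i x else f j y) =
           (\<lambda>y. if y \<in> {x} then e i y else if y \<in> X then e c y else f j y)" using x(2) by auto
        moreover have "range (\<lambda>y. if y \<in> X then e c y else f j y) \<subseteq> ?V" using inV by auto
        ultimately show ?thesis using ran(1)[of i] unfolding val_def split_sat_def fst_conv by simp
      qed
      ultimately have "ladder h (\<lambda>i j. split_sat (G, P) {x} \<phi> (e i) (\<lambda>y. if y \<in> X then e c y else f j y))" by (simp only:)
      from ladder_mono[OF ladder_comp[where R = "split_sat (G, P) {x} \<phi>" and f = e and g = "\<lambda>j y. if y \<in> X then e c y else f j y", OF this], of h2] have "ladder h2 (split_sat (G, P) {x} \<phi>)"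
        by (simp add: h_def)
      then show False using h2 G P by blast
    next
      fix \<epsilon> i j
      assume d: "\<forall>a\<in>{1..h}. \<forall>a'\<in>{1..h}. \<forall>b\<in>{1..h}. (val (i a) (i a') (j b) \<noteq> \<epsilon>) \<longleftrightarrow> a = a' \<and> a \<le> b"
      \<comment> \<open>The predicate \<open>c\<close> does not occur in \<open>\<phi>\<close>, so
        marking the values of \<open>x\<close> leaves the truth of \<open>\<phi>\<close>
        unchanged.\<close>
      define P' where "P' = P(c := {e (i a) x |a. a \<in> {1..h}})"
      have P': "\<forall>i. P' i \<subseteq> ?V" using P inV unfolding P'_def by auto
      have "sat (G, P') (\<lambda>y. if y \<in> X then e (i a) y else f (j b) y) (\<Phi> \<epsilon>) \<longleftrightarrow> a \<le> b"
        if ab: "a \<in> {1..h}" "b \<in> {1..h}" for a b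
      proof -
        let ?s = "\<lambda>y. if y \<in> X then e (i a) y else f (j b) y"
        have s: "sat (G, P') (?s(x := e (i a') x)) \<phi> = val (i a) (i a') (j b)" for a'
        proof -
          have "?s(x := e (i a') x) = (\<lambda>y. if y \<in> X then e (i a) y else if y = x then e (i a') x else f (j b) y)"
            using x(2) by auto
          moreover have "sat (G, P') s \<phi> = sat (G, P) s \<phi>" for s
            by (rule sat_preds_cong) (use c in \<open>auto simp: P'_def\<close>)
          ultimately show ?thesis unfolding val_def by simp
        qed
        have "sat (G, P') ?s (\<Phi> \<epsilon>) \<longleftrightarrow> (\<exists>v\<in>?V. v \<in> P' c \<and> (sat (G, P') (?s(x := v)) \<phi> \<noteq> \<epsilon>))"
          unfolding \<Phi>_def by (cases \<epsilon>) simp_all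
        also have "\<dots> \<longleftrightarrow> (\<exists>a'\<in>{1..h}. sat (G, P') (?s(x := e (i a') x)) \<phi> \<noteq> \<epsilon>)"
        proof -
          have Pc: "v \<in> P' c \<longleftrightarrow> (\<exists>a'\<in>{1..h}. v = e (i a') x)" for v by (auto simp: P'_def)
          have "(\<exists>v\<in>?V. (\<exists>a'\<in>{1..h}. v = e (i a') x) \<and> Q v) = (\<exists>a'\<in>{1..h}. Q (e (i a') x))" for Q
            using inV by blast
          then show ?thesis unfolding Pc .
        qed
        also have "\<dots> \<longleftrightarrow> (\<exists>a'\<in>{1..h}. a = a' \<and> a \<le> b)" unfolding s
        proof (rule bex_cong[OF refl])
          fix a' assume "a' \<in> {1..h}"
          then show "(val (i a) (i a') (j b) \<noteq> \<epsilon>) \<longleftrightarrow> a = a' \<and> a \<le> b"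
            by (rule d[THEN bspec, OF ab(1), THEN bspec, THEN bspec, OF _ ab(2)])
        qed
        also have "\<dots> \<longleftrightarrow> a \<le> b" using ab(1) by simp
        finally show ?thesis .
      qed
      then have "ladder h (split_sat (G, P') X (\<Phi> \<epsilon>))"
        unfolding ladder_def split_sat_def using ran by (intro exI[of _ "\<lambda>a. e (i a)"] exI[of _ "\<lambda>b. f (j b)"]) simp
      then show False using k G P' ladder_mono[OF _ hk] by blast
    qed
  qed
qed

lemma var_stable_finite:
  assumes "\<And>x. var_stable C {x}" "finite X"
  shows "var_stable C X"
  using assms(2)
proof (induction X)
  case empty
  show ?case by (rule var_stable_empty)
next
  case (insert x X)
  show ?case by (rule var_stable_insert[OF insert.IH assms(1) insert.hyps(2)])
qed

lemma var_stable_imp_monadically_stable: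
  fixes C :: "'v pair_pre_digraph set"
  assumes "\<And>x. var_stable C {x}"
  shows "monadically_stable C"
  unfolding monadically_stable_def stable_class_def
proof (intro allI impI notI)
  fix D :: "'v coloured_graph set" assume D: "unary_expansion D C"
  assume "\<exists>\<psi> p q. fv \<psi> \<subseteq> {..<p + q} \<and> (\<forall>k. \<exists>M\<in>D. orders M \<psi> p q k)"
  then obtain \<psi> p q where fv: "fv \<psi> \<subseteq> {..<p + q}" and ord: "\<forall>k. \<exists>M\<in>D. orders M \<psi> p q k" by (elim exE conjE)
  show False
  \<comment> \<open>Empty tuples provide no vertex that could serve as the default for irrelevant
    variables; but they are all equal and cannot be ordered anyway.\<close>
  proof (cases "p + q = 0")
    case True
    from ord[THEN spec, of 2] obtain M :: "'v coloured_graph" where "orders M \<psi> p q 2" by (elim bexE)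
    then obtain a b where ab: "\<forall>i\<in>{1..2}. a i \<in> tuples M p \<and> b i \<in> tuples M q"
      "\<forall>i\<in>{1..2}. \<forall>j\<in>{1..2}. sat M ((!) (a i @ b j)) \<psi> \<longleftrightarrow> i \<le> (j::nat)"
      unfolding orders_def by (elim exE conjE)
    have "a 1 = a 2" using ab(1) True by (simp add: tuples_def)
    moreover have "sat M ((!) (a 1 @ b 1)) \<psi>" "\<not> sat M ((!) (a 2 @ b 1)) \<psi>"
      using ab(2)[rule_format, of 1 1] ab(2)[rule_format, of 2 1] by simp_all
    ultimately show False by simp
  next
    case False
    have "var_stable C {..<p}" by (rule var_stable_finite[OF assms]) simp
    from this[unfolded var_stable_def, THEN spec, of \<psi>] obtain h where
      h: "\<forall>G\<in>C. \<forall>P. (\<forall>i. P i \<subseteq> pverts G) \<longrightarrow>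
       \<not> ladder h (split_sat (G, P) {..<p} \<psi>)" ..
    from ord[THEN spec, of h] obtain M :: "'v coloured_graph" where M: "M \<in> D" "orders M \<psi> p q h" by (elim bexE)
    obtain G P where GP: "M = (G, P)" by force
    have "fst M \<in> C" using D M(1) unfolding unary_expansion_def by blast
    moreover have "case M of (G, P) \<Rightarrow> \<forall>i. P i \<subseteq> pverts G"
      using D M(1) unfolding unary_expansion_def by (elim conjE bspec)
    ultimately have G: "G \<in> C" "\<forall>i. P i \<subseteq> pverts G" by (simp_all add: GP)
    have nl: "\<not> ladder h (split_sat (G, P) {..<p} \<psi>)" using h G by blast
    then have "1 \<in> {1..h}" by (cases "h = 0") (simp_all add: ladder_def)
    from M(2) obtain a b where ab: "\<And>i. i \<in> {1..h} \<Longrightarrow> a i \<in> tuples M p \<and> b i \<in> tuples M q"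
      and sat: "\<And>i j. i \<in> {1..h} \<Longrightarrow> j \<in> {1..h} \<Longrightarrow> sat M ((!) (a i @ b j)) \<psi> \<longleftrightarrow> i \<le> j"
      unfolding orders_def by blast
    have "pverts G \<noteq> {}"
      using ab[OF \<open>1 \<in> {1..h}\<close>] False by (auto simp: tuples_def GP)
    then obtain v0 where v0: "v0 \<in> pverts G" by blast
    define e where "e i x = (if x < p then a i ! x else v0)" for i x
    define f where "f j x = (if p \<le> x \<and> x < p + q then b j ! (x - p) else v0)" for j x
    have "range (e i) \<subseteq> pverts G" "range (f i) \<subseteq> pverts G" if "i \<in> {1..h}" for i
    proof -
      have "a i ! x \<in> pverts G" if "x < p" for x
        using ab[OF \<open>i \<in> {1..h}\<close>] that by (auto simp: tuples_def GP)
      then show "range (e i) \<subseteq> pverts G" using v0 by (auto simp: e_def)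
      have "b i ! x \<in> pverts G" if "x < q" for x
        using ab[OF \<open>i \<in> {1..h}\<close>] that by (auto simp: tuples_def GP)
      then show "range (f i) \<subseteq> pverts G" using v0 by (auto simp: f_def)
    qed
    moreover have "sat (G, P) (\<lambda>x. if x \<in> {..<p} then e i x else f j x) \<psi> \<longleftrightarrow> i \<le> j"
      if "i \<in> {1..h}" "j \<in> {1..h}" for i j
    proof -
      have "sat (G, P) (\<lambda>x. if x \<in> {..<p} then e i x else f j x) \<psi> = sat (G, P) ((!) (a i @ b j)) \<psi>"
      proof (rule sat_cong)
        fix x assume "x \<in> fv \<psi>"
        then have "x < p + q" using fv by auto
        moreover have "length (a i) = p" using ab[OF that(1)] by (simp add: tuples_def)
        ultimately show "(if x \<in> {..<p} then e i x else f j x) = (a i @ b j) ! x"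
          by (simp add: e_def f_def nth_append)
      qed
      then show ?thesis using sat[OF that] unfolding GP by simp
    qed
    ultimately have "ladder h (split_sat (G, P) {..<p} \<psi>)"
      unfolding ladder_def split_sat_def by (intro exI[of _ e] exI[of _ f]) simp
    then show False using nl by blast
  qed
qed

section \<open>Locality\<close>

text \<open>Types of rank \<open>k\<close> are coded by numbers so that there are boundedly many of them, uniformly in the
  graph; quantifiers range over \<open>L\<close>, and \<open>atm\<close> codes the atomic type.\<close>

primrec types :: "('v list \<Rightarrow> nat) \<Rightarrow> 'v set \<Rightarrow> nat \<Rightarrow> 'v list \<Rightarrow> nat" where
  "types atm L 0 S = atm S"
| "types atm L (Suc k) S = prod_encode (atm S, set_encode ((\<lambda>v. types atm L k (v # S)) ` L))"

lemma types_atomic: "types atm L k S = types atm L' k S' \<Longrightarrow> atm S = atm S'"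
  by (cases k) auto

lemma types_forth:
  assumes "types atm L (Suc k) S = types atm L' (Suc k) S'" "finite L" "finite L'" "v \<in> L"
  shows "\<exists>v'\<in>L'. types atm L k (v # S) = types atm L' k (v' # S')"
proof -
  have "(\<lambda>v. types atm L k (v # S)) ` L = (\<lambda>v. types atm L' k (v # S')) ` L'"
    using assms(1-3) by (simp add: inj_on_eq_iff[OF inj_on_set_encode])
  then show ?thesis using assms(4) by (metis (no_types, lifting) imageE imageI)
qed

lemma types_down:
  assumes "finite L" "finite L'"
  shows "types atm L (Suc k) S = types atm L' (Suc k) S' \<Longrightarrow> types atm L k S = types atm L' k S'"
proof (induction k arbitrary: S S')
  case 0
  then show ?case by simp
next
  case (Suc k)
  have atm: "atm S = atm S'" by (rule types_atomic[OF Suc.prems])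
  have "(\<lambda>v. types atm L k (v # S)) ` L \<subseteq> (\<lambda>v. types atm L' k (v # S')) ` L'"
  proof
    fix t assume "t \<in> (\<lambda>v. types atm L k (v # S)) ` L"
    then obtain v where v: "v \<in> L" "t = types atm L k (v # S)" by blast
    obtain v' where "v' \<in> L'" "types atm L (Suc k) (v # S) = types atm L' (Suc k) (v' # S')"
      using types_forth[OF Suc.prems assms v(1)] by blast
    then show "t \<in> (\<lambda>v. types atm L' k (v # S')) ` L'" using Suc.IH v by blast
  qed
  moreover have "(\<lambda>v. types atm L' k (v # S')) ` L' \<subseteq> (\<lambda>v. types atm L k (v # S)) ` L"
  proof
    fix t assume "t \<in> (\<lambda>v. types atm L' k (v # S')) ` L'"
    then obtain v where v: "v \<in> L'" "t = types atm L' k (v # S')" by blast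
    obtain v' where "v' \<in> L" "types atm L' (Suc k) (v # S') = types atm L (Suc k) (v' # S)"
      using types_forth[OF Suc.prems[symmetric] assms(2,1) v(1)] by blast
    then show "t \<in> (\<lambda>v. types atm L k (v # S)) ` L" using Suc.IH v by (metis imageI)
  qed
  ultimately have "(\<lambda>v. types atm L k (v # S)) ` L = (\<lambda>v. types atm L' k (v # S')) ` L'" by (rule equalityI)
  then show ?case using atm by (simp only: types.simps)
qed

lemma types_bounded:
  fixes a :: "nat \<Rightarrow> nat"
  shows "\<exists>M. \<forall>atm (L :: 'v set) S. (\<forall>S. atm S < a (length S)) \<longrightarrow> finite L \<longrightarrow> length S = l \<longrightarrow> types atm L k (S :: 'v list) < M"
proof (induction k arbitrary: l)
  case 0
  show ?case by (rule exI[of _ "a l"]) auto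
next
  case (Suc k)
  from Suc.IH[of "Suc l"] obtain M where
    M: "\<forall>atm (L :: 'v set) S. (\<forall>S. atm S < a (length S)) \<longrightarrow> finite L \<longrightarrow> length S = Suc l \<longrightarrow> types atm L k (S :: 'v list) < M" ..
  define Z where "Z = prod_encode ` ({..<a l} \<times> set_encode ` Pow {..<M})"
  have "finite Z" by (simp add: Z_def)
  show ?case
  proof (rule exI[of _ "Suc (Max Z)"], intro allI impI)
    fix atm :: "'v list \<Rightarrow> nat" and L :: "'v set" and S :: "'v list" assume atm: "\<forall>S. atm S < a (length S)" and L: "finite L" and S: "length S = l"
    have "types atm L k (v # S) < M" for v using M atm L S by simp
    then have "(\<lambda>v. types atm L k (v # S)) ` L \<in> Pow {..<M}" by auto
    moreover have "atm S < a l" using atm S by blast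
    ultimately have "types atm L (Suc k) S \<in> Z" unfolding Z_def types.simps by blast
    then show "types atm L (Suc k) S < Suc (Max Z)" using \<open>finite Z\<close> by (simp add: less_Suc_eq_le)
  qed
qed

section \<open>Atomic types of lists of pebbles\<close>

definition atoms :: "('v \<Rightarrow> 'v \<Rightarrow> bool) \<Rightarrow> (nat \<Rightarrow> 'v set) \<Rightarrow> nat \<Rightarrow> 'v list \<Rightarrow> nat set" where
  "atoms H Q n S = {prod_encode (t, prod_encode (i, j)) |t i j. i < length S \<and>
     (t = 0 \<and> j < length S \<and> S ! i = S ! j \<or> t = 1 \<and> j < length S \<and> H (S ! i) (S ! j) \<or> t = 2 \<and> j < n \<and> S ! i \<in> Q j)}"

definition atom_code :: "('v \<Rightarrow> 'v \<Rightarrow> bool) \<Rightarrow> (nat \<Rightarrow> 'v set) \<Rightarrow> nat \<Rightarrow> 'v list \<Rightarrow> nat" where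
  "atom_code H Q n S = set_encode (atoms H Q n S)"

lemma atoms_finite:
  "atoms H Q n S \<subseteq> (\<lambda>(t, i, j). prod_encode (t, prod_encode (i, j))) ` ({..<3} \<times> {..<length S} \<times> {..<length S + n})"
proof
  fix x
  assume "x \<in> atoms H Q n S"
  then obtain t i j where x: "x = prod_encode (t, prod_encode (i, j))" "i < length S" "t < 3" "j < length S + n"
    unfolding atoms_def by fastforce
  then show "x \<in> (\<lambda>(t, i, j). prod_encode (t, prod_encode (i, j))) ` ({..<3} \<times> {..<length S} \<times> {..<length S + n})"
    by (intro image_eqI[where x = "(t, i, j)"]) simp_all
qed

lemma atom_code_bounded: "\<exists>a. \<forall>H Q S. atom_code H Q n (S :: 'v list) < a (length S)"
proof -
  define Z :: "nat \<Rightarrow> nat set" where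
    "Z l = (\<lambda>(t, i, j). prod_encode (t, prod_encode (i, j))) ` ({..<3} \<times> {..<l} \<times> {..<l + n})" for l
  have fin: "finite (set_encode ` Pow (Z l))" for l by (simp add: Z_def)
  show ?thesis
  proof (intro exI[of _ "\<lambda>l. Suc (Max (set_encode ` Pow (Z l)))"] allI)
    fix H Q and S :: "'v list"
    have "atom_code H Q n S \<in> set_encode ` Pow (Z (length S))"
      unfolding atom_code_def Z_def by (rule imageI, rule PowI, rule atoms_finite)
    then show "atom_code H Q n S < Suc (Max (set_encode ` Pow (Z (length S))))"
      using fin by (simp add: less_Suc_eq_le)
  qed
qed

lemma atom_codeD:
  assumes eq: "atom_code H Q n S = atom_code H Q n S'" and len: "length S = length S'"
    and i: "i < length S"
  shows "j < length S \<Longrightarrow> S ! i = S ! j \<longleftrightarrow> S' ! i = S' ! j"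
    "j < length S \<Longrightarrow> H (S ! i) (S ! j) \<longleftrightarrow> H (S' ! i) (S' ! j)"
    "j < n \<Longrightarrow> S ! i \<in> Q j \<longleftrightarrow> S' ! i \<in> Q j"
proof -
  let ?A = "atoms H Q n"
  have fin: "finite (?A S)" for S by (rule finite_subset[OF atoms_finite]) simp
  have "?A S = ?A S'"
    using eq unfolding atom_code_def by (rule inj_onD[OF inj_on_set_encode]) (use fin in blast)+
  then have *: "x \<in> ?A S \<longleftrightarrow> x \<in> ?A S'" for x by (simp only:)
  have mem: "prod_encode (t, prod_encode (i, j)) \<in> ?A S \<longleftrightarrow> i < length S \<and>
     (t = 0 \<and> j < length S \<and> S ! i = S ! j \<or> t = 1 \<and> j < length S \<and> H (S ! i) (S ! j) \<or> t = 2 \<and> j < n \<and> S ! i \<in> Q j)" for t i j S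
    by (simp add: atoms_def)
  show "j < length S \<Longrightarrow> S ! i = S ! j \<longleftrightarrow> S' ! i = S' ! j"
    using *[of "prod_encode (0, prod_encode (i, j))"] i len unfolding mem by simp
  show "j < length S \<Longrightarrow> H (S ! i) (S ! j) \<longleftrightarrow> H (S' ! i) (S' ! j)"
    using *[of "prod_encode (1, prod_encode (i, j))"] i len unfolding mem by simp
  show "j < n \<Longrightarrow> S ! i \<in> Q j \<longleftrightarrow> S' ! i \<in> Q j"
    using *[of "prod_encode (2, prod_encode (i, j))"] i len unfolding mem by simp
qed

text \<open>The game on a graph \<open>H\<close> with a scattered set \<open>B\<close> compares \<open>(H, u)\<close> with \<open>(H, u')\<close> for \<open>u\<close> and \<open>u'\<close> of
  the same local type in \<open>B\<close>. A pebble close to \<open>u\<close> on one side is answered close to \<open>u'\<close> on the other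
  side and vice versa, every other pebble is copied.\<close>

locale scattered_game =
  fixes V B :: "'v set" and H :: "'v \<Rightarrow> 'v \<Rightarrow> bool" and r n :: nat and Q :: "nat \<Rightarrow> 'v set"
  assumes finV: "finite V" and Hsym: "H u v \<Longrightarrow> H v u"
    and BV: "B \<subseteq> V" and scat: "scattered H (2 * r + 1) B"
    and dist_col: "d \<le> r \<Longrightarrow> \<exists>c<n. Q c = {v\<in>V. \<exists>b\<in>B. near H d b v}"
begin

abbreviation ball :: "nat \<Rightarrow> 'v \<Rightarrow> 'v set" where
  "ball d u \<equiv> {v\<in>V. near H d u v}"

abbreviation ty :: "'v \<Rightarrow> nat \<Rightarrow> 'v list \<Rightarrow> nat" where
  "ty u \<equiv> types (atom_code H Q n) (ball r u)"

definition linked :: "'v list \<Rightarrow> 'v list \<Rightarrow> 'v \<Rightarrow> 'v \<Rightarrow> bool" where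
  "linked S S' x x' \<longleftrightarrow> (\<exists>i<length S. x = S ! i \<and> x' = S' ! i)"

definition distant :: "nat \<Rightarrow> 'v \<Rightarrow> 'v \<Rightarrow> 'v \<Rightarrow> bool" where
  "distant d u u' x \<longleftrightarrow> x \<in> V \<and> \<not> near H d u x \<and> \<not> near H d u' x"

text \<open>\<open>S\<close> and \<open>S'\<close> pair pebbles near \<open>u\<close> with answers
  near \<open>u'\<close>, and \<open>T\<close> and \<open>T'\<close> the other way round. With
  \<open>k\<close> moves left these pebbles are within \<open>d\<close> of their centre and the
  copied ones are farther than \<open>d + 2 ^ k\<close> from both centres. Each move halves the gap:
  a pebble in its lower half enlarges \<open>d\<close>, any other one is copied.\<close>

definition position :: "nat \<Rightarrow> nat \<Rightarrow> nat set \<Rightarrow> (nat \<Rightarrow> 'v) \<Rightarrow> (nat \<Rightarrow> 'v) \<Rightarrow> 'v \<Rightarrow> 'v \<Rightarrow>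
    'v list \<Rightarrow> 'v list \<Rightarrow> 'v list \<Rightarrow> 'v list \<Rightarrow> bool" where
  "position k d X e e' u u' S S' T T' \<longleftrightarrow>
     d + 2 ^ k \<le> r \<and> u \<in> B \<and> u' \<in> B \<and> u \<noteq> u' \<and> length S = length S' \<and> length T = length T' \<and>
     set S \<subseteq> ball d u \<and> set S' \<subseteq> ball d u' \<and> set T \<subseteq> ball d u' \<and> set T' \<subseteq> ball d u \<and>
     ty u k S = ty u' k S' \<and> ty u' k T = ty u k T' \<and>
     (\<forall>x\<in>X. linked S S' (e x) (e' x) \<or> linked T T' (e x) (e' x) \<or>
        e x = e' x \<and> distant (d + 2 ^ k) u u' (e x))"

lemma position_facts:
  assumes pos: "position k d X e e' u u' S S' T T'"
  shows "d + 2 ^ k \<le> r" "u \<in> B" "u' \<in> B" "u \<noteq> u'" "length S = length S'" "length T = length T'"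
     "set S \<subseteq> ball d u" "set S' \<subseteq> ball d u'" "set T \<subseteq> ball d u'" "set T' \<subseteq> ball d u"
     "ty u k S = ty u' k S'" "ty u' k T = ty u k T'"
     "\<And>x. x \<in> X \<Longrightarrow> linked S S' (e x) (e' x) \<or> linked T T' (e x) (e' x) \<or>
        e x = e' x \<and> distant (d + 2 ^ k) u u' (e x)"
  using pos unfolding position_def by blast+

lemma linked_sym: "length S = length S' \<Longrightarrow> linked S S' x x' \<longleftrightarrow> linked S' S x' x"
  unfolding linked_def by (simp only:) blast

text \<open>Of the two symmetries of a position this one exchanges the assignments and
  \<open>position_swap\<close> exchanges the centres. Together they reduce the moves near a centre
  to \<open>position_near\<close> and both directions of the game to
  \<open>position_forth\<close>.\<close>

lemma position_sides:
  assumes "position k d X e e' u u' S S' T T'"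
  shows "position k d X e' e u u' T' T S' S"
proof -
  have p: "length S = length S'" "length T = length T'"
    "\<forall>x\<in>X. linked S S' (e x) (e' x) \<or> linked T T' (e x) (e' x) \<or>
        e x = e' x \<and> distant (d + 2 ^ k) u u' (e x)"
    using assms unfolding position_def by blast+
  have "\<forall>x\<in>X. linked T' T (e' x) (e x) \<or> linked S' S (e' x) (e x) \<or>
        e' x = e x \<and> distant (d + 2 ^ k) u u' (e' x)"
    using p(3) linked_sym[OF p(1)] linked_sym[OF p(2)] by metis
  then show ?thesis using assms unfolding position_def by (simp add: eq_commute)
qed

lemma position_swap:
  assumes "position k d X e e' u u' S S' T T'"
  shows "position k d X e e' u' u T T' S S'"
proof -
  note p = position_facts[OF assms]
  have "distant m u u' = distant m u' u" for m unfolding distant_def by blast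
  then have "\<forall>x\<in>X. linked T T' (e x) (e' x) \<or> linked S S' (e x) (e' x) \<or>
        e x = e' x \<and> distant (d + 2 ^ k) u' u (e x)"
    using p(13) by metis
  with p(1-3) p(4)[symmetric] p(5-12) show ?thesis unfolding position_def by (intro conjI)
qed

lemma ball_mono: "d \<le> d' \<Longrightarrow> ball d u \<subseteq> ball d' u"
  using near_mono[of H d u _ d'] by blast

lemma balls_apart:
  assumes "u \<in> B" "u' \<in> B" "u \<noteq> u'" "near H m u x" "near H l u' y" "m + l \<le> 2 * r"
  shows "x \<noteq> y" "\<not> H x y"
proof -
  have far: "\<not> near H j u u'" if "j \<le> 2 * r + 1" for j
    using scat assms(1-3) near_mono[of H j u u' "2 * r + 1"] that unfolding scattered_def by blast
  have rev: "near H l y u'" by (rule near_sym[OF Hsym assms(5)])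
  show "x \<noteq> y"
  proof
    assume "x = y"
    then have "near H (m + l) u u'" using near_trans[OF assms(4)] rev by blast
    then show False using far[of "m + l"] assms(6) by simp
  qed
  show "\<not> H x y"
  proof
    assume "H x y"
    then have "near H (Suc m + l) u u'" using near_trans[OF near_step[OF assms(4)] rev] by blast
    then show False using far[of "Suc m + l"] assms(6) by simp
  qed
qed

text \<open>Two pebbles from the same list are compared by the types, and two copied ones are
  identical on both sides. In all mixed cases the pebbles are too far apart to be equal or adjacent
  on either side.\<close>

lemma position_atoms:
  assumes pos: "position k d X e e' u u' S S' T T'" and x: "x \<in> X" and y: "y \<in> X"
  shows "e x \<in> V" "e' x \<in> V" "e x = e y \<longleftrightarrow> e' x = e' y" "H (e x) (e y) \<longleftrightarrow> H (e' x) (e' y)"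
    "c < n \<Longrightarrow> e x \<in> Q c \<longleftrightarrow> e' x \<in> Q c"
proof -
  note p = position_facts[OF pos]
  note atS = types_atomic[OF p(11)] and atT = types_atomic[OF p(12)]
  have S: "near H d u (e z)" "near H d u' (e' z)" "e z \<in> V" "e' z \<in> V" if "linked S S' (e z) (e' z)" for z
  proof -
    from that obtain i where i: "i < length S" "e z = S ! i" "e' z = S' ! i" unfolding linked_def by blast
    then have "e z \<in> set S" "e' z \<in> set S'" using p(5) by auto
    then show "near H d u (e z)" "near H d u' (e' z)" "e z \<in> V" "e' z \<in> V" using p(7,8) by auto
  qed
  have T: "near H d u' (e z)" "near H d u (e' z)" "e z \<in> V" "e' z \<in> V" if "linked T T' (e z) (e' z)" for z
  proof -
    from that obtain i where i: "i < length T" "e z = T ! i" "e' z = T' ! i" unfolding linked_def by blast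
    then have "e z \<in> set T" "e' z \<in> set T'" using p(6) by auto
    then show "near H d u' (e z)" "near H d u (e' z)" "e z \<in> V" "e' z \<in> V" using p(9,10) by auto
  qed
  \<comment> \<open>Even with no moves left the gap is one edge wide, enough to exclude adjacency
    between a near and a distant pebble.\<close>
  have d1: "Suc d \<le> d + 2 ^ k" and dr: "d + d \<le> 2 * r" using p(1) by (auto simp: Suc_le_eq)
  have near_far: "a \<noteq> b \<and> \<not> H a b \<and> \<not> H b a"
    if "near H d w a" "distant (d + 2 ^ k) u u' b" "w = u \<or> w = u'" for a b w
  proof -
    have nb: "\<not> near H (d + 2 ^ k) w b" using that(2,3) unfolding distant_def by blast
    have "a \<noteq> b" using near_mono[OF that(1), of "d + 2 ^ k"] nb by auto
    moreover have "\<not> H a b" using near_mono[OF near_step[OF that(1)] d1] nb by blast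
    ultimately show ?thesis using Hsym by blast
  qed
  have cross: "a \<noteq> b \<and> \<not> H a b \<and> \<not> H b a" if "near H d u a" "near H d u' b" for a b
    using balls_apart[OF p(2-4) that dr] Hsym by blast
  show "e x \<in> V" "e' x \<in> V"
    using p(13)[OF x] S(3,4)[of x] T(3,4)[of x] unfolding distant_def by metis+
  have "(e x = e y \<longleftrightarrow> e' x = e' y) \<and> (H (e x) (e y) \<longleftrightarrow> H (e' x) (e' y))"
    using p(13)[OF x]
  proof (elim disjE)
    assume xS: "linked S S' (e x) (e' x)"
    show ?thesis using p(13)[OF y]
    proof (elim disjE)
      assume "linked S S' (e y) (e' y)"
      then show ?thesis using xS atom_codeD(1,2)[OF atS p(5)] unfolding linked_def by metis
    next
      assume "linked T T' (e y) (e' y)"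
      then show ?thesis using cross[OF S(1)[OF xS] T(1)] cross[OF T(2) S(2)[OF xS]] by metis
    next
      assume "e y = e' y \<and> distant (d + 2 ^ k) u u' (e y)"
      then show ?thesis using near_far[OF S(1)[OF xS]] near_far[OF S(2)[OF xS]] by metis
    qed
  next
    assume xT: "linked T T' (e x) (e' x)"
    show ?thesis using p(13)[OF y]
    proof (elim disjE)
      assume "linked S S' (e y) (e' y)"
      then show ?thesis using cross[OF S(1) T(1)[OF xT]] cross[OF T(2)[OF xT] S(2)] by metis
    next
      assume "linked T T' (e y) (e' y)"
      then show ?thesis using xT atom_codeD(1,2)[OF atT p(6)] unfolding linked_def by metis
    next
      assume "e y = e' y \<and> distant (d + 2 ^ k) u u' (e y)"
      then show ?thesis using near_far[OF T(1)[OF xT]] near_far[OF T(2)[OF xT]] by metis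
    qed
  next
    assume xZ: "e x = e' x \<and> distant (d + 2 ^ k) u u' (e x)"
    show ?thesis using p(13)[OF y]
    proof (elim disjE)
      assume "linked S S' (e y) (e' y)"
      then show ?thesis using near_far[OF S(1)] near_far[OF S(2)] xZ by metis
    next
      assume "linked T T' (e y) (e' y)"
      then show ?thesis using near_far[OF T(1)] near_far[OF T(2)] xZ by metis
    next
      assume "e y = e' y \<and> distant (d + 2 ^ k) u u' (e y)"
      then show ?thesis using xZ by simp
    qed
  qed
  then show "e x = e y \<longleftrightarrow> e' x = e' y" "H (e x) (e y) \<longleftrightarrow> H (e' x) (e' y)" by blast+
  show "e x \<in> Q c \<longleftrightarrow> e' x \<in> Q c" if "c < n"
    using p(13)[OF x]
  proof (elim disjE)
    assume "linked S S' (e x) (e' x)"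
    then show ?thesis using atom_codeD(3)[OF atS p(5) _ that] unfolding linked_def by metis
  next
    assume "linked T T' (e x) (e' x)"
    then show ?thesis using atom_codeD(3)[OF atT p(6) _ that] unfolding linked_def by metis
  qed simp
qed

lemma linked_Cons: "linked S S' x x' \<Longrightarrow> linked (v # S) (v' # S') x x'"
  unfolding linked_def
proof (elim exE conjE)
  fix i assume "i < length S" "x = S ! i" "x' = S' ! i"
  then show "\<exists>i<length (v # S). x = (v # S) ! i \<and> x' = (v' # S') ! i"
    by (intro exI[of _ "Suc i"]) simp
qed

lemma finite_ball: "finite (ball d u)"
  using finV by simp

lemma position_near:
  assumes pos: "position (Suc k) d X e e' u u' S S' T T'" and v: "v \<in> V" "near H (d + 2 ^ k) u v"
  shows "\<exists>v'\<in>V. position k (d + 2 ^ k) (insert y X) (e(y := v)) (e'(y := v')) u u' (v # S) (v' # S') T T'"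
proof -
  note p = position_facts[OF pos]
  let ?d = "d + 2 ^ k"
  have dr: "?d \<le> r" "?d + 2 ^ k = d + 2 ^ Suc k" using p(1) by auto
  have "v \<in> ball r u" using v near_mono[OF v(2) dr(1)] by simp
  then obtain v' where v': "v' \<in> ball r u'" "ty u k (v # S) = ty u' k (v' # S')"
    using types_forth[OF p(11) finite_ball finite_ball] by blast
  \<comment> \<open>The type only places the answer within \<open>r\<close> of \<open>u'\<close>.
    The distance colour brings it within \<open>d + 2 ^ k\<close> of some centre in
    \<open>B\<close>, and since the balls of radius \<open>r\<close> around \<open>B\<close> are
    disjoint, this centre is \<open>u'\<close>.\<close>
  obtain c where c: "c < n" "Q c = {v\<in>V. \<exists>b\<in>B. near H ?d b v}" using dist_col[OF dr(1)] by blast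
  have "v \<in> Q c" using c(2) v p(2) by blast
  moreover have "v \<in> Q c \<longleftrightarrow> v' \<in> Q c"
    using atom_codeD(3)[OF types_atomic[OF v'(2)], of 0 c] p(5) c(1) by simp
  ultimately obtain b where b: "b \<in> B" "near H ?d b v'" using c(2) by blast
  have "b = u'"
  proof (rule ccontr)
    assume "b \<noteq> u'"
    then show False using balls_apart(1)[OF b(1) p(3) _ b(2), of r v'] v'(1) dr(1) by auto
  qed
  then have nv': "v' \<in> ball ?d u'" using b v' by simp
  have mono: "ball d w \<subseteq> ball ?d w" for w by (rule ball_mono) simp
  have "linked (v # S) (v' # S') ((e(y := v)) x) ((e'(y := v')) x) \<or> linked T T' ((e(y := v)) x) ((e'(y := v')) x) \<or>
        (e(y := v)) x = (e'(y := v')) x \<and> distant (?d + 2 ^ k) u u' ((e(y := v)) x)" if "x \<in> insert y X" for x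
  proof (cases "x = y")
    case True
    have "linked (v # S) (v' # S') v v'" unfolding linked_def by (rule exI[of _ 0]) simp
    then show ?thesis using True by simp
  next
    case False
    then have "x \<in> X" using that by simp
    then show ?thesis using p(13)[of x] linked_Cons False unfolding dr(2) by auto
  qed
  then have "\<forall>x\<in>insert y X. linked (v # S) (v' # S') ((e(y := v)) x) ((e'(y := v')) x) \<or>
        linked T T' ((e(y := v)) x) ((e'(y := v')) x) \<or>
        (e(y := v)) x = (e'(y := v')) x \<and> distant (?d + 2 ^ k) u u' ((e(y := v)) x)" by blast
  moreover have "ty u' k T = ty u k T'" by (rule types_down[OF finite_ball finite_ball p(12)])
  moreover have "?d + 2 ^ k \<le> r" using p(1) dr(2) by simp
  moreover have "set (v # S) \<subseteq> ball ?d u" "set (v' # S') \<subseteq> ball ?d u'"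
    using subset_trans[OF p(7) mono] subset_trans[OF p(8) mono] v nv' by simp_all
  moreover have "set T \<subseteq> ball ?d u'" "set T' \<subseteq> ball ?d u"
    using subset_trans[OF p(9) mono] subset_trans[OF p(10) mono] by blast+
  moreover have "length (v # S) = length (v' # S')" using p(5) by simp
  moreover note p(2-4) p(6) v'(2)
  ultimately have "position k ?d (insert y X) (e(y := v)) (e'(y := v')) u u' (v # S) (v' # S') T T'"
    unfolding position_def by (intro conjI)
  then show ?thesis using v'(1) by blast
qed

lemma position_forth:
  assumes pos: "position (Suc k) d X e e' u u' S S' T T'" and v: "v \<in> V"
  shows "\<exists>v'\<in>V. \<exists>d S S' T T'. position k d (insert y X) (e(y := v)) (e'(y := v')) u u' S S' T T'"
proof (cases "near H (d + 2 ^ k) u v")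
  case True
  then show ?thesis using position_near[OF pos v] by blast
next
  case nu: False
  show ?thesis
  proof (cases "near H (d + 2 ^ k) u' v")
    case True
    from position_near[OF position_swap[OF pos] v True, where y = y] obtain v' where
      v': "v' \<in> V" "position k (d + 2 ^ k) (insert y X) (e(y := v)) (e'(y := v')) u' u (v # T) (v' # T') S S'"
      by blast
    from position_swap[OF v'(2)] show ?thesis using v'(1) by blast
  next
    case False
    note p = position_facts[OF pos]
    have le: "d + 2 ^ k \<le> d + 2 ^ Suc k" by simp
    have far: "distant (d + 2 ^ k) u u' w" if "distant (d + 2 ^ Suc k) u u' w" for w
      using that near_mono[of H "d + 2 ^ k" u w, OF _ le] near_mono[of H "d + 2 ^ k" u' w, OF _ le]
      unfolding distant_def by blast
    have "linked S S' ((e(y := v)) x) ((e'(y := v)) x) \<or> linked T T' ((e(y := v)) x) ((e'(y := v)) x) \<or>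
        (e(y := v)) x = (e'(y := v)) x \<and> distant (d + 2 ^ k) u u' ((e(y := v)) x)" if "x \<in> insert y X" for x
    proof (cases "x = y")
      case True
      then show ?thesis using nu False v by (simp add: distant_def)
    next
      case ne: False
      then have "x \<in> X" using that by simp
      then show ?thesis using p(13)[of x] far[of "e x"] ne by auto
    qed
    then have "\<forall>x\<in>insert y X. linked S S' ((e(y := v)) x) ((e'(y := v)) x) \<or>
        linked T T' ((e(y := v)) x) ((e'(y := v)) x) \<or>
        (e(y := v)) x = (e'(y := v)) x \<and> distant (d + 2 ^ k) u u' ((e(y := v)) x)" by blast
    moreover have "ty u k S = ty u' k S'" "ty u' k T = ty u k T'"
      using types_down[OF finite_ball finite_ball p(11)] types_down[OF finite_ball finite_ball p(12)] by blast+
    moreover have "d + 2 ^ k \<le> r" using le p(1) by linarith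
    moreover note p(2-10)
    ultimately have "position k d (insert y X) (e(y := v)) (e'(y := v)) u u' S S' T T'"
      unfolding position_def by (intro conjI)
    then show ?thesis using v by blast
  qed
qed

text \<open>The game is played on the flipped graph \<open>H\<close>, while the formula speaks about
  \<open>G\<close>. The assumption on \<open>adj\<close> expresses that the colours undo the
  flips.\<close>

lemma position_sat:
  assumes "pverts G = V"
    and adj: "\<And>a b a' b'. a \<in> V \<Longrightarrow> b \<in> V \<Longrightarrow> a' \<in> V \<Longrightarrow> b' \<in> V \<Longrightarrow> (a = b \<longleftrightarrow> a' = b') \<Longrightarrow> H a b = H a' b' \<Longrightarrow>
       (\<And>c. c < n \<Longrightarrow> a \<in> Q c \<longleftrightarrow> a' \<in> Q c) \<Longrightarrow> (\<And>c. c < n \<Longrightarrow> b \<in> Q c \<longleftrightarrow> b' \<in> Q c) \<Longrightarrow> adj G a b = adj G a' b'"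
    and "position k d X e e' u u' S S' T T'" "depth \<phi> \<le> k" "fv \<phi> \<subseteq> X" "\<And>i. i \<in> preds \<phi> \<Longrightarrow> \<exists>c<n. Q c = P i"
  shows "sat (G, P) e \<phi> = sat (G, P) e' \<phi>"
  using assms(3-)
proof (induction \<phi> arbitrary: k d X e e' S S' T T')
  case (Equal x y)
  have "x \<in> X" "y \<in> X" using Equal.prems(3) by auto
  then show ?case using position_atoms(3)[OF Equal.prems(1)] by simp
next
  case (Adj x y)
  have xy: "x \<in> X" "y \<in> X" using Adj.prems(3) by auto
  note px = position_atoms[OF Adj.prems(1) xy] and py = position_atoms[OF Adj.prems(1) xy(2,1)]
  have "adj G (e x) (e y) = adj G (e' x) (e' y)"
    by (rule adj[OF px(1) py(1) px(2) py(2) px(3) px(4) px(5) py(5)])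
  then show ?case by (simp add: adj_def)
next
  case (Pred i x)
  have "x \<in> X" using Pred.prems(3) by auto
  moreover obtain c where "c < n" "Q c = P i" using Pred.prems(4)[of i] by auto
  ultimately show ?case using position_atoms(5)[OF Pred.prems(1), of x x c] by simp
next
  case (Neg \<phi>)
  have "sat (G, P) e \<phi> = sat (G, P) e' \<phi>"
    by (rule Neg.IH[OF Neg.prems(1)]) (use Neg.prems(2-4) in auto)
  then show ?case by simp
next
  case (Conj \<phi> \<psi>)
  have "sat (G, P) e \<phi> = sat (G, P) e' \<phi>"
    by (rule Conj.IH(1)[OF Conj.prems(1)]) (use Conj.prems(2-4) in auto)
  moreover have "sat (G, P) e \<psi> = sat (G, P) e' \<psi>"
    by (rule Conj.IH(2)[OF Conj.prems(1)]) (use Conj.prems(2-4) in auto)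
  ultimately show ?case by simp
next
  case (Exists y \<phi>)
  obtain l where l: "k = Suc l" "depth \<phi> \<le> l" using Exists.prems(2) by (cases k) auto
  have fv: "fv \<phi> \<subseteq> insert y X" using Exists.prems(3) by auto
  have step: "\<exists>v'\<in>V. sat (G, P) (f'(y := v')) \<phi>"
    if pos: "position k d X f f' u u' S S' T T'" and v: "v \<in> V" "sat (G, P) (f(y := v)) \<phi>" for f f' S S' T T' v
  proof -
    obtain v' d S S' T T' where v': "v' \<in> V" "position l d (insert y X) (f(y := v)) (f'(y := v')) u u' S S' T T'"
      using position_forth[OF pos[unfolded l(1)] v(1)] by blast
    have "sat (G, P) (f(y := v)) \<phi> = sat (G, P) (f'(y := v')) \<phi>"
      by (rule Exists.IH[OF v'(2) l(2) fv]) (use Exists.prems(4) in simp)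
    then show ?thesis using v(2) v'(1) by blast
  qed
  have "(\<exists>v\<in>V. sat (G, P) (e(y := v)) \<phi>) \<longleftrightarrow> (\<exists>v\<in>V. sat (G, P) (e'(y := v)) \<phi>)"
    using step[OF Exists.prems(1)] step[OF position_sides[OF Exists.prems(1)]] by blast
  then show ?case using assms(1) by simp
qed

end

section \<open>Flip-wide classes are monadically stable\<close>

lemma flip_wide_imp_var_stable:
  fixes C :: "'v pair_pre_digraph set"
  assumes fw: "flip_wide C" and pgC: "\<forall>G\<in>C. pair_graph G"
  shows "var_stable C {z}"
  unfolding var_stable_def
proof
  fix \<phi>
  define k where "k = depth \<phi>"
  \<comment> \<open>The initial gap, since it is halved once per nested quantifier.\<close>
  define r :: nat where "r = 2 ^ k"
  from fw[unfolded flip_wide_def, THEN spec, of "2 * r + 1"] obtain Nf s where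
    Nf: "\<forall>m. \<forall>G\<in>C. \<forall>A. A \<subseteq> pverts G \<and> Nf m \<le> card A \<longrightarrow>
       (\<exists>F B. F \<subseteq> flips G \<and> finite F \<and> card F \<le> s \<and> B \<subseteq> A \<and> m \<le> card B \<and> dist_independent (G \<oplus>\<^sub>F F) (2 * r + 1) B)"
    by (elim exE)
  obtain pn where pn: "preds \<phi> \<subseteq> {..<pn}" using finite_nat_iff_bounded finite_preds by blast
  \<comment> \<open>The colours are the predicates of \<open>\<phi>\<close>, the sets that code the
    flips, and one colour for each distance from 0 to \<open>r\<close> to the scattered set.\<close>
  define n where "n = pn + 2 * s + (r + 1)"
  from atom_code_bounded[of n, where 'v = 'v] obtain a where
    a: "\<forall>H Q S. atom_code H Q n (S :: 'v list) < a (length S)" ..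
  from types_bounded[of a 1 k, where 'v = 'v] obtain M where
    M: "\<forall>atm (L :: 'v set) S. (\<forall>S. atm S < a (length S)) \<longrightarrow> finite L \<longrightarrow> length S = 1 \<longrightarrow> types atm L k S < M" ..
  define q where "q = card (fv \<phi>)"
  \<comment> \<open>Among this many scattered vertices more than \<open>2 * q + 1\<close> share one
    local type.\<close>
  define m where "m = Suc (M * (2 * q + 1))"
  define h where "h = Suc (Nf m)"
  show "\<exists>h. \<forall>G\<in>C. \<forall>P. (\<forall>i. P i \<subseteq> pverts G) \<longrightarrow> \<not> ladder h (split_sat (G, P) {z} \<phi>)"
  proof (intro exI[of _ h] ballI allI impI notI)
    fix G and P :: "nat \<Rightarrow> 'v set" assume G: "G \<in> C" and P: "\<forall>i. P i \<subseteq> pverts G"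
    let ?V = "pverts G"
    have pg: "pair_graph G" using pgC G by blast
    have finV: "finite ?V" using adj_facts[OF pg] by blast
    assume "ladder h (split_sat (G, P) {z} \<phi>)"
    then obtain e f where lad: "\<forall>i\<in>{1..h}. \<forall>j\<in>{1..h}. split_sat (G, P) {z} \<phi> (e i) (f j) \<longleftrightarrow> i \<le> j"
      unfolding ladder_def by (elim exE)
    define b where "b i = e i z" for i
    have ran: "range (e i) \<subseteq> ?V" "range (f i) \<subseteq> ?V" if "i \<in> {1..h}" for i
    proof -
      have "split_sat (G, P) {z} \<phi> (e i) (f i)" using lad that by blast
      then show "range (e i) \<subseteq> ?V" "range (f i) \<subseteq> ?V" by (simp_all add: split_sat_def)
    qed
    have bV: "b i \<in> ?V" if "i \<in> {1..h}" for i using ran(1)[OF that] by (auto simp: b_def)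
    have fV: "f i y \<in> ?V" if "i \<in> {1..h}" for i y using ran(2)[OF that] by auto
    have val: "sat (G, P) ((f j)(z := b i)) \<phi> \<longleftrightarrow> i \<le> j" if ij: "i \<in> {1..h}" "j \<in> {1..h}" for i j
    proof -
      have "(\<lambda>x. if x \<in> {z} then e i x else f j x) = (f j)(z := b i)" by (auto simp: b_def)
      moreover have "split_sat (G, P) {z} \<phi> (e i) (f j) \<longleftrightarrow> i \<le> j" using lad ij by blast
      ultimately show ?thesis using ran(1)[OF ij(1)] ran(2)[OF ij(2)] unfolding split_sat_def fst_conv by simp
    qed
    have binj: "inj_on b {1..h}"
    proof (rule inj_onI)
      fix i j assume ij: "i \<in> {1..h}" "j \<in> {1..h}" "b i = b j"
      have "i \<le> j" using val[OF ij(1,2)] val[OF ij(2,2)] ij(3) by simp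
      moreover have "j \<le> i" using val[OF ij(2,1)] val[OF ij(1,1)] ij(3) by simp
      ultimately show "i = j" by simp
    qed
    define A where "A = b ` {1..h}"
    have "card A = h" using binj by (simp add: A_def card_image)
    then have A: "A \<subseteq> ?V \<and> Nf m \<le> card A" using bV by (auto simp: A_def h_def)
    from Nf[THEN spec, THEN bspec, OF G, THEN spec, THEN mp, OF A]
    obtain F B where F: "F \<subseteq> flips G" "finite F" "card F \<le> s"
      and B: "B \<subseteq> A" "m \<le> card B" "dist_independent (G \<oplus>\<^sub>F F) (2 * r + 1) B" by (elim exE conjE)
    note pg' = pair_graph_apply_flips(1)[OF pg F(2)]
    obtain D where D: "coded (2 * s) ?V D" and adjD: "adj (G \<oplus>\<^sub>F F) = xadj G D"
      using flips_coded[OF pg F(2,3)] by blast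
    define H where "H = adj (G \<oplus>\<^sub>F F)"
    obtain PD where PD: "\<And>v v' w w'. v \<in> ?V \<Longrightarrow> v' \<in> ?V \<Longrightarrow> w \<in> ?V \<Longrightarrow> w' \<in> ?V \<Longrightarrow>
      (\<And>i. i < 2 * s \<Longrightarrow> v \<in> PD i \<longleftrightarrow> v' \<in> PD i) \<Longrightarrow> (\<And>i. i < 2 * s \<Longrightarrow> w \<in> PD i \<longleftrightarrow> w' \<in> PD i) \<Longrightarrow> D v w = D v' w'"
      using codedE[OF D] by metis
    define Q where "Q c = (if c < pn then P c else if c < pn + 2 * s then PD (c - pn)
       else {v\<in>?V. \<exists>b\<in>B. near H (c - (pn + 2 * s)) b v})" for c
    have BV: "B \<subseteq> ?V" using B(1) A by blast
    interpret scattered_game ?V B H r n Q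
    proof
      show "finite ?V" by (rule finV)
      show "H u v \<Longrightarrow> H v u" for u v unfolding H_def by (rule adj_facts(5)[OF pg'])
      show "B \<subseteq> ?V" by (rule BV)
      show "scattered H (2 * r + 1) B" using B(3) dist_independent_iff[OF pg'] unfolding H_def by blast
      show "\<exists>c<n. Q c = {v\<in>?V. \<exists>b\<in>B. near H d b v}" if "d \<le> r" for d
        using that by (intro exI[of _ "pn + 2 * s + d"]) (simp add: Q_def n_def)
    qed
    have finB: "finite B" using BV finV finite_subset by blast
    have "ty x k [x] < M" for x using M a finite_ball[of r x] by simp
    then have img: "(\<lambda>x. ty x k [x]) ` B \<subseteq> {..<M}" by auto
    have "card {..<M} * (2 * q + 1) < card B" using B(2) by (simp add: m_def)
    then obtain t where "t \<in> {..<M}" and t: "2 * q + 1 < card {x\<in>B. ty x k [x] = t}"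
      by (rule pigeonhole_fibre[OF finB finite_lessThan img])
    define J where "J = {i\<in>{1..h}. b i \<in> B \<and> ty (b i) k [b i] = t}"
    have "b ` J = {x\<in>B. ty x k [x] = t}" using B(1) by (auto simp: J_def A_def)
    moreover have "inj_on b J" by (rule inj_on_subset[OF binj]) (auto simp: J_def)
    ultimately have cardJ: "2 * q + 1 < card J" using t card_image by metis
    have finJ: "finite J" by (simp add: J_def)
    obtain g where g: "strict_mono_on {..<card J} g" "g ` {..<card J} = J"
      by (rule finite_nat_enum[OF finJ refl])
    have gJ: "g i \<in> J" if "i < 2 * q + 2" for i using g(2) cardJ that by auto
    have Jh: "i \<in> {1..h}" "b i \<in> B" "ty (b i) k [b i] = t" if "i \<in> J" for i using that by (auto simp: J_def)
    have bne: "b i \<noteq> b j" if "i \<in> J" "j \<in> J" "i \<noteq> j" for i j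
      using inj_onD[OF binj _ Jh(1) Jh(1)] that by blast
    \<comment> \<open>The middle of \<open>2 * q + 2\<close> indices of equal type:
      \<open>q + 1\<close> of them are at most \<open>j0\<close> and \<open>q + 1\<close> are
      larger.\<close>
    define j0 where "j0 = g q"
    have j0: "j0 \<in> {1..h}" using Jh(1)[OF gJ[of q]] by (simp add: j0_def)
    \<comment> \<open>The balls are disjoint, so each free variable accounts for at most one index
      here. Hence an index outside \<open>T\<close> remains on each side of
      \<open>j0\<close>.\<close>
    define T where "T = {i\<in>J. \<exists>y\<in>fv \<phi>. near H r (b i) (f j0 y)}"
    have "\<forall>i\<in>T. \<exists>y. y \<in> fv \<phi> \<and> near H r (b i) (f j0 y)" by (auto simp: T_def)
    from bchoice[OF this] obtain w where w: "\<forall>i\<in>T. w i \<in> fv \<phi> \<and> near H r (b i) (f j0 (w i))" ..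
    have "inj_on w T"
    proof (rule inj_onI, rule ccontr)
      fix i j assume ij: "i \<in> T" "j \<in> T" "w i = w j" "i \<noteq> j"
      then have "b i \<noteq> b j" "b i \<in> B" "b j \<in> B" using bne Jh(2) by (auto simp: T_def)
      moreover have "near H r (b i) (f j0 (w i))" "near H r (b j) (f j0 (w i))" using w ij by auto
      ultimately show False using balls_apart(1)[of "b i" "b j" r "f j0 (w i)" r "f j0 (w i)"] by simp
    qed
    then have cardT: "card T \<le> q" unfolding q_def
      by (rule card_inj_on_le) (use w finite_fv in auto)
    have finT: "finite T" using finJ by (simp add: T_def)
    have ginj: "inj_on g I" if "I \<subseteq> {..<2 * q + 2}" for I
      by (rule inj_on_subset[OF strict_mono_on_imp_inj_on[OF g(1)]]) (use that cardJ in auto)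
    have free: "\<exists>p\<in>I. g p \<notin> T" if "card I = Suc q" "I \<subseteq> {..<2 * q + 2}" for I
    proof (rule ccontr)
      assume "\<not> ?thesis"
      then have "g ` I \<subseteq> T" by blast
      then have "card (g ` I) \<le> card T" by (rule card_mono[OF finT])
      then show False using card_image[OF ginj[OF that(2)]] that(1) cardT by simp
    qed
    have "\<exists>p\<in>{..q}. g p \<notin> T" by (rule free) auto
    then obtain p where p: "p \<le> q" "g p \<notin> T" by auto
    have "\<exists>p\<in>{Suc q..<2 * q + 2}. g p \<notin> T" by (rule free) auto
    then obtain p' where "p' \<in> {Suc q..<2 * q + 2}" "g p' \<notin> T" by (elim bexE)
    then have p': "q < p'" "p' < 2 * q + 2" "g p' \<notin> T" by simp_all
    have pJ: "g p \<in> J" "g p' \<in> J" using gJ p p' by auto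
    have le: "g p \<le> j0" "j0 < g p'"
      using strict_mono_on_leD[OF g(1), of p q] strict_mono_onD[OF g(1), of q p'] p p' cardJ by (auto simp: j0_def)
    let ?u = "b (g p)" and ?u' = "b (g p')"
    have uu: "?u \<in> B" "?u' \<in> B" "?u \<noteq> ?u'" using Jh(2) pJ bne le by auto
    \<comment> \<open>The second pair of lists starts with the centres as well, although no variable
      has to point to \<open>u'\<close> on the left: their equal types let moves near
      \<open>u'\<close> be answered near \<open>u\<close>.\<close>
    have pos: "position k 0 (fv \<phi>) ((f j0)(z := ?u)) ((f j0)(z := ?u')) ?u ?u' [?u] [?u'] [?u'] [?u]"
      unfolding position_def
    proof (intro conjI ballI)
      show "0 + 2 ^ k \<le> r" by (simp add: r_def)
      show "ty ?u k [?u] = ty ?u' k [?u']" "ty ?u' k [?u'] = ty ?u k [?u]" using Jh(3) pJ by simp_all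
      fix x assume x: "x \<in> fv \<phi>"
      show "linked [?u] [?u'] (((f j0)(z := ?u)) x) (((f j0)(z := ?u')) x) \<or>
        linked [?u'] [?u] (((f j0)(z := ?u)) x) (((f j0)(z := ?u')) x) \<or>
        ((f j0)(z := ?u)) x = ((f j0)(z := ?u')) x \<and> distant (0 + 2 ^ k) ?u ?u' (((f j0)(z := ?u)) x)"
      proof (cases "x = z")
        case True
        then show ?thesis by (simp add: linked_def)
      next
        case False
        have "\<not> near H r ?u (f j0 x)" "\<not> near H r ?u' (f j0 x)" using x p(2) p'(3) pJ unfolding T_def by blast+
        then show ?thesis using False fV[OF j0] by (simp add: distant_def r_def)
      qed
    qed (use uu BV in auto)
    have "sat (G, P) ((f j0)(z := ?u)) \<phi> = sat (G, P) ((f j0)(z := ?u')) \<phi>"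
    proof (rule position_sat[OF refl _ pos])
      fix x y x' y'
      assume V: "x \<in> ?V" "y \<in> ?V" "x' \<in> ?V" "y' \<in> ?V" and eq: "x = y \<longleftrightarrow> x' = y'" and Heq: "H x y = H x' y'"
        and cx: "\<And>c. c < n \<Longrightarrow> x \<in> Q c \<longleftrightarrow> x' \<in> Q c" and cy: "\<And>c. c < n \<Longrightarrow> y \<in> Q c \<longleftrightarrow> y' \<in> Q c"
      have "D x y = D x' y'"
      proof (rule PD[OF V(1,3,2,4)])
        show "x \<in> PD i \<longleftrightarrow> x' \<in> PD i" "y \<in> PD i \<longleftrightarrow> y' \<in> PD i" if "i < 2 * s" for i
          using cx[of "pn + i"] cy[of "pn + i"] that by (simp_all add: Q_def n_def)
      qed
      moreover have "xadj G D x y = xadj G D x' y'" using Heq unfolding H_def adjD .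
      ultimately show "adj G x y = adj G x' y'"
        using eq V adj_facts(4)[OF pg] unfolding xadj_def by metis
    next
      show "depth \<phi> \<le> k" by (simp add: k_def)
      show "fv \<phi> \<subseteq> fv \<phi>" ..
      fix i assume "i \<in> preds \<phi>"
      then have "i < pn" using pn by blast
      then show "\<exists>c<n. Q c = P i" by (intro exI[of _ i]) (simp add: Q_def n_def)
    qed
    then show False using val[OF Jh(1)[OF pJ(1)] j0] val[OF Jh(1)[OF pJ(2)] j0] le by simp
  qed
qed

theorem theorem5p5:
  fixes C :: "'v pair_pre_digraph set"
  assumes "\<forall>G\<in>C. pair_graph G"
  shows "monadically_stable C \<longleftrightarrow> flip_wide C"
proof
  show "flip_wide C" if "monadically_stable C"
    using stable_imp_flip_wide[OF that assms] .
  show "monadically_stable C" if "flip_wide C"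
    using flip_wide_imp_var_stable[OF that assms] by (rule var_stable_imp_monadically_stable)
qed

end
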